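(* Let $m,n\in\mathbb R$, $\mathcal B>0$, $q=m-n+1$, $X>0$. Let $h_{\rm ss}\in C^4(\mathbb R)$ be a non-constant positive $X$-periodic steady state of $h_t=-(h^nh_{xxx})_x-\mathcal B(h^mh_x)_x$. Translate $h_{\rm ss}$ to put its minimum at $x=0$, so that $h_{\rm ss}$ rescales to $k_\alpha$ for some $\alpha\in(0,1)$ (rescaling as in the context). (1) If $q<1$ or $q>2$ then $h_{\rm ss}$ is energy unstable (at period $X$) in the directions $u=\pm h_{\rm ss}'$ and $u=\pm h_{\rm ss}''$. (2) If $q=2$, or if $q>1$ and $E'(\alpha)>0$, then $h_{\rm ss}$ is energy unstable (at period $X$).
   Context: A positive periodic steady state is a positive periodic $C^4$ function with $(h^nh'''+\mathcal B h^mh')'=0$ classically. Rescaling: a non-constant positive periodic steady state $h_{\rm ss}$ satisfies, for some constant $D$, $h_{\rm ss}''+\frac{\mathcal B h_{\rm ss}^q-D}{q}=0$ if $q\ne0$ (and then $D>0$), or $h_{\rm ss}''+\mathcal B\log h_{\rm ss}-D=0$ if $q=0$. With the minimum of $h_{\rm ss}$ at $x=0$, put $k(x)=(\mathcal B/D)^{1/q}\,h_{\rm ss}\big((D/\mathcal B)^{1/(2q)}D^{-1/2}x\big)$ if $q\neq0$, and $k(x)=e^{-D/\mathcal B}h_{\rm ss}\big(e^{D/(2\mathcal B)}\mathcal B^{-1/2}x\big)$ if $q=0$. Then $k=k_\alpha$ with $\alpha=\min k\in(0,1)$; this is what "$h_{\rm ss}$ rescales to $k_\alpha$" means. For $\alpha\in(0,1)$,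 $k_\alpha$ is the unique smooth positive periodic solution of $k''+\frac{k^q-1}{q}=0$ (if $q\ne0$) or $k''+\log k=0$ (if $q=0$) with $k(0)=\alpha$, $k'(0)=0$. $P(\alpha)$ is its least period, $A(\alpha)=\int_0^{P(\alpha)}k_\alpha\,dx$, and $E(\alpha)=P(\alpha)^{3-q}A(\alpha)^{q-1}$; these are smooth functions of $\alpha\in(0,1)$. Energy at period $X$: for positive $\ell\in H^1(\mathbb T_X)$ ($\mathbb T_X$ the circle of circumference $X$), $\mathcal E(\ell)=\int_0^X[\frac12(\ell')^2-H(\ell)]dx$, where $H$ is a fixed function on $(0,\infty)$ with $H''(y)=\mathcal B y^{q-1}$. For a mean-zero $X$-periodic $u$, $h_{\rm ss}$ is energy unstable in the direction $u$ if $\mathcal E(h_{\rm ss}+\varepsilon u)<\mathcal E(h_{\rm ss})$ for all sufficiently small $\varepsilon>0$; $h_{\rm ss}$ is energy unstable at period $X$ if this holds for some smooth $X$-periodic $u$ of mean zero. *)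

theory Defs
  imports "HOL-Analysis.Analysis"
begin

definition Ck :: "nat \<Rightarrow> (real \<Rightarrow> real) \<Rightarrow> bool" where
  "Ck k f \<longleftrightarrow>
     (\<forall>j<k. \<forall>x. (deriv ^^ j) f differentiable (at x)) \<and>
     continuous_on UNIV ((deriv ^^ k) f)"

definition smooth :: "(real \<Rightarrow> real) \<Rightarrow> bool" where
  "smooth f \<longleftrightarrow> (\<forall>k. Ck k f)"

definition has_period :: "real \<Rightarrow> (real \<Rightarrow> real) \<Rightarrow> bool" where
  "has_period X f \<longleftrightarrow> (\<forall>x. f (x + X) = f x)"

definition steady_state :: "real \<Rightarrow> real \<Rightarrow> real \<Rightarrow> real \<Rightarrow> (real \<Rightarrow> real) \<Rightarrow> bool" where
  "steady_state B m n X h \<longleftrightarrow>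
     Ck 4 h \<and> (\<forall>x. h x > 0) \<and> has_period X h \<and>
     (\<forall>x. ((\<lambda>y. h y powr n * (deriv ^^ 3) h y + B * h y powr m * deriv h y)
            has_real_derivative 0) (at x))"

text \<open>The profile \<open>k\<^sub>\<alpha>\<close>; the description is meaningful for \<open>0 < \<alpha> < 1\<close>, where there is
  exactly one such solution. Note that \<open>k'(0) = 0\<close> and \<open>\<alpha> < 1\<close> make 0 a minimum point.\<close>

definition k_prof :: "real \<Rightarrow> real \<Rightarrow> real \<Rightarrow> real" where
  "k_prof q \<alpha> = (THE k. smooth k \<and> (\<forall>x. k x > 0) \<and> (\<exists>p>0. has_period p k) \<and>
     (\<forall>x. deriv (deriv k) x + (if q = 0 then ln (k x) else (k x powr q - 1) / q) = 0) \<and>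
     k 0 = \<alpha> \<and> deriv k 0 = 0)"

definition P_per :: "real \<Rightarrow> real \<Rightarrow> real" where
  "P_per q \<alpha> = (LEAST p. p > 0 \<and> has_period p (k_prof q \<alpha>))"

definition A_area :: "real \<Rightarrow> real \<Rightarrow> real" where
  "A_area q \<alpha> = integral {0..P_per q \<alpha>} (k_prof q \<alpha>)"

definition E_fun :: "real \<Rightarrow> real \<Rightarrow> real" where
  "E_fun q \<alpha> = P_per q \<alpha> powr (3 - q) * A_area q \<alpha> powr (q - 1)"

definition rescaled :: "real \<Rightarrow> real \<Rightarrow> real \<Rightarrow> (real \<Rightarrow> real) \<Rightarrow> real \<Rightarrow> real" where
  "rescaled B q D h x =
     (if q = 0 then exp (- D / B) * h (exp (D / (2 * B)) * B powr (-1/2) * x)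
      else (B / D) powr (1 / q) * h ((D / B) powr (1 / (2 * q)) * D powr (-1/2) * x))"

text \<open>To be applied to \<open>h\<close> with its minimum at 0. The constant \<open>D\<close> is determined by \<open>h\<close>
  through the differential equation.\<close>

definition rescales_to :: "real \<Rightarrow> real \<Rightarrow> (real \<Rightarrow> real) \<Rightarrow> real \<Rightarrow> bool" where
  "rescales_to B q h \<alpha> \<longleftrightarrow> 0 < \<alpha> \<and> \<alpha> < 1 \<and>
     (\<exists>D. (q \<noteq> 0 \<longrightarrow> D > 0) \<and>
        (\<forall>x. deriv (deriv h) x +
           (if q = 0 then B * ln (h x) - D else (B * h x powr q - D) / q) = 0) \<and>
        rescaled B q D h = k_prof q \<alpha> \<and>
        rescaled B q D h 0 = \<alpha> \<and> (\<forall>x. \<alpha> \<le> rescaled B q D h x))"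

text \<open>\<open>H\<close> is only constrained on the positive half line, and only its second derivative
  is prescribed.\<close>

definition potential :: "real \<Rightarrow> real \<Rightarrow> (real \<Rightarrow> real) \<Rightarrow> bool" where
  "potential B q H \<longleftrightarrow>
     (\<forall>y>0. H differentiable (at y) \<and>
            (deriv H has_real_derivative B * y powr (q - 1)) (at y))"

text \<open>\<open>H\<^sup>1\<close> of the circle of circumference \<open>X\<close>, as the \<open>X\<close>-periodic absolutely continuous
  functions on the line whose derivative \<open>g\<close> is square integrable over a period. The
  derivative \<open>g\<close> agrees almost everywhere with \<open>deriv u\<close>.\<close>

definition H1_circle :: "real \<Rightarrow> (real \<Rightarrow> real) \<Rightarrow> bool" where
  "H1_circle X u \<longleftrightarrow> has_period X u \<and>
     (\<exists>g. g absolutely_integrable_on {0..X} \<and> (\<lambda>x. (g x)\<^sup>2) integrable_on {0..X} \<and>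
          (\<forall>x\<in>{0..X}. u x = u 0 + integral {0..x} g))"

definition energy :: "(real \<Rightarrow> real) \<Rightarrow> real \<Rightarrow> (real \<Rightarrow> real) \<Rightarrow> real" where
  "energy H X l = integral {0..X} (\<lambda>x. (deriv l x)\<^sup>2 / 2 - H (l x))"

text \<open>An \<open>H\<^sup>1\<close> perturbation \<open>u\<close> is bounded, so \<open>h + \<epsilon> u\<close> is positive for small \<open>\<epsilon>\<close>.\<close>

definition energy_unstable_dir ::
    "(real \<Rightarrow> real) \<Rightarrow> real \<Rightarrow> (real \<Rightarrow> real) \<Rightarrow> (real \<Rightarrow> real) \<Rightarrow> bool" where
  "energy_unstable_dir H X h u \<longleftrightarrow>
     H1_circle X u \<and> integral {0..X} u = 0 \<and>
     (\<forall>\<^sub>F \<epsilon> in at_right 0. energy H X (\<lambda>x. h x + \<epsilon> * u x) < energy H X h)"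

definition energy_unstable :: "(real \<Rightarrow> real) \<Rightarrow> real \<Rightarrow> (real \<Rightarrow> real) \<Rightarrow> bool" where
  "energy_unstable H X h \<longleftrightarrow> (\<exists>u. smooth u \<and> energy_unstable_dir H X h u)"

end

theory Submission
  imports Defs
begin

text \<open>
  Integrating the steady state equation once, periodicity makes the flux vanish, so
  \<open>h''' + B h\<^sup>q\<^sup>-\<^sup>1 h' = 0\<close> and \<open>h\<close> is a critical point of the energy on functions of fixed mean.
  Instability is read off the Taylor expansion of the energy at \<open>h + \<epsilon> u\<close> up to order four. For
  \<open>u = \<plusminus>h'\<close> the orders two and three vanish and the fourth is \<open>- B (q-1)(q-2)/24 \<integral> h\<^sup>q\<^sup>-\<^sup>3 h'\<^sup>4\<close>;
  for \<open>u = \<plusminus>h''\<close> the second variation is \<open>- B (q-1)(q-2)/3 \<integral> h\<^sup>q\<^sup>-\<^sup>3 h'\<^sup>4\<close>.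

  For \<open>q > 1\<close> and \<open>E'(\<alpha>) > 0\<close>, rescale \<open>k\<^sub>\<beta>\<close> with \<open>\<beta>\<close> slightly above \<open>\<alpha>\<close> to the period of \<open>k = k\<^sub>\<alpha>\<close>
  and let \<open>w\<close> be the difference. Then \<open>w'' + k\<^sup>q\<^sup>-\<^sup>1 w = d + O(w\<^sup>2)\<close> with a constant \<open>d\<close>, and the second
  variation at \<open>w + c\<close>, with \<open>c\<close> making the mean zero, is \<open>d \<integral>w - c\<^sup>2 \<integral>k\<^sup>q\<^sup>-\<^sup>1 + O(w\<^sup>3)\<close>. Here \<open>\<integral>w\<close> is
  positive of order \<open>\<beta> - \<alpha>\<close> because \<open>E' > 0\<close>, and \<open>d \<le> 0\<close> because the period decreases in \<open>\<beta>\<close>.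
  In polar coordinates of the phase plane the period is \<open>\<integral> \<lambda>(\<rho> cos \<theta>) d\<theta>\<close> over a full turn, where
  \<open>\<lambda>(s) + (q-1)s/3\<close> increases with \<open>\<bar>s\<bar>\<close> on either side of zero, which gives the monotonicity.
\<close>

section \<open>Periodic and smooth functions\<close>

text \<open>The direction suggested by \<open>E' > 0\<close> is the derivative in \<beta> of the
  rescaled profiles. A finite difference takes its place, controlled by Lipschitz bounds in \<beta>:
  the gain c^2 * K is quadratic in \<beta> - \<alpha> with a coefficient bounded below, the error of
  the linearisation is cubic, and of the term d * I only the sign matters. Hence weak monotonicity
  of the period is enough. The weight (q-1)/3 is minus the slope of \<lambda> at s = 0, that is,
  \<lambda>(s) = 1 - (q-1)s/3 + ... Adding the linear term cancels the first order and leaves a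
  function with its minimum at 0. The addition costs nothing in the period, since the integral of
  cos over a full turn is zero. \<open>X\<close> may contain several least periods of the steady
  state. The perturbation is built on the least period of the profile and then repeated.\<close>

lemma antiderivative_exists:
  fixes f :: "real \<Rightarrow> real"
  assumes "continuous_on UNIV f"
  shows "\<exists>F. \<forall>x. (F has_real_derivative f x) (at x)"
proof -
  have "\<exists>F. \<forall>x. -\<infinity> < ereal x \<longrightarrow> ereal x < \<infinity> \<longrightarrow> (F has_vector_derivative f x) (at x)"
    by (rule einterval_antiderivative)
       (use assms in \<open>auto simp: continuous_on_eq_continuous_at\<close>)
  then show ?thesis
    by (auto simp: has_real_derivative_iff_has_vector_derivative)
qed

lemma has_integral_antiderivative:
  fixes f F :: "real \<Rightarrow> real"
  assumes "a \<le> b" "\<And>x. (F has_real_derivative f x) (at x)"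
  shows "(f has_integral (F b - F a)) {a..b}"
  using assms
  by (intro fundamental_theorem_of_calculus)
     (auto simp: has_real_derivative_iff_has_vector_derivative[symmetric] has_field_derivative_at_within)

lemma integral_antiderivative:
  fixes f F :: "real \<Rightarrow> real"
  assumes "a \<le> b" "\<And>x. (F has_real_derivative f x) (at x)"
  shows "integral {a..b} f = F b - F a"
  using has_integral_antiderivative[OF assms] by (rule integral_unique)

lemma has_period_deriv:
  assumes "has_period X f" "\<And>x. (f has_real_derivative f' x) (at x)"
  shows "has_period X f'"
  unfolding has_period_def
proof
  fix x
  have "((\<lambda>y. f (y + X)) has_real_derivative f' (x + X)) (at x)"
    using assms(2)[of "x + X"] by (simp add: DERIV_shift)
  then have "(f has_real_derivative f' (x + X)) (at x)"
    using assms(1) by (simp add: has_period_def)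
  then show "f' (x + X) = f' x"
    using assms(2) DERIV_unique by blast
qed

lemma has_period_mult_nat:
  assumes "has_period X f"
  shows "f (x + real N * X) = f x"
proof (induction N)
  case (Suc N)
  have "f (x + real (Suc N) * X) = f ((x + real N * X) + X)"
    by (simp add: algebra_simps)
  then show ?case
    using Suc assms by (simp only: has_period_def)
qed simp

lemma has_period_mult_int:
  assumes "has_period X f"
  shows "f (x + of_int N * X) = f x"
proof (cases "N \<ge> 0")
  case True
  then show ?thesis using has_period_mult_nat[OF assms, of x "nat N"] by simp
next
  case False
  then show ?thesis
    using has_period_mult_nat[OF assms, of "x + of_int N * X" "nat (- N)"] by simp
qed

lemma has_period_reduce:
  assumes "has_period X f" "X > 0"
  shows "\<exists>y. 0 \<le> y \<and> y < X \<and> f x = f y"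
proof -
  define N where "N = \<lfloor>x / X\<rfloor>"
  have "of_int N \<le> x / X" "x / X < of_int N + 1"
    unfolding N_def by linarith+
  then have "0 \<le> x - of_int N * X" "x - of_int N * X < X"
    using \<open>X > 0\<close> by (auto simp: field_simps)
  moreover have "f x = f (x - of_int N * X)"
    using has_period_mult_int[OF assms(1), of "x - of_int N * X" N] by simp
  ultimately show ?thesis by blast
qed

text \<open>By periodicity \<open>F (x + P) - F x\<close> has derivative zero. It is therefore the
  integral over one period, whatever the starting point.\<close>

lemma antiderivative_period_mult:
  fixes f F :: "real \<Rightarrow> real"
  assumes "has_period P f" "\<And>x. (F has_real_derivative f x) (at x)"
  shows "F (x + real N * P) - F x = real N * (F P - F 0)"
proof -
  have "((\<lambda>x. F (x + P) - F x) has_real_derivative 0) (at x)" for x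
  proof -
    have "((\<lambda>x. F (x + P) - F x) has_real_derivative f (x + P) - f x) (at x)"
      using assms(2)[of "x + P"] assms(2)[of x]
      by (intro DERIV_diff) (auto simp: DERIV_shift)
    then show ?thesis using assms(1) by (simp add: has_period_def)
  qed
  then have 1: "F (x + P) - F x = F (0 + P) - F 0" for x
    using DERIV_isconst_all by blast
  show ?thesis
  proof (induction N)
    case (Suc N)
    have "F (x + real (Suc N) * P) = F ((x + real N * P) + P)"
      by (simp add: algebra_simps)
    then show ?case
      using Suc 1[of "x + real N * P"] by (simp add: algebra_simps)
  qed simp
qed

lemma periodic_pos_bounds:
  fixes f :: "real \<Rightarrow> real"
  assumes "has_period X f" "X > 0" "continuous_on UNIV f" "\<And>x. f x > 0"
  shows "\<exists>a b. 0 < a \<and> (\<forall>x. a \<le> f x \<and> f x \<le> b)"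
proof -
  have c: "continuous_on {0..X} f" using assms(3) continuous_on_subset by blast
  obtain y where y: "\<forall>x\<in>{0..X}. f y \<le> f x"
    using continuous_attains_inf[of "{0..X}" f] c \<open>X > 0\<close> by auto
  obtain z where z: "\<forall>x\<in>{0..X}. f x \<le> f z"
    using continuous_attains_sup[of "{0..X}" f] c \<open>X > 0\<close> by auto
  have "f y \<le> f x \<and> f x \<le> f z" for x
  proof -
    obtain x' where "0 \<le> x'" "x' < X" "f x = f x'"
      using has_period_reduce[OF assms(1,2)] by blast
    then show ?thesis using y z by auto
  qed
  then show ?thesis using assms(4) by blast
qed

lemma periodic_abs_bound:
  fixes f :: "real \<Rightarrow> real"
  assumes "has_period X f" "X > 0" "continuous_on UNIV f"
  shows "\<exists>b. 0 < b \<and> (\<forall>x. \<bar>f x\<bar> \<le> b)"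
proof -
  \<comment> \<open>Adding 1 makes the function positive, so that the bounds for positive periodic
    functions apply.\<close>
  have "has_period X (\<lambda>x. \<bar>f x\<bar> + 1)" using assms(1) by (simp add: has_period_def)
  moreover have "continuous_on UNIV (\<lambda>x. \<bar>f x\<bar> + 1)" by (intro continuous_intros assms(3))
  moreover have "\<bar>f x\<bar> + 1 > 0" for x by linarith
  ultimately have "\<exists>a b. 0 < a \<and> (\<forall>x. a \<le> \<bar>f x\<bar> + 1 \<and> \<bar>f x\<bar> + 1 \<le> b)"
    by (intro periodic_pos_bounds[OF _ assms(2)])
  then obtain b where b: "\<bar>f x\<bar> + 1 \<le> b" for x by blast
  have "0 < b" "\<bar>f x\<bar> \<le> b" for x using b[of x] by linarith+
  then show ?thesis by blast
qed

lemma integral_periodic_deriv_zero: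
  fixes f F :: "real \<Rightarrow> real"
  assumes "has_period X F" "X > 0" "\<And>x. (F has_real_derivative f x) (at x)"
  shows "(f has_integral 0) {0..X}"
  using has_integral_antiderivative[of 0 X F f] assms
  by (metis add_0 diff_self has_period_def less_imp_le)

section \<open>Smoothness through families closed under differentiation\<close>

lemma smooth_iff: "smooth f \<longleftrightarrow> (\<forall>j x. (deriv ^^ j) f differentiable (at x))"
proof
  assume "smooth f"
  then show "\<forall>j x. (deriv ^^ j) f differentiable (at x)"
    unfolding smooth_def Ck_def by blast
next
  assume *: "\<forall>j x. (deriv ^^ j) f differentiable (at x)"
  then show "smooth f"
    unfolding smooth_def Ck_def
    by (simp add: continuous_at_imp_continuous_on differentiable_imp_continuous_within)
qed

text \<open>By induction every iterated derivative stays in \<open>S\<close>. Smoothness is thus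
  reduced to exhibiting a family that contains the derivatives of its members.\<close>

lemma smooth_coinduct:
  assumes "f \<in> S" "\<And>f. f \<in> S \<Longrightarrow> \<exists>f'\<in>S. \<forall>x. (f has_real_derivative f' x) (at x)"
  shows "smooth f"
proof -
  have *: "(deriv ^^ j) f \<in> S" for j
  proof (induction j)
    case (Suc j)
    obtain g where "g \<in> S" "\<forall>x. ((deriv ^^ j) f has_real_derivative g x) (at x)"
      using assms(2) Suc by blast
    moreover have "(deriv ^^ Suc j) f = g"
      using calculation by (auto intro!: DERIV_imp_deriv)
    ultimately show ?case by simp
  qed (use assms(1) in simp)
  show ?thesis
    unfolding smooth_iff real_differentiable_def using assms(2)[OF *] by blast
qed

lemma smooth_DERIV: "smooth f \<Longrightarrow> (f has_real_derivative deriv f x) (at x)"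
  unfolding smooth_iff DERIV_deriv_iff_real_differentiable by (drule spec[of _ 0]) simp

lemma smooth_deriv: "smooth f \<Longrightarrow> smooth (deriv f)"
  unfolding smooth_iff
proof (intro allI)
  fix j x
  assume "\<forall>j x. (deriv ^^ j) f differentiable (at x)"
  then have "(deriv ^^ Suc j) f differentiable (at x)" by blast
  then show "(deriv ^^ j) (deriv f) differentiable (at x)" by (simp add: funpow_Suc_right del: funpow.simps)
qed

text \<open>The family closed under differentiation keeps the inner affine maps fixed and lets the
  outer coefficients and the two functions vary.\<close>

lemma smooth_scaled_add:
  assumes "smooth f" "smooth g"
  shows "smooth (\<lambda>x. a * f (b * x + c) + a' * g (b' * x + c') + d)"
proof (rule smooth_coinduct)
  let ?S = "{\<lambda>x. a * f (b * x + c) + a' * g (b' * x + c') + d | a a' f g d. smooth f \<and> smooth g}"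
  show "(\<lambda>x. a * f (b * x + c) + a' * g (b' * x + c') + d) \<in> ?S"
    using assms by blast
  fix h assume "h \<in> ?S"
  then obtain a a' f g d where h: "h = (\<lambda>x. a * f (b * x + c) + a' * g (b' * x + c') + d)"
    "smooth f" "smooth g" by blast
  let ?h' = "\<lambda>x. (a * b) * deriv f (b * x + c) + (a' * b') * deriv g (b' * x + c') + 0"
  have "(h has_real_derivative ?h' x) (at x)" for x
    unfolding h(1)
    by (rule derivative_eq_intros refl DERIV_chain'[where f = "\<lambda>x. b * x + c"]
         DERIV_chain'[where f = "\<lambda>x. b' * x + c'"] smooth_DERIV h)+ simp
  moreover have "?h' \<in> ?S"
    using smooth_deriv h(2,3) by blast
  ultimately show "\<exists>f'\<in>?S. \<forall>x. (h has_real_derivative f' x) (at x)" by (intro bexI[of _ ?h']) simp_all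
qed

text \<open>The algebra generated by a positive function \<open>k\<close> through powers and logarithm,
  together with \<open>k'\<close>; it is stable under differentiation when \<open>k''\<close> is a power
  function of \<open>k\<close> plus a multiple of \<open>ln k\<close>.\<close>

inductive_set ode_algebra :: "(real \<Rightarrow> real) \<Rightarrow> (real \<Rightarrow> real) \<Rightarrow> (real \<Rightarrow> real) set"
  for k k1 :: "real \<Rightarrow> real" where
  const: "(\<lambda>x. c) \<in> ode_algebra k k1"
| ln: "(\<lambda>x. ln (k x)) \<in> ode_algebra k k1"
| powr: "(\<lambda>x. k x powr e) \<in> ode_algebra k k1"
| k1: "k1 \<in> ode_algebra k k1"
| add: "f \<in> ode_algebra k k1 \<Longrightarrow> g \<in> ode_algebra k k1 \<Longrightarrow> (\<lambda>x. f x + g x) \<in> ode_algebra k k1"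
| mult: "f \<in> ode_algebra k k1 \<Longrightarrow> g \<in> ode_algebra k k1 \<Longrightarrow> (\<lambda>x. f x * g x) \<in> ode_algebra k k1"

lemma smooth_ode_algebra:
  assumes "f \<in> ode_algebra k k1"
    and pos: "\<And>x. k x > 0"
    and k: "\<And>x. (k has_real_derivative k1 x) (at x)"
    and k1: "\<And>x. (k1 has_real_derivative c1 + c2 * k x powr e + c3 * ln (k x)) (at x)"
  shows "smooth f"
proof (rule smooth_coinduct[OF assms(1)])
  fix f assume "f \<in> ode_algebra k k1"
  then show "\<exists>f'\<in>ode_algebra k k1. \<forall>x. (f has_real_derivative f' x) (at x)"
  proof induction
    case (const c)
    show ?case by (rule bexI[of _ "\<lambda>x. 0"]) (auto intro: ode_algebra.const)
  next
    case ln
    have "((\<lambda>x. ln (k x)) has_real_derivative k1 x * k x powr - 1) (at x)" for x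
      using pos[of x] by (auto intro!: derivative_eq_intros k simp: powr_minus_divide abs_of_pos)
    then show ?case
      by (intro bexI[of _ "\<lambda>x. k1 x * k x powr - 1"] allI)
         (assumption, intro ode_algebra.intros)
  next
    case (powr e)
    have "((\<lambda>x. k x powr e) has_real_derivative e * (k x powr (e - 1) * k1 x)) (at x)" for x
      using pos[of x] by (auto intro!: derivative_eq_intros k simp: powr_diff)
    then show ?case
      by (intro bexI[of _ "\<lambda>x. e * (k x powr (e - 1) * k1 x)"]) (auto intro!: ode_algebra.intros)
  next
    case k1
    show ?case
      by (rule bexI[of _ "\<lambda>x. (c1 + c2 * k x powr e) + c3 * ln (k x)"])
         (auto intro!: ode_algebra.intros assms(4))
  next
    case (add f g)
    then obtain f' g' where "f' \<in> ode_algebra k k1" "g' \<in> ode_algebra k k1"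
      "\<forall>x. (f has_real_derivative f' x) (at x)" "\<forall>x. (g has_real_derivative g' x) (at x)" by blast
    then show ?case
      by (intro bexI[of _ "\<lambda>x. f' x + g' x"]) (auto intro!: ode_algebra.intros DERIV_add)
  next
    case (mult f g)
    then obtain f' g' where "f' \<in> ode_algebra k k1" "g' \<in> ode_algebra k k1"
      "\<forall>x. (f has_real_derivative f' x) (at x)" "\<forall>x. (g has_real_derivative g' x) (at x)" by blast
    with mult show ?case
      by (intro bexI[of _ "\<lambda>x. f' x * g x + g' x * f x"])
         (auto intro!: ode_algebra.intros DERIV_mult)
  qed
qed

lemma smooth_ode:
  assumes "\<And>x. k x > 0"
    and "\<And>x. (k has_real_derivative k1 x) (at x)"
    and "\<And>x. (k1 has_real_derivative c1 + c2 * k x powr e + c3 * ln (k x)) (at x)"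
  shows "smooth k"
proof -
  \<comment> \<open>The algebra has no generator for \<open>k\<close> itself; it enters as the power
    with exponent 1.\<close>
  have "(\<lambda>x. k x powr 1) \<in> ode_algebra k k1" by (rule ode_algebra.powr)
  moreover have "(\<lambda>x. k x powr 1) = k" using assms(1) by (auto simp: less_imp_le)
  ultimately show ?thesis using smooth_ode_algebra[OF _ assms] by simp
qed

text \<open>The lower bound on the derivative forces linear growth in both directions, hence
  surjectivity. It will be applied to time as a function of the polar angle.\<close>

lemma global_inverse_function:
  fixes f f' :: "real \<Rightarrow> real"
  assumes f: "\<And>x. (f has_real_derivative f' x) (at x)" and "c > 0" "\<And>x. c \<le> f' x"
  shows "\<exists>g. \<forall>x. f (g x) = x \<and> g (f x) = x \<and> (g has_real_derivative inverse (f' (g x))) (at x)"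
proof -
  have pos: "f' x > 0" for x using assms(2) assms(3)[of x] by linarith
  have mono: "f x < f y" if "x < y" for x y
    using DERIV_pos_imp_increasing[OF that, of f] f pos by blast
  then have "strict_mono f" by (simp add: strict_mono_def)
  then have "inj f" by (rule strict_mono_imp_inj_on)
  have cont: "isCont f x" for x using f DERIV_isCont by blast
  have "y \<in> range f" for y
  proof -
    \<comment> \<open>Growth at rate at least \<open>c\<close> over a length \<open>b\<close> covers
      the distance from \<open>f 0\<close> to \<open>y\<close> on either side.\<close>
    define b where "b = (\<bar>y\<bar> + \<bar>f 0\<bar>) / c + 1"
    have "b > 0" unfolding b_def using \<open>c > 0\<close> by (simp add: add_nonneg_pos)
    have cb: "c * b \<ge> \<bar>y\<bar> + \<bar>f 0\<bar>" unfolding b_def using \<open>c > 0\<close> by (simp add: field_simps)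
    obtain z where "f b - f 0 = (b - 0) * f' z"
      using MVT2[where a = 0 and b = b and f = f and f' = f'] \<open>b > 0\<close> f by auto
    then have "f b - f 0 \<ge> c * b" using mult_left_mono[OF assms(3)[of z], of b] \<open>b > 0\<close>
      by (simp add: mult.commute)
    moreover obtain z where "f 0 - f (- b) = (0 - - b) * f' z"
      using MVT2[where a = "- b" and b = 0 and f = f and f' = f'] \<open>b > 0\<close> f by auto
    then have "f 0 - f (- b) \<ge> c * b" using mult_left_mono[OF assms(3)[of z], of b] \<open>b > 0\<close>
      by (simp add: mult.commute)
    ultimately have "f (- b) \<le> y" "y \<le> f b" using cb by linarith+
    moreover have "continuous_on {- b..b} f" using cont by (simp add: continuous_at_imp_continuous_on)
    ultimately obtain x where "f x = y"
      using IVT'[where f = f and a = "- b" and b = b and y = y] \<open>b > 0\<close> by auto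
    then show ?thesis by blast
  qed
  then have "surj f" by blast
  have 1: "f (inv f x) = x" for x using \<open>surj f\<close> by (simp add: surj_f_inv_f)
  have 2: "inv f (f x) = x" for x using \<open>inj f\<close> by simp
  have c: "isCont (inv f) x" for x
    using isCont_inverse_function[where d = 1 and x = "inv f x" and g = "inv f" and f = f] 2 cont 1
    by simp
  have "(inv f has_real_derivative inverse (f' (inv f x))) (at x)" for x
    by (rule DERIV_inverse_function[where f = f and a = "x - 1" and b = "x + 1"])
       (use f pos 1 c in \<open>auto simp: less_imp_neq[symmetric]\<close>)
  then show ?thesis using 1 2 by blast
qed

section \<open>Uniqueness of profiles\<close>

text \<open>Integrating factors: \<open>e x * exp (- M * x)\<close> does not increase, which settles
  \<open>x \<ge> 0\<close>, and \<open>e x * exp (M * x)\<close> does not decrease, which settles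
  \<open>x < 0\<close>; both vanish at 0.\<close>

lemma gronwall_zero:
  fixes e e' :: "real \<Rightarrow> real"
  assumes e: "\<And>x. (e has_real_derivative e' x) (at x)"
    and nonneg: "\<And>x. e x \<ge> 0" and "e 0 = 0" and bound: "\<And>x. \<bar>e' x\<bar> \<le> M * e x"
  shows "e x = 0"
proof (cases "x \<ge> 0")
  case True
  have "e x * exp (- M * x) \<le> e 0 * exp (- M * 0)"
  proof (rule DERIV_nonpos_imp_nonincreasing[OF True, where f = "\<lambda>x. e x * exp (- M * x)"])
    fix t
    have "((\<lambda>t. e t * exp (- M * t)) has_real_derivative (e' t - M * e t) * exp (- M * t)) (at t)"
      by (auto intro!: derivative_eq_intros e simp: algebra_simps)
    moreover have "(e' t - M * e t) * exp (- M * t) \<le> 0"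
      using bound[of t] by (intro mult_nonpos_nonneg) auto
    ultimately show "\<exists>y. ((\<lambda>t. e t * exp (- M * t)) has_real_derivative y) (at t) \<and> y \<le> 0"
      by blast
  qed
  then have "e x * exp (- M * x) \<le> 0" using \<open>e 0 = 0\<close> by simp
  then show ?thesis using nonneg[of x] by (simp add: mult_le_0_iff)
next
  case False
  have "e x * exp (M * x) \<le> e 0 * exp (M * 0)"
  proof (rule DERIV_nonneg_imp_nondecreasing[where f = "\<lambda>x. e x * exp (M * x)"])
    fix t
    have "((\<lambda>t. e t * exp (M * t)) has_real_derivative (e' t + M * e t) * exp (M * t)) (at t)"
      by (auto intro!: derivative_eq_intros e simp: algebra_simps)
    moreover have "(e' t + M * e t) * exp (M * t) \<ge> 0"
      using bound[of t] by (intro mult_nonneg_nonneg) auto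
    ultimately show "\<exists>y. ((\<lambda>t. e t * exp (M * t)) has_real_derivative y) (at t) \<and> y \<ge> 0"
      by blast
  qed (use False in simp)
  then have "e x * exp (M * x) \<le> 0" using \<open>e 0 = 0\<close> by simp
  then show ?thesis using nonneg[of x] by (simp add: mult_le_0_iff)
qed

text \<open>Gronwall for the squared distance of the two solutions in the phase plane. The Lipschitz
  bound is asked only along the solutions, because the nonlinearities in use are not globally
  Lipschitz.\<close>

lemma second_order_ode_unique:
  fixes k l k1 l1 F :: "real \<Rightarrow> real"
  assumes k: "\<And>x. (k has_real_derivative k1 x) (at x)" "\<And>x. (k1 has_real_derivative - F (k x)) (at x)"
    and l: "\<And>x. (l has_real_derivative l1 x) (at x)" "\<And>x. (l1 has_real_derivative - F (l x)) (at x)"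
    and lip: "\<And>x. \<bar>F (k x) - F (l x)\<bar> \<le> L * \<bar>k x - l x\<bar>"
    and init: "k 0 = l 0" "k1 0 = l1 0"
  shows "k x = l x"
proof -
  let ?e = "\<lambda>x. (k x - l x)\<^sup>2 + (k1 x - l1 x)\<^sup>2"
  let ?e' = "\<lambda>x. 2 * (k x - l x) * (k1 x - l1 x) + 2 * (k1 x - l1 x) * - (F (k x) - F (l x))"
  have "?e x = 0"
  proof (rule gronwall_zero[where e = ?e and e' = ?e' and M = "1 + \<bar>L\<bar>"])
    fix x
    show "(?e has_real_derivative ?e' x) (at x)"
      by (auto intro!: derivative_eq_intros k l simp: algebra_simps)
    define a b where "a = \<bar>k x - l x\<bar>" and "b = \<bar>k1 x - l1 x\<bar>"
    have ab: "2 * a * b \<le> a\<^sup>2 + b\<^sup>2" by (rule sum_squares_bound)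
    have "\<bar>2 * u * v + 2 * v * - w\<bar> \<le> 2 * \<bar>u\<bar> * \<bar>v\<bar> + 2 * \<bar>v\<bar> * \<bar>w\<bar>" for u v w :: real
      by (rule order_trans[OF abs_triangle_ineq]) (simp add: abs_mult)
    then have "\<bar>?e' x\<bar> \<le> 2 * a * b + 2 * b * \<bar>F (k x) - F (l x)\<bar>"
      unfolding a_def b_def .
    also have "\<bar>F (k x) - F (l x)\<bar> \<le> \<bar>L\<bar> * a"
      using lip[of x] mult_right_mono[OF abs_ge_self[of L], of a] unfolding a_def by linarith
    then have "2 * a * b + 2 * b * \<bar>F (k x) - F (l x)\<bar> \<le> 2 * a * b + 2 * b * (\<bar>L\<bar> * a)"
      unfolding b_def by (intro add_left_mono mult_left_mono) auto
    also have "\<dots> = (1 + \<bar>L\<bar>) * (2 * a * b)" by (simp add: algebra_simps)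
    also have "\<dots> \<le> (1 + \<bar>L\<bar>) * (a\<^sup>2 + b\<^sup>2)" using ab by (intro mult_left_mono) auto
    finally show "\<bar>?e' x\<bar> \<le> (1 + \<bar>L\<bar>) * ?e x" unfolding a_def b_def by simp
  qed (use init in auto)
  then show ?thesis by (simp add: sum_power2_eq_zero_iff)
qed

text \<open>The power is monotone in one direction or the other, so the sum of the endpoint values
  covers both signs of the exponent and spares later bounds a case distinction.\<close>

lemma powr_bounds_between:
  fixes y a b e :: real
  assumes "0 < a" "a \<le> y" "y \<le> b"
  shows "y powr e \<le> a powr e + b powr e"
proof (cases "e \<ge> 0")
  case True
  then have "y powr e \<le> b powr e" using assms by (intro powr_mono2) auto
  then show ?thesis by (simp add: add_increasing)
next
  case False
  then have "y powr e \<le> a powr e" using assms by (intro powr_mono2') auto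
  then show ?thesis by (simp add: add_increasing2)
qed

text \<open>The primitive of y^(q-1) that vanishes at 1. It lets the power form and the logarithmic
  form of the profile equation be treated together.\<close>

definition nonlin :: "real \<Rightarrow> real \<Rightarrow> real" where
  "nonlin q y = (if q = 0 then ln y else (y powr q - 1) / q)"

lemma DERIV_nonlin [derivative_intros]:
  assumes "y > 0"
  shows "(nonlin q has_real_derivative y powr (q - 1)) (at y)"
proof (cases "q = 0")
  case True
  have "(ln has_real_derivative y powr - 1) (at y)"
    using assms by (auto intro!: derivative_eq_intros simp: powr_minus_divide)
  then show ?thesis using True unfolding nonlin_def by simp
next
  case False
  have "((\<lambda>y. (y powr q - 1) / q) has_real_derivative y powr (q - 1)) (at y)"
    using assms False by (auto intro!: derivative_eq_intros)
  then show ?thesis using False unfolding nonlin_def by simp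
qed

lemma nonlin_lipschitz:
  assumes "0 < a" "a \<le> y" "y \<le> b" "a \<le> z" "z \<le> b"
  shows "\<bar>nonlin q y - nonlin q z\<bar> \<le> (a powr (q - 1) + b powr (q - 1)) * \<bar>y - z\<bar>"
proof -
  have "norm (nonlin q y - nonlin q z) \<le> (a powr (q - 1) + b powr (q - 1)) * norm (y - z)"
  proof (rule field_differentiable_bound[where S = "{a..b}"])
    fix t assume "t \<in> {a..b}"
    then show "(nonlin q has_field_derivative t powr (q - 1)) (at t within {a..b})"
      using assms by (intro has_field_derivative_at_within[OF DERIV_nonlin]) auto
    show "norm (t powr (q - 1)) \<le> a powr (q - 1) + b powr (q - 1)"
      using \<open>t \<in> {a..b}\<close> assms powr_bounds_between[of a t b] by auto
  qed (use assms in auto)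
  then show ?thesis by simp
qed

text \<open>Positivity and periodicity confine both solutions to a compact part of the positive half
  line, on which \<open>nonlin q\<close> is Lipschitz. The two periods may differ, since the
  description of \<open>k_prof\<close> fixes none.\<close>

lemma positive_periodic_ode_unique:
  assumes k: "\<And>x. (k has_real_derivative k1 x) (at x)" "\<And>x. (k1 has_real_derivative - nonlin q (k x)) (at x)"
    and l: "\<And>x. (l has_real_derivative l1 x) (at x)" "\<And>x. (l1 has_real_derivative - nonlin q (l x)) (at x)"
    and "\<And>x. k x > 0" "\<And>x. l x > 0" "has_period p k" "p > 0" "has_period p' l" "p' > 0"
    and init: "k 0 = l 0" "k1 0 = l1 0"
  shows "k = l"
proof
  fix x
  have c: "continuous_on UNIV k" "continuous_on UNIV l"
    using k(1) l(1) by (meson DERIV_isCont continuous_at_imp_continuous_on)+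
  obtain a b where ab: "0 < a" "\<And>x. a \<le> k x \<and> k x \<le> b"
    using periodic_pos_bounds[of p k] assms c by blast
  obtain a' b' where ab': "0 < a'" "\<And>x. a' \<le> l x \<and> l x \<le> b'"
    using periodic_pos_bounds[of p' l] assms c by blast
  have "\<bar>nonlin q (k x) - nonlin q (l x)\<bar>
      \<le> ((min a a') powr (q - 1) + (max b b') powr (q - 1)) * \<bar>k x - l x\<bar>" for x
    using ab ab' by (intro nonlin_lipschitz) (auto simp: min_le_iff_disj le_max_iff_disj)
  then show "k x = l x" by (rule second_order_ode_unique[OF k l _ init])
qed

text \<open>Eliminates the definite description: by uniqueness, any positive periodic solution with
  the right initial data is the profile. Its smoothness follows from the equation.\<close>

lemma k_prof_eqI:
  assumes k: "\<And>x. (k has_real_derivative k1 x) (at x)" "\<And>x. (k1 has_real_derivative - nonlin q (k x)) (at x)"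
    and pos: "\<And>x. k x > 0" and per: "has_period p k" "p > 0"
    and init: "k 0 = \<alpha>" "k1 0 = 0"
  shows "k_prof q \<alpha> = k" "smooth k"
proof -
  \<comment> \<open>The coefficients write \<open>- nonlin q (k x)\<close> as constant plus power
    plus logarithm, the shape that \<open>smooth_ode\<close> expects.\<close>
  have k1: "(k1 has_real_derivative (if q = 0 then 0 else 1 / q) + (if q = 0 then 0 else - 1 / q) * k x powr q
        + (if q = 0 then - 1 else 0) * ln (k x)) (at x)" for x
    using k(2)[of x] by (cases "q = 0") (simp_all add: nonlin_def diff_divide_distrib)
  show sm: "smooth k" by (rule smooth_ode[OF pos k(1) k1])
  have d: "deriv k = k1" using k(1) by (intro ext DERIV_imp_deriv)
  have dd: "deriv k1 x = - nonlin q (k x)" for x using k(2) by (intro DERIV_imp_deriv)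
  show "k_prof q \<alpha> = k"
    unfolding k_prof_def
  proof (rule the_equality, goal_cases)
    case 1
    then show ?case using sm pos per init d dd by (auto simp: nonlin_def)
  next
    case (2 l)
    then obtain p' where p': "p' > 0" "has_period p' l" by blast
    have 1: "(l has_real_derivative deriv l x) (at x)" for x using 2 smooth_DERIV by blast
    have "(deriv l has_real_derivative deriv (deriv l) x) (at x)" for x
      using 2 smooth_DERIV smooth_deriv by blast
    moreover have "deriv (deriv l) x = - nonlin q (l x)" for x
      using 2 by (simp add: nonlin_def eq_neg_iff_add_eq_0)
    ultimately have l1: "(deriv l has_real_derivative - nonlin q (l x)) (at x)" for x by simp
    show ?case
      by (rule positive_periodic_ode_unique[OF 1 l1 k _ pos p'(2,1) per]) (use 2 init in auto)
  qed
qed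

section \<open>Expansion of the energy\<close>

lemma potential_DERIV:
  assumes "potential B q H" "y > 0"
  shows "(H has_real_derivative deriv H y) (at y)"
    "(deriv H has_real_derivative B * y powr (q - 1)) (at y)"
  using assms by (auto simp: potential_def DERIV_deriv_iff_real_differentiable)

text \<open>Order four is kept because it is the first nonzero order in the directions
  \<plusminus>h'. The constant is uniform in both points, so the remainder can be integrated along
  \<open>h\<close>.\<close>

lemma potential_taylor:
  assumes H: "potential B q H" and ab: "0 < a" "a \<le> b"
  shows "\<exists>M. \<forall>y\<in>{a..b}. \<forall>z\<in>{a..b}.
    \<bar>H z - (H y + deriv H y * (z - y) + B * y powr (q - 1) / 2 * (z - y)^2
      + B * (q - 1) * y powr (q - 2) / 6 * (z - y)^3
      + B * (q - 1) * (q - 2) * y powr (q - 3) / 24 * (z - y)^4)\<bar> \<le> M * \<bar>z - y\<bar>^5"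
proof -
  \<comment> \<open>A bound for the fifth derivative of \<open>H\<close> on the interval, divided by
    5!.\<close>
  define M where "M = \<bar>B * (q - 1) * (q - 2) * (q - 3)\<bar> * (a powr (q - 4) + b powr (q - 4)) / 120"
  define diff :: "nat \<Rightarrow> real \<Rightarrow> real" where "diff m = [H, deriv H, \<lambda>y. B * y powr (q - 1),
      \<lambda>y. B * (q - 1) * y powr (q - 2), \<lambda>y. B * (q - 1) * (q - 2) * y powr (q - 3),
      \<lambda>y. B * (q - 1) * (q - 2) * (q - 3) * y powr (q - 4)] ! m" for m
  have D: "\<forall>m t. m < 5 \<and> a \<le> t \<and> t \<le> b \<longrightarrow> (diff m has_real_derivative diff (Suc m) t) (at t)"
  proof (intro allI impI)
    fix m :: nat and t assume *: "m < 5 \<and> a \<le> t \<and> t \<le> b"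
    then have "t > 0" using ab by linarith
    from * have "m = 0 \<or> m = 1 \<or> m = 2 \<or> m = 3 \<or> m = 4" by linarith
    then show "(diff m has_real_derivative diff (Suc m) t) (at t)"
      using potential_DERIV[OF H \<open>t > 0\<close>] \<open>t > 0\<close>
      by (elim disjE)
         (auto simp: diff_def eval_nat_numeral intro!: derivative_eq_intros)
  qed
  show ?thesis
  proof (intro exI[of _ M] ballI)
    fix y z assume yz: "y \<in> {a..b}" "z \<in> {a..b}"
    let ?T = "H y + deriv H y * (z - y) + B * y powr (q - 1) / 2 * (z - y)^2
      + B * (q - 1) * y powr (q - 2) / 6 * (z - y)^3
      + B * (q - 1) * (q - 2) * y powr (q - 3) / 24 * (z - y)^4"
    show "\<bar>H z - ?T\<bar> \<le> M * \<bar>z - y\<bar>^5"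
    proof (cases "z = y")
      case False
      obtain t where t: "if z < y then z < t \<and> t < y else y < t \<and> t < z"
        and Hz: "H z = (\<Sum>m<5. (diff m y / fact m) * (z - y) ^ m) + (diff 5 t / fact 5) * (z - y) ^ 5"
        using Taylor[of 5 diff H a b y z] D yz False by (auto simp: diff_def)
      have "(\<Sum>m<5. (diff m y / fact m) * (z - y) ^ m) = ?T"
        by (simp add: eval_nat_numeral diff_def fact_numeral)
      then have "\<bar>H z - ?T\<bar> = \<bar>B * (q - 1) * (q - 2) * (q - 3)\<bar> * t powr (q - 4) / 120 * \<bar>z - y\<bar>^5"
        using Hz by (simp add: diff_def abs_mult power_abs fact_numeral)
      also have "\<dots> \<le> M * \<bar>z - y\<bar>^5"
        unfolding M_def using yz ab t powr_bounds_between[of a t b "q - 4"]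
        by (intro mult_right_mono divide_right_mono mult_left_mono) (auto split: if_splits)
      finally show ?thesis .
    qed simp
  qed
qed

text \<open>The steady state equation after one integration, with zero flux. The exponents
  \<open>m\<close> and \<open>n\<close> survive only through \<open>q\<close>.\<close>

locale steady =
  fixes B q X :: real and h h1 h2 :: "real \<Rightarrow> real"
  assumes B_pos: "B > 0" and X_pos: "X > 0" and h_pos: "\<And>x. h x > 0"
    and h_per: "has_period X h"
    and h_D: "\<And>x. (h has_real_derivative h1 x) (at x)"
    and h1_D: "\<And>x. (h1 has_real_derivative h2 x) (at x)"
    and h2_D: "\<And>x. (h2 has_real_derivative - (B * h x powr (q - 1) * h1 x)) (at x)"
begin

lemma cont: "continuous_on S h" "continuous_on S h1" "continuous_on S h2"
  using h_D h1_D h2_D by (meson DERIV_isCont continuous_at_imp_continuous_on)+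

lemma cont_powr: "continuous_on S (\<lambda>x. h x powr e)"
  using h_pos by (intro continuous_on_powr cont continuous_intros) (metis less_irrefl)

lemma h_powr_D: "((\<lambda>x. h x powr e) has_real_derivative e * h x powr (e - 1) * h1 x) (at x)"
  using h_pos[of x] by (auto intro!: derivative_eq_intros h_D simp: powr_diff)

lemma per1: "has_period X h1" and per2: "has_period X h2"
  using has_period_deriv[OF h_per h_D] has_period_deriv[OF has_period_deriv[OF h_per h_D] h1_D]
  by blast+

text \<open>The derivative of \<open>deriv H (h x)\<close> cancels h'''. This is the Euler-Lagrange
  equation of the energy, and the constant is the multiplier of the mean-value constraint.\<close>

lemma first_integral:
  assumes "potential B q H"
  shows "h2 x + deriv H (h x) = h2 0 + deriv H (h 0)"
proof -
  have "((\<lambda>x. h2 x + deriv H (h x)) has_real_derivative 0) (at x)" for x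
  proof -
    have "((\<lambda>x. deriv H (h x)) has_real_derivative B * h x powr (q - 1) * h1 x) (at x)"
      using potential_DERIV(2)[OF assms h_pos] h_D by (rule DERIV_chain2)
    from DERIV_add[OF h2_D this] show ?thesis by simp
  qed
  then show ?thesis using DERIV_isconst_all by blast
qed

lemma energy_expansion:
  assumes H: "potential B q H"
    and u: "\<And>x. (u has_real_derivative u1 x) (at x)" "continuous_on UNIV u1" "has_period X u"
      "(u has_integral 0) {0..X}"
    and I2: "((\<lambda>x. (u1 x)\<^sup>2 - B * h x powr (q - 1) * (u x)\<^sup>2) has_integral I2) {0..X}"
    and I3: "((\<lambda>x. B * (q - 1) * h x powr (q - 2) * (u x)^3) has_integral I3) {0..X}"
    and I4: "((\<lambda>x. B * (q - 1) * (q - 2) * h x powr (q - 3) * (u x)^4) has_integral I4) {0..X}"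
  shows "\<exists>C. \<exists>\<delta>>0. \<forall>\<epsilon>. 0 < \<epsilon> \<and> \<epsilon> < \<delta> \<longrightarrow>
    \<bar>energy H X (\<lambda>x. h x + \<epsilon> * u x) - energy H X h - (\<epsilon>^2 / 2 * I2 - \<epsilon>^3 / 6 * I3 - \<epsilon>^4 / 24 * I4)\<bar>
      \<le> C * \<epsilon>^5"
proof -
  obtain a b where ab: "0 < a" "\<And>x. a \<le> h x" "\<And>x. h x \<le> b"
    using periodic_pos_bounds[OF h_per X_pos cont(1) h_pos] by blast
  have u_cont: "continuous_on UNIV u" using u(1) by (meson DERIV_isCont continuous_at_imp_continuous_on)
  obtain U where U: "0 < U" "\<And>x. \<bar>u x\<bar> \<le> U"
    using periodic_abs_bound[OF u(3) X_pos u_cont] by blast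
  have "a \<le> b" using ab(2,3) order_trans by blast
  have ab2: "0 < a / 2" "a / 2 \<le> b + a / 2" using ab(1) \<open>a \<le> b\<close> by auto
  obtain M where M: "\<And>y z. y \<in> {a/2..b + a/2} \<Longrightarrow> z \<in> {a/2..b + a/2} \<Longrightarrow>
      \<bar>H z - (H y + deriv H y * (z - y) + B * y powr (q - 1) / 2 * (z - y)^2
      + B * (q - 1) * y powr (q - 2) / 6 * (z - y)^3
      + B * (q - 1) * (q - 2) * y powr (q - 3) / 24 * (z - y)^4)\<bar> \<le> M * \<bar>z - y\<bar>^5"
    using potential_taylor[OF H ab2] by blast
  define \<kappa> where "\<kappa> = h2 0 + deriv H (h 0)"
  have kap: "h2 x + deriv H (h x) = \<kappa>" for x
    unfolding \<kappa>_def by (rule first_integral[OF H])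
  \<comment> \<open>The first variation vanishes: \<open>h1 * u\<close> is periodic, and the
    multiplier \<open>\<kappa>\<close> is annihilated by the zero mean of \<open>u\<close>.\<close>
  have first: "((\<lambda>x. h1 x * u1 x - deriv H (h x) * u x) has_integral 0) {0..X}"
  proof -
    have "((\<lambda>x. h2 x * u x + h1 x * u1 x) has_integral 0) {0..X}"
    proof (rule integral_periodic_deriv_zero[OF _ X_pos])
      show "has_period X (\<lambda>x. h1 x * u x)" using per1 u(3) by (simp add: has_period_def)
      show "((\<lambda>x. h1 x * u x) has_real_derivative h2 x * u x + h1 x * u1 x) (at x)" for x
        by (auto intro!: derivative_eq_intros h1_D u(1))
    qed
    from has_integral_diff[OF this has_integral_mult_right[OF u(4), of \<kappa>]]
    have "((\<lambda>x. h2 x * u x + h1 x * u1 x - \<kappa> * u x) has_integral 0) {0..X}" by simp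
    moreover have "h2 x * u x + h1 x * u1 x - \<kappa> * u x = h1 x * u1 x - deriv H (h x) * u x" for x
      unfolding kap[of x, symmetric] by (simp add: algebra_simps)
    ultimately show ?thesis by simp
  qed
  have int: "((\<lambda>x. (h1 x + \<epsilon> * u1 x)\<^sup>2 / 2 - H (h x + \<epsilon> * u x)) has_integral energy H X (\<lambda>x. h x + \<epsilon> * u x)) {0..X}"
    if pos: "\<And>x. h x + \<epsilon> * u x > 0" for \<epsilon>
  proof -
    have D: "deriv (\<lambda>x. h x + \<epsilon> * u x) x = h1 x + \<epsilon> * u1 x" for x
      by (rule DERIV_imp_deriv) (auto intro!: derivative_eq_intros h_D u(1))
    have "((\<lambda>x. H (h x + \<epsilon> * u x)) has_real_derivative deriv H (h x + \<epsilon> * u x) * (h1 x + \<epsilon> * u1 x)) (at x)" for x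
      by (rule DERIV_chain2[where f = H and g = "\<lambda>x. h x + \<epsilon> * u x", OF potential_DERIV(1)[OF H pos]])
         (auto intro!: derivative_eq_intros h_D u(1))
    then have "continuous_on UNIV (\<lambda>x. H (h x + \<epsilon> * u x))"
      by (meson DERIV_isCont continuous_at_imp_continuous_on)
    then have "continuous_on {0..X} (\<lambda>x. (h1 x + \<epsilon> * u1 x)\<^sup>2 / 2 - H (h x + \<epsilon> * u x))"
      by (intro continuous_intros cont continuous_on_subset[OF u(2)]) (auto elim: continuous_on_subset)
    from integrable_integral[OF integrable_continuous_real[OF this]]
    show ?thesis unfolding energy_def D .
  qed
  have h: "(\<lambda>x. h x + 0 * u x) = h" by simp
  have int0: "((\<lambda>x. (h1 x)\<^sup>2 / 2 - H (h x)) has_integral energy H X h) {0..X}"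
    using int[of 0] h_pos unfolding h by simp
  \<comment> \<open>Keeps \<open>h + \<epsilon> u\<close> within \<open>a / 2\<close> of
    \<open>h\<close>, hence positive and inside the interval of the Taylor bound.\<close>
  define \<delta> where "\<delta> = a / (2 * U)"
  have "\<delta> > 0" unfolding \<delta>_def using ab U by simp
  have "\<bar>energy H X (\<lambda>x. h x + \<epsilon> * u x) - energy H X h - (\<epsilon>^2 / 2 * I2 - \<epsilon>^3 / 6 * I3 - \<epsilon>^4 / 24 * I4)\<bar>
      \<le> (\<bar>M\<bar> * U^5 * X) * \<epsilon>^5" if "0 < \<epsilon>" "\<epsilon> < \<delta>" for \<epsilon>
  proof -
    have eu: "\<bar>\<epsilon> * u x\<bar> \<le> \<epsilon> * U" for x
      using U(2)[of x] that by (simp add: abs_mult)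
    have "\<epsilon> * U \<le> a / 2" using that U(1) unfolding \<delta>_def by (simp add: field_simps)
    then have eu2: "\<bar>\<epsilon> * u x\<bar> \<le> a / 2" for x using eu[of x] by linarith
    have rng: "h x \<in> {a/2..b + a/2}" "h x + \<epsilon> * u x \<in> {a/2..b + a/2}" for x
      using eu2[of x] ab(2,3)[of x] ab(1) by auto
    have pos: "h x + \<epsilon> * u x > 0" for x using rng(2)[of x] ab(1) by auto
    define R where "R x = H (h x + \<epsilon> * u x) - (H (h x) + deriv H (h x) * (\<epsilon> * u x) + B * h x powr (q - 1) / 2 * (\<epsilon> * u x)^2
      + B * (q - 1) * h x powr (q - 2) / 6 * (\<epsilon> * u x)^3
      + B * (q - 1) * (q - 2) * h x powr (q - 3) / 24 * (\<epsilon> * u x)^4)" for x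
    have R_bound: "\<bar>R x\<bar> \<le> \<bar>M\<bar> * U^5 * \<epsilon>^5" for x
    proof -
      have "\<bar>R x\<bar> \<le> M * \<bar>\<epsilon> * u x\<bar>^5" unfolding R_def using M[OF rng(1)[of x] rng(2)[of x]] by simp
      also have "\<dots> \<le> \<bar>M\<bar> * \<bar>\<epsilon> * u x\<bar>^5" by (intro mult_right_mono) auto
      also have "\<dots> \<le> \<bar>M\<bar> * (\<epsilon> * U)^5" using eu[of x] by (intro mult_left_mono power_mono) auto
      finally show ?thesis by (simp add: power_mult_distrib mult_ac)
    qed
    \<comment> \<open>Solved for the Taylor remainder, the expansion is a pointwise identity between
      integrable functions. Integrating it gives the energy difference minus the claimed polynomial,
      and the sup bound on \<open>R\<close> does the rest.\<close>
    have R_eq: "R x = ((h1 x)\<^sup>2 / 2 - H (h x)) - ((h1 x + \<epsilon> * u1 x)\<^sup>2 / 2 - H (h x + \<epsilon> * u x))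
       + \<epsilon> * (h1 x * u1 x - deriv H (h x) * u x)
       + \<epsilon>^2 / 2 * ((u1 x)\<^sup>2 - B * h x powr (q - 1) * (u x)\<^sup>2)
       - \<epsilon>^3 / 6 * (B * (q - 1) * h x powr (q - 2) * (u x)^3)
       - \<epsilon>^4 / 24 * (B * (q - 1) * (q - 2) * h x powr (q - 3) * (u x)^4)" for x
      unfolding R_def by (simp add: power2_eq_square power3_eq_cube power4_eq_xxxx field_simps)
    have "(R has_integral (energy H X h - energy H X (\<lambda>x. h x + \<epsilon> * u x) + \<epsilon> * 0
        + \<epsilon>^2 / 2 * I2 - \<epsilon>^3 / 6 * I3 - \<epsilon>^4 / 24 * I4)) {0..X}"
      unfolding R_eq
      by (intro has_integral_diff has_integral_add has_integral_mult_right int int0 first I2 I3 I4 pos)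
    from has_integral_bound_real[OF _ finite.emptyI this, of "\<bar>M\<bar> * U^5 * \<epsilon>^5"] R_bound that U(1) X_pos
    show ?thesis by (simp add: abs_minus_commute algebra_simps)
  qed
  then show ?thesis using \<open>\<delta> > 0\<close> by blast
qed

text \<open>The leading coefficient of the energy difference is \<open>I2 / 2\<close> or
  \<open>- I4 / 24\<close>. Dividing the upper bound by the leading power of \<epsilon> leaves a
  continuous function that is negative at 0.\<close>

lemma energy_unstable_dirI:
  assumes H: "potential B q H"
    and u: "\<And>x. (u has_real_derivative u1 x) (at x)" "continuous_on UNIV u1" "has_period X u"
      "(u has_integral 0) {0..X}"
    and I2: "((\<lambda>x. (u1 x)\<^sup>2 - B * h x powr (q - 1) * (u x)\<^sup>2) has_integral I2) {0..X}"
    and I3: "((\<lambda>x. B * (q - 1) * h x powr (q - 2) * (u x)^3) has_integral I3) {0..X}"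
    and I4: "((\<lambda>x. B * (q - 1) * (q - 2) * h x powr (q - 3) * (u x)^4) has_integral I4) {0..X}"
    and neg: "I2 < 0 \<or> I2 = 0 \<and> I3 = 0 \<and> I4 > 0"
  shows "energy_unstable_dir H X h u"
  unfolding energy_unstable_dir_def H1_circle_def
proof (intro conjI)
  show "has_period X u" by (rule u(3))
  show "integral {0..X} u = 0" using u(4) by (rule integral_unique)
  have c: "continuous_on {0..X} u1" using u(2) continuous_on_subset by blast
  show "\<exists>g. g absolutely_integrable_on {0..X} \<and> (\<lambda>x. (g x)\<^sup>2) integrable_on {0..X} \<and>
          (\<forall>x\<in>{0..X}. u x = u 0 + integral {0..x} g)"
    using integral_antiderivative[OF _ u(1)] c
    by (intro exI[of _ u1])
       (auto intro!: absolutely_integrable_continuous_real integrable_continuous_real continuous_intros)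
  obtain C \<delta> where "\<delta> > 0" and exp: "\<And>\<epsilon>. 0 < \<epsilon> \<Longrightarrow> \<epsilon> < \<delta> \<Longrightarrow>
    \<bar>energy H X (\<lambda>x. h x + \<epsilon> * u x) - energy H X h - (\<epsilon>^2 / 2 * I2 - \<epsilon>^3 / 6 * I3 - \<epsilon>^4 / 24 * I4)\<bar>
      \<le> C * \<epsilon>^5"
    using energy_expansion[OF H u I2 I3 I4] by blast
  have *: "\<forall>\<^sub>F \<epsilon> in at_right 0. \<epsilon>^2 / 2 * I2 - \<epsilon>^3 / 6 * I3 - \<epsilon>^4 / 24 * I4 + C * \<epsilon>^5 < 0"
    using neg
  proof
    assume "I2 < 0"
    have "((\<lambda>\<epsilon>. I2 / 2 - \<epsilon> / 6 * I3 - \<epsilon>^2 / 24 * I4 + C * \<epsilon>^3) \<longlongrightarrow> I2 / 2 - 0 / 6 * I3 - 0^2 / 24 * I4 + C * 0^3) (at_right 0)"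
      by (intro tendsto_intros) auto
    then have "\<forall>\<^sub>F \<epsilon> in at_right 0. I2 / 2 - \<epsilon> / 6 * I3 - \<epsilon>^2 / 24 * I4 + C * \<epsilon>^3 < 0"
      by (rule order_tendstoD(2)) (use \<open>I2 < 0\<close> in simp)
    then show ?thesis using eventually_at_right_less[of 0]
    proof eventually_elim
      case (elim \<epsilon>)
      then have "\<epsilon>^2 * (I2 / 2 - \<epsilon> / 6 * I3 - \<epsilon>^2 / 24 * I4 + C * \<epsilon>^3) < 0"
        by (intro mult_pos_neg) auto
      then show ?case by (simp add: eval_nat_numeral algebra_simps)
    qed
  next
    assume 0: "I2 = 0 \<and> I3 = 0 \<and> I4 > 0"
    have "((\<lambda>\<epsilon>. - I4 / 24 + C * \<epsilon>) \<longlongrightarrow> - I4 / 24 + C * 0) (at_right 0)"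
      by (intro tendsto_intros)
    then have "\<forall>\<^sub>F \<epsilon> in at_right 0. - I4 / 24 + C * \<epsilon> < 0"
      by (rule order_tendstoD(2)) (use 0 in simp)
    then show ?thesis using eventually_at_right_less[of 0]
    proof eventually_elim
      case (elim \<epsilon>)
      then have "\<epsilon>^4 * (- I4 / 24 + C * \<epsilon>) < 0" by (intro mult_pos_neg) auto
      then show ?case using 0 by (simp add: eval_nat_numeral algebra_simps)
    qed
  qed
  have "\<forall>\<^sub>F \<epsilon> in at_right 0. \<epsilon> < \<delta>"
    using \<open>\<delta> > 0\<close> by (rule eventually_at_right_real[THEN eventually_mono]) simp
  with * show "\<forall>\<^sub>F \<epsilon> in at_right 0. energy H X (\<lambda>x. h x + \<epsilon> * u x) < energy H X h"
    using eventually_at_right_less[of 0]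
  proof eventually_elim
    case (elim \<epsilon>)
    then show ?case using exp[of \<epsilon>] by linarith
  qed
qed

end

section \<open>Instability in explicit directions\<close>

context steady
begin

lemma integrable:
  fixes f :: "real \<Rightarrow> real"
  shows "continuous_on UNIV f \<Longrightarrow> (f has_integral integral {0..X} f) {0..X}"
  by (rule integrable_integral[OF integrable_continuous_real[OF continuous_on_subset[of UNIV]]]) auto

lemma zero_of_zero_on_period:
  assumes "\<And>x. x \<in> {0..X} \<Longrightarrow> f x = 0" "has_period X f"
  shows "f x = 0"
  using has_period_reduce[OF assms(2) X_pos, of x] assms(1) by force

lemma continuous_nonneg_integral_pos:
  fixes f :: "real \<Rightarrow> real"
  assumes "continuous_on UNIV f" "\<And>x. f x \<ge> 0" "has_period X f" "f z \<noteq> 0"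
  shows "integral {0..X} f > 0"
proof -
  have c: "continuous_on {0..X} f" using assms(1) continuous_on_subset by blast
  have "integral {0..X} f \<noteq> 0"
    using integral_eq_0_iff[OF c X_pos] assms(2) zero_of_zero_on_period[OF _ assms(3), of z] assms(4) by auto
  moreover have "integral {0..X} f \<ge> 0"
    using c assms(2) by (intro integral_nonneg integrable_continuous_real) auto
  ultimately show ?thesis by simp
qed

lemma h1_zero_integral: "(h1 has_integral 0) {0..X}"
  by (rule integral_periodic_deriv_zero[OF h_per X_pos h_D])

lemma h2_zero_integral: "(h2 has_integral 0) {0..X}"
  by (rule integral_periodic_deriv_zero[OF per1 X_pos h1_D])

lemma quartic_integral_pos:
  assumes "\<exists>x. h1 x \<noteq> 0"
  shows "integral {0..X} (\<lambda>x. h x powr e * h1 x ^ 4) > 0"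
proof -
  obtain z where "h1 z \<noteq> 0" using assms by blast
  then have "h z powr e * h1 z ^ 4 \<noteq> 0" using h_pos[of z] by simp
  then show ?thesis
    using h_per per1
    by (intro continuous_nonneg_integral_pos[where z = z] continuous_intros cont cont_powr)
       (auto simp: has_period_def)
qed

text \<open>\<open>s\<close> is the sign of the direction. \<open>h1\<close> generates translations,
  which leave the energy unchanged, so the second variation has to vanish there. Explicitly, the
  integrands of orders two and three have the periodic primitives \<open>h1 * h2\<close> and B
  h^(q-1) h1^2 + h2^2.\<close>

lemma unstable_h1:
  assumes H: "potential B q H" and nc: "\<exists>x. h1 x \<noteq> 0" and q: "(q - 1) * (q - 2) > 0" and s: "s\<^sup>2 = 1"
  shows "energy_unstable_dir H X h (\<lambda>x. s * h1 x)"
proof (rule energy_unstable_dirI[OF H])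
  show "((\<lambda>x. s * h1 x) has_real_derivative s * h2 x) (at x)" for x
    by (auto intro!: derivative_eq_intros h1_D)
  show "continuous_on UNIV (\<lambda>x. s * h2 x)" by (intro continuous_intros cont)
  show "has_period X (\<lambda>x. s * h1 x)" using per1 by (simp add: has_period_def)
  show "((\<lambda>x. s * h1 x) has_integral 0) {0..X}"
    using has_integral_mult_right[OF h1_zero_integral, of s] by simp
  have "((\<lambda>x. (h2 x)\<^sup>2 - B * h x powr (q - 1) * (h1 x)\<^sup>2) has_integral 0) {0..X}"
  proof (rule integral_periodic_deriv_zero[OF _ X_pos])
    show "has_period X (\<lambda>x. h1 x * h2 x)" using per1 per2 by (simp add: has_period_def)
    show "((\<lambda>x. h1 x * h2 x) has_real_derivative (h2 x)\<^sup>2 - B * h x powr (q - 1) * (h1 x)\<^sup>2) (at x)" for x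
      by (auto intro!: derivative_eq_intros h1_D h2_D simp: power2_eq_square)
  qed
  from has_integral_mult_right[OF this, of "s\<^sup>2"]
  show "((\<lambda>x. (s * h2 x)\<^sup>2 - B * h x powr (q - 1) * (s * h1 x)\<^sup>2) has_integral 0) {0..X}"
    using s by (simp add: power_mult_distrib)
  have "((\<lambda>x. B * (q - 1) * h x powr (q - 2) * (h1 x)^3) has_integral 0) {0..X}"
  proof (rule integral_periodic_deriv_zero[OF _ X_pos])
    show "has_period X (\<lambda>x. B * h x powr (q - 1) * (h1 x)\<^sup>2 + (h2 x)\<^sup>2)"
      using h_per per1 per2 by (simp add: has_period_def)
    show "((\<lambda>x. B * h x powr (q - 1) * (h1 x)\<^sup>2 + (h2 x)\<^sup>2) has_real_derivative
        B * (q - 1) * h x powr (q - 2) * (h1 x)^3) (at x)" for x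
      by (rule DERIV_cong, (rule h_powr_D h1_D h2_D DERIV_const DERIV_add DERIV_power DERIV_mult)+)
         (simp add: power2_eq_square power3_eq_cube algebra_simps)
  qed
  from has_integral_mult_right[OF this, of "s^3"]
  show "((\<lambda>x. B * (q - 1) * h x powr (q - 2) * (s * h1 x)^3) has_integral 0) {0..X}"
    by (simp add: power_mult_distrib mult_ac)
  have s4: "s ^ 4 = 1" using s power_mult[of s 2 2] by simp
  have "((\<lambda>x. h x powr (q - 3) * h1 x ^ 4) has_integral integral {0..X} (\<lambda>x. h x powr (q - 3) * h1 x ^ 4)) {0..X}"
    by (intro integrable continuous_intros cont cont_powr)
  from has_integral_mult_right[OF this, of "B * (q - 1) * (q - 2)"]
  show "((\<lambda>x. B * (q - 1) * (q - 2) * h x powr (q - 3) * (s * h1 x)^4) has_integral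
     B * (q - 1) * (q - 2) * integral {0..X} (\<lambda>x. h x powr (q - 3) * h1 x ^ 4)) {0..X}"
    by (simp add: power_mult_distrib s4 mult_ac)
  show "(0::real) < 0 \<or> (0::real) = 0 \<and> (0::real) = 0 \<and>
      B * (q - 1) * (q - 2) * integral {0..X} (\<lambda>x. h x powr (q - 3) * h1 x ^ 4) > 0"
    using quartic_integral_pos[OF nc, of "q - 3"] mult_pos_pos[OF B_pos q] by (simp add: mult.assoc[symmetric])
qed

text \<open>Differentiating h'' h''' produces, besides the quadratic form, the indefinite term
  h^(q-2) h1^2 h2. The second summand of the primitive trades it for a multiple of h^(q-3) h1^4,
  which has a sign.\<close>

lemma quadratic_form_h2:
  "((\<lambda>x. (- (B * h x powr (q - 1) * h1 x))\<^sup>2 - B * h x powr (q - 1) * (h2 x)\<^sup>2) has_integral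
     - (B * ((q - 1) * (q - 2)) / 3) * integral {0..X} (\<lambda>x. h x powr (q - 3) * h1 x ^ 4)) {0..X}"
proof -
  let ?h3 = "\<lambda>x. - (B * h x powr (q - 1) * h1 x)"
  let ?c = "B * ((q - 1) * (q - 2)) / 3"
  have 1: "((\<lambda>x. (?h3 x)\<^sup>2 - B * h x powr (q - 1) * (h2 x)\<^sup>2 + ?c * (h x powr (q - 3) * h1 x ^ 4)) has_integral 0) {0..X}"
  proof (rule integral_periodic_deriv_zero[OF _ X_pos])
    show "has_period X (\<lambda>x. h2 x * ?h3 x + (B * (q - 1) / 3) * h x powr (q - 2) * h1 x ^ 3)"
      using h_per per1 per2 by (simp add: has_period_def)
    show "((\<lambda>x. h2 x * ?h3 x + (B * (q - 1) / 3) * h x powr (q - 2) * h1 x ^ 3) has_real_derivative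
       (?h3 x)\<^sup>2 - B * h x powr (q - 1) * (h2 x)\<^sup>2 + ?c * (h x powr (q - 3) * h1 x ^ 4)) (at x)" for x
      by (rule DERIV_cong, (rule h_powr_D h1_D h2_D DERIV_const DERIV_add DERIV_power DERIV_minus DERIV_mult)+)
         (simp add: power2_eq_square power3_eq_cube power4_eq_xxxx field_simps)
  qed
  have 2: "((\<lambda>x. ?c * (h x powr (q - 3) * h1 x ^ 4)) has_integral
      ?c * integral {0..X} (\<lambda>x. h x powr (q - 3) * h1 x ^ 4)) {0..X}"
    by (intro has_integral_mult_right integrable continuous_intros cont cont_powr)
  show ?thesis using has_integral_diff[OF 1 2] by simp
qed

lemma unstable_h2:
  assumes H: "potential B q H" and nc: "\<exists>x. h1 x \<noteq> 0" and q: "(q - 1) * (q - 2) > 0" and s: "s\<^sup>2 = 1"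
  shows "energy_unstable_dir H X h (\<lambda>x. s * h2 x)"
proof (rule energy_unstable_dirI[OF H])
  show "((\<lambda>x. s * h2 x) has_real_derivative s * - (B * h x powr (q - 1) * h1 x)) (at x)" for x
    by (intro DERIV_cmult h2_D)
  show "continuous_on UNIV (\<lambda>x. s * - (B * h x powr (q - 1) * h1 x))"
    by (intro continuous_intros cont cont_powr)
  show "has_period X (\<lambda>x. s * h2 x)" using per2 by (simp add: has_period_def)
  show "((\<lambda>x. s * h2 x) has_integral 0) {0..X}"
    using has_integral_mult_right[OF h2_zero_integral, of s] by simp
  from has_integral_mult_right[OF quadratic_form_h2, of "s\<^sup>2"]
  show "((\<lambda>x. (s * - (B * h x powr (q - 1) * h1 x))\<^sup>2 - B * h x powr (q - 1) * (s * h2 x)\<^sup>2) has_integral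
     - (B * ((q - 1) * (q - 2)) / 3) * integral {0..X} (\<lambda>x. h x powr (q - 3) * h1 x ^ 4)) {0..X}"
    using s by (simp add: power_mult_distrib)
  show "- (B * ((q - 1) * (q - 2)) / 3) * integral {0..X} (\<lambda>x. h x powr (q - 3) * h1 x ^ 4) < 0 \<or>
     - (B * ((q - 1) * (q - 2)) / 3) * integral {0..X} (\<lambda>x. h x powr (q - 3) * h1 x ^ 4) = 0 \<and>
     integral {0..X} (\<lambda>x. B * (q - 1) * h x powr (q - 2) * (s * h2 x)^3) = 0 \<and>
     integral {0..X} (\<lambda>x. B * (q - 1) * (q - 2) * h x powr (q - 3) * (s * h2 x)^4) > 0"
    using quartic_integral_pos[OF nc, of "q - 3"] q B_pos by (intro disjI1 mult_neg_pos) auto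
qed (intro integrable continuous_intros cont cont_powr)+

lemma second_order_ode: "\<exists>D. \<forall>x. h2 x = D - B * nonlin q (h x)"
proof -
  have "((\<lambda>x. h2 x + B * nonlin q (h x)) has_real_derivative 0) (at x)" for x
    by (auto intro!: derivative_eq_intros h2_D h_D h_pos DERIV_chain'[where g = "nonlin q"])
  then have "h2 x + B * nonlin q (h x) = h2 0 + B * nonlin q (h 0)" for x
    using DERIV_isconst_all[of "\<lambda>x. h2 x + B * nonlin q (h x)"] by blast
  then show ?thesis by (intro exI[of _ "h2 0 + B * nonlin q (h 0)"]) (simp add: algebra_simps)
qed

lemma deriv_eqs: "deriv h = h1" "deriv h1 = h2"
  using h_D h1_D by (auto intro!: DERIV_imp_deriv)

lemma smooth_h: "smooth h" "smooth (\<lambda>x. h1 x * h1 x)"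
proof -
  obtain D where D: "\<And>x. h2 x = D - B * nonlin q (h x)" using second_order_ode by blast
  have h1': "(h1 has_real_derivative (if q = 0 then D else D + B / q)
     + (if q = 0 then 0 else - B / q) * h x powr q + (if q = 0 then - B else 0) * ln (h x)) (at x)" for x
    using h1_D[of x] unfolding D nonlin_def by (cases "q = 0") (auto simp: algebra_simps diff_divide_distrib)
  show "smooth h" by (rule smooth_ode[OF h_pos h_D h1'])
  show "smooth (\<lambda>x. h1 x * h1 x)"
    by (rule smooth_ode_algebra[OF _ h_pos h_D h1']) (intro ode_algebra.intros)
qed

text \<open>For \<open>q = 2\<close> the second variation vanishes at \<open>h''\<close>, but \<open>h''\<close> is not a critical
  point of it on mean-zero functions, so a small correction makes it negative.\<close>

lemma unstable_quadratic:
  assumes H: "potential B q H" and nc: "\<exists>x. h1 x \<noteq> 0" and q: "q = 2"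
  shows "energy_unstable H X h"
proof -
  let ?h3 = "\<lambda>x. - (B * h x powr (q - 1) * h1 x)"
  define \<mu> where "\<mu> = integral {0..X} (\<lambda>x. h1 x * h1 x) / X"
  \<comment> \<open>For \<open>q = 2\<close> the linearised operator maps \<open>h2\<close> to
    \<open>B * h1 * h1\<close>. Up to the factor \<open>B\<close>, \<open>v\<close> is minus the
    mean-free part of this gradient, so it is the descent direction at \<open>h2\<close>.\<close>
  define v where "v x = \<mu> - h1 x * h1 x" for x
  define v1 where "v1 x = - 2 * h1 x * h2 x" for x
  have v_D: "(v has_real_derivative v1 x) (at x)" for x
    unfolding v_def v1_def by (auto intro!: derivative_eq_intros h1_D)
  have v_cont: "continuous_on UNIV v" "continuous_on UNIV v1"
    unfolding v_def v1_def by (intro continuous_intros cont)+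
  have v_per: "has_period X v" using per1 by (simp add: v_def has_period_def)
  have v0: "(v has_integral 0) {0..X}"
  proof -
    have "(v has_integral (X * \<mu> - integral {0..X} (\<lambda>x. h1 x * h1 x))) {0..X}"
      unfolding v_def
    proof (intro has_integral_diff integrable continuous_intros cont)
      show "((\<lambda>x. \<mu>) has_integral X * \<mu>) {0..X}"
        using has_integral_const_real[of \<mu> 0 X] X_pos by simp
    qed
    then show ?thesis using X_pos by (simp add: \<mu>_def)
  qed
  define K where "K = integral {0..X} (\<lambda>x. v x * v x)"
  have "K > 0"
  proof -
    \<comment> \<open>Otherwise \<open>h1\<close> has constant square; since periodicity of
      \<open>h\<close> gives \<open>h1\<close> a zero, it would vanish identically.\<close>
    have "\<exists>z. v z \<noteq> 0"
    proof (rule ccontr)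
      assume "\<not> ?thesis"
      then have *: "h1 x * h1 x = \<mu>" for x by (simp add: v_def)
      obtain z where "h X - h 0 = (X - 0) * h1 z" using MVT2[of 0 X h h1] h_D X_pos by auto
      then have "h1 z = 0" using h_per X_pos by (metis add_0 diff_self diff_zero has_period_def mult_eq_0_iff less_irrefl)
      then show False using * nc by (metis mult_eq_0_iff)
    qed
    then obtain z where "v z \<noteq> 0" by blast
    then show ?thesis unfolding K_def using v_per
      by (intro continuous_nonneg_integral_pos[where z = z] continuous_intros v_cont)
         (auto simp: has_period_def)
  qed
  define Z where "Z = integral {0..X} (\<lambda>x. (v1 x)\<^sup>2 - B * h x powr (q - 1) * (v x)\<^sup>2)"
  have Z: "((\<lambda>x. (v1 x)\<^sup>2 - B * h x powr (q - 1) * (v x)\<^sup>2) has_integral Z) {0..X}"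
    unfolding Z_def by (intro integrable continuous_intros cont cont_powr v_cont)
  have Q0: "((\<lambda>x. (?h3 x)\<^sup>2 - B * h x powr (q - 1) * (h2 x)\<^sup>2) has_integral 0) {0..X}"
    using quadratic_form_h2 q by simp
  \<comment> \<open>After integration by parts the gradient B h1^2 = B (\<mu> - v) is tested against
    \<open>v\<close>; the part with \<open>\<mu>\<close> drops out because \<open>v\<close> has mean
    zero.\<close>
  have cross: "((\<lambda>x. ?h3 x * v1 x - B * h x powr (q - 1) * h2 x * v x) has_integral - (B * K)) {0..X}"
  proof -
    have 1: "((\<lambda>x. ?h3 x * v1 x - (B * h x powr (q - 1) * h2 x + B * h1 x * h1 x) * v x) has_integral 0) {0..X}"
    proof (rule integral_periodic_deriv_zero[OF _ X_pos])
      show "has_period X (\<lambda>x. ?h3 x * v x)" using h_per per1 v_per by (simp add: has_period_def)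
      show "((\<lambda>x. ?h3 x * v x) has_real_derivative
         ?h3 x * v1 x - (B * h x powr (q - 1) * h2 x + B * h1 x * h1 x) * v x) (at x)" for x
        using h_pos[of x] q
        by (intro DERIV_cong[OF DERIV_mult[OF DERIV_minus[OF DERIV_mult[OF DERIV_cmult[OF h_powr_D] h1_D]] v_D]])
           (simp add: algebra_simps)
    qed
    have 2: "((\<lambda>x. B * (v x * v x)) has_integral B * K) {0..X}"
      unfolding K_def by (intro has_integral_mult_right integrable continuous_intros v_cont)
    have eq: "?h3 x * v1 x - (B * h x powr (q - 1) * h2 x + B * h1 x * h1 x) * v x + B * \<mu> * v x - B * (v x * v x)
        = ?h3 x * v1 x - B * h x powr (q - 1) * h2 x * v x" for x
      by (simp add: v_def algebra_simps)
    from has_integral_diff[OF has_integral_add[OF 1 has_integral_mult_right[OF v0, of "B * \<mu>"]] 2]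
    show ?thesis unfolding eq by simp
  qed
  \<comment> \<open>Ensures \<open>\<delta> * Z \<le> B * K\<close>, so the negative cross term 2
    \<delta> B K outweighs the second variation at \<delta> v.\<close>
  define \<delta> where "\<delta> = B * K / (\<bar>Z\<bar> + 1)"
  have "\<delta> > 0" unfolding \<delta>_def using B_pos \<open>K > 0\<close> by simp
  have "\<delta> * Z \<le> \<delta> * (\<bar>Z\<bar> + 1)" using \<open>\<delta> > 0\<close> by (intro mult_left_mono) auto
  then have "\<delta> * Z \<le> B * K" unfolding \<delta>_def by simp
  moreover have "B * K > 0" using B_pos \<open>K > 0\<close> by simp
  ultimately have neg: "\<delta> * (- 2 * (B * K) + \<delta> * Z) < 0" using \<open>\<delta> > 0\<close> by (intro mult_pos_neg) auto
  define u where "u x = h2 x + \<delta> * v x" for x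
  define u1 where "u1 x = ?h3 x + \<delta> * v1 x" for x
  have "energy_unstable_dir H X h u"
  proof (rule energy_unstable_dirI[OF H])
    show "(u has_real_derivative u1 x) (at x)" for x
      unfolding u_def u1_def by (intro DERIV_add h2_D DERIV_cmult v_D)
    show "continuous_on UNIV u1" unfolding u1_def by (intro continuous_intros cont cont_powr v_cont)
    show "has_period X u" using per2 v_per by (simp add: u_def has_period_def)
    show "(u has_integral 0) {0..X}"
      unfolding u_def using has_integral_add[OF h2_zero_integral has_integral_mult_right[OF v0, of \<delta>]] by simp
    have "(u1 x)\<^sup>2 - B * h x powr (q - 1) * (u x)\<^sup>2 =
       ((?h3 x)\<^sup>2 - B * h x powr (q - 1) * (h2 x)\<^sup>2)
       + 2 * \<delta> * (?h3 x * v1 x - B * h x powr (q - 1) * h2 x * v x)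
       + \<delta>\<^sup>2 * ((v1 x)\<^sup>2 - B * h x powr (q - 1) * (v x)\<^sup>2)" for x
      unfolding u1_def u_def by (simp add: power2_eq_square algebra_simps)
    with has_integral_add[OF has_integral_add[OF Q0 has_integral_mult_right[OF cross, of "2 * \<delta>"]]
        has_integral_mult_right[OF Z, of "\<delta>\<^sup>2"]]
    show "((\<lambda>x. (u1 x)\<^sup>2 - B * h x powr (q - 1) * (u x)\<^sup>2) has_integral
        (0 + 2 * \<delta> * - (B * K) + \<delta>\<^sup>2 * Z)) {0..X}" by simp
    have uc: "continuous_on UNIV u" unfolding u_def by (intro continuous_intros cont v_cont)
    show "((\<lambda>x. B * (q - 1) * h x powr (q - 2) * (u x)^3) has_integral
        integral {0..X} (\<lambda>x. B * (q - 1) * h x powr (q - 2) * (u x)^3)) {0..X}"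
      by (intro integrable continuous_intros cont_powr uc)
    show "((\<lambda>x. B * (q - 1) * (q - 2) * h x powr (q - 3) * (u x)^4) has_integral
        integral {0..X} (\<lambda>x. B * (q - 1) * (q - 2) * h x powr (q - 3) * (u x)^4)) {0..X}"
      by (intro integrable continuous_intros cont_powr uc)
    show "0 + 2 * \<delta> * - (B * K) + \<delta>\<^sup>2 * Z < 0 \<or> 0 + 2 * \<delta> * - (B * K) + \<delta>\<^sup>2 * Z = 0 \<and>
       integral {0..X} (\<lambda>x. B * (q - 1) * h x powr (q - 2) * (u x)^3) = 0 \<and>
       integral {0..X} (\<lambda>x. B * (q - 1) * (q - 2) * h x powr (q - 3) * (u x)^4) > 0"
      using neg by (simp add: power2_eq_square algebra_simps)
  qed
  moreover have "smooth u"
  proof -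
    have "smooth h2" using smooth_deriv[OF smooth_deriv[OF smooth_h(1)]] deriv_eqs by simp
    from smooth_scaled_add[OF this smooth_h(2), of 1 1 0 "- \<delta>" 1 0 "\<delta> * \<mu>"]
    show ?thesis unfolding u_def v_def by (simp add: algebra_simps)
  qed
  ultimately show ?thesis unfolding energy_unstable_def by blast
qed

end

section \<open>Rescaling\<close>

lemma steady_of_steady_state:
  assumes "B > 0" "q = m - n + 1" "X > 0" "steady_state B m n X h"
  shows "steady B q X h (deriv h) (deriv (deriv h))"
proof -
  have C4: "Ck 4 h" and pos: "\<And>x. h x > 0" and per: "has_period X h"
    and eq: "\<And>x. ((\<lambda>y. h y powr n * (deriv ^^ 3) h y + B * h y powr m * deriv h y)
            has_real_derivative 0) (at x)"
    using assms(4) unfolding steady_state_def by auto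
  have diff: "(deriv ^^ j) h differentiable (at x)" if "j < 4" for j x
    using C4 that unfolding Ck_def by blast
  have D0: "(h has_real_derivative deriv h x) (at x)" for x
    using diff[of 0 x] by (simp add: DERIV_deriv_iff_real_differentiable)
  have D1: "(deriv h has_real_derivative deriv (deriv h) x) (at x)" for x
    using diff[of 1 x] by (simp add: DERIV_deriv_iff_real_differentiable)
  have D2: "(deriv (deriv h) has_real_derivative (deriv ^^ 3) h x) (at x)" for x
    using diff[of 2 x] by (simp add: DERIV_deriv_iff_real_differentiable eval_nat_numeral)
  define C where "C = h 0 powr n * (deriv ^^ 3) h 0 + B * h 0 powr m * deriv h 0"
  have "h x powr n * (deriv ^^ 3) h x + B * h x powr m * deriv h x = C" for x
    unfolding C_def
    by (rule DERIV_isconst_all[where f = "\<lambda>y. h y powr n * (deriv ^^ 3) h y + B * h y powr m * deriv h y"])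
       (use eq in blast)
  then have "h x powr (- n) * (h x powr n * (deriv ^^ 3) h x + B * h x powr m * deriv h x) = C * h x powr (- n)" for x
    by simp
  moreover have "h x powr (- n) * (h x powr n * (deriv ^^ 3) h x + B * h x powr m * deriv h x)
     = (deriv ^^ 3) h x + B * h x powr (q - 1) * deriv h x" for x
  proof -
    have "h x powr (- n) * h x powr n = 1" "h x powr (- n) * h x powr m = h x powr (q - 1)"
      using pos[of x] assms(2) by (simp_all add: powr_add[symmetric])
    then show ?thesis by (simp add: distrib_left mult.assoc[symmetric] mult.left_commute[of _ B])
  qed
  ultimately have h3: "(deriv ^^ 3) h x + B * h x powr (q - 1) * deriv h x = C * h x powr (- n)" for x
    by simp
  text \<open>By periodicity the derivative of \<open>h'' + B (h\<^sup>q - 1)/q\<close> vanishes somewhere, which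
    forces the flux \<open>C\<close> to be zero.\<close>
  let ?K = "\<lambda>x. deriv (deriv h) x + B * nonlin q (h x)"
  have KD: "(?K has_real_derivative C * h x powr (- n)) (at x)" for x
    unfolding h3[symmetric]
    by (auto intro!: derivative_eq_intros D2 D0 pos DERIV_chain'[where g = "nonlin q"])
  have "has_period X (deriv (deriv h))"
    using has_period_deriv[OF has_period_deriv[OF per D0] D1] .
  then have "?K X = ?K 0" using per by (metis add_0 has_period_def)
  moreover obtain z where "?K X - ?K 0 = (X - 0) * (C * h z powr (- n))"
    using MVT2[OF assms(3) KD] by blast
  ultimately have "C = 0" using assms(3) pos[of z] by simp
  then have "(deriv ^^ 3) h x = - (B * h x powr (q - 1) * deriv h x)" for x
    using h3[of x] by simp
  then show ?thesis using assms pos per D0 D1 D2 by unfold_locales auto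
qed

lemma nonlin_nonneg:
  assumes "y \<ge> 1"
  shows "nonlin q y \<ge> 0"
proof -
  have "nonlin q 1 \<le> nonlin q y"
  proof (rule DERIV_nonneg_imp_nondecreasing[OF assms])
    fix t :: real assume "1 \<le> t"
    then show "\<exists>d. (nonlin q has_real_derivative d) (at t) \<and> d \<ge> 0"
      by (intro exI[of _ "t powr (q - 1)"] conjI DERIV_nonlin) auto
  qed
  moreover have "nonlin q 1 = 0" by (simp add: nonlin_def)
  ultimately show ?thesis by simp
qed

text \<open>Merges the two branches of \<open>rescaled\<close> into one amplitude \<open>a\<close>
  and one length factor \<open>b\<close>. The identity for B a^(1-q) b^2 carries the second
  variation of the profile to that of \<open>h\<close>; the last clause normalises the differential
  equation.\<close>

lemma rescaled_scaling:
  assumes "B > 0" "q \<noteq> 0 \<longrightarrow> D > 0"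
  shows "\<exists>a>0. \<exists>b>0. (\<forall>g x. rescaled B q D g x = a * g (b * x)) \<and> B * a powr (1 - q) * b\<^sup>2 = 1 \<and>
    (\<forall>y>0. a * b\<^sup>2 * (if q = 0 then D - B * ln y else (D - B * y powr q) / q) = - nonlin q (a * y))"
proof (cases "q = 0")
  case True
  define a where "a = exp (- D / B)"
  define b where "b = exp (D / (2 * B)) * B powr (-1/2)"
  have "B powr (-1/2) * B powr (-1/2) = 1 / B"
    using assms(1) by (simp add: powr_add[symmetric] powr_minus_divide)
  moreover have "exp (D / (2 * B)) * exp (D / (2 * B)) = exp (D / B)"
    by (simp add: exp_add[symmetric])
  ultimately have b2: "b\<^sup>2 = exp (D / B) / B"
    unfolding b_def by (simp add: power2_eq_square algebra_simps)
  have ab2: "a * b\<^sup>2 = 1 / B" unfolding a_def b2 by (simp add: exp_minus)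
  have "a > 0" "b > 0" using assms(1) by (auto simp: a_def b_def)
  show ?thesis
  proof (rule exI[of _ a], intro conjI exI[of _ b] allI impI)
    fix y :: real assume "y > 0"
    then have "ln (a * y) = - D / B + ln y" using \<open>a > 0\<close> by (simp add: ln_mult a_def)
    then show "a * b\<^sup>2 * (if q = 0 then D - B * ln y else (D - B * y powr q) / q) = - nonlin q (a * y)"
      using True assms(1) unfolding ab2 nonlin_def by (simp add: field_simps)
  next
    have "B * a powr (1 - q) * b\<^sup>2 = B * (a * b\<^sup>2)" using True \<open>a > 0\<close> by simp
    then show "B * a powr (1 - q) * b\<^sup>2 = 1" unfolding ab2 using assms(1) by simp
  qed (use True \<open>a > 0\<close> \<open>b > 0\<close> in \<open>auto simp: rescaled_def a_def b_def\<close>)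
next
  case False
  then have "D > 0" using assms by simp
  define a where "a = (B / D) powr (1 / q)"
  define b where "b = (D / B) powr (1 / (2 * q)) * D powr (-1/2)"
  have pos: "a > 0" "b > 0" using assms(1) \<open>D > 0\<close> by (auto simp: a_def b_def)
  have aq: "a powr q = B / D" using False assms(1) \<open>D > 0\<close> by (simp add: a_def powr_powr)
  have "D powr (-1/2) * D powr (-1/2) = 1 / D"
    using \<open>D > 0\<close> by (simp add: powr_add[symmetric] powr_minus_divide)
  moreover have "(D / B) powr (1 / (2 * q)) * (D / B) powr (1 / (2 * q)) = (D / B) powr (1 / q)"
    using False by (simp add: powr_add[symmetric])
  ultimately have b2: "b\<^sup>2 = (D / B) powr (1 / q) / D"
    unfolding b_def by (simp add: power2_eq_square algebra_simps)
  have "a * (D / B) powr (1 / q) = 1"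
    unfolding a_def using assms(1) \<open>D > 0\<close> by (simp add: powr_mult[symmetric])
  then have ab2: "a * b\<^sup>2 = 1 / D" unfolding b2 by simp
  have "B * a powr (1 - q) * b\<^sup>2 = B / a powr q * (a * b\<^sup>2)"
    using pos by (simp add: powr_diff)
  also have "\<dots> = 1" unfolding ab2 aq using assms(1) \<open>D > 0\<close> by simp
  finally have 1: "B * a powr (1 - q) * b\<^sup>2 = 1" .
  show ?thesis
  proof (rule exI[of _ a], intro conjI exI[of _ b] allI impI)
    fix y :: real assume "y > 0"
    then have "(a * y) powr q = B / D * y powr q" using pos aq by (simp add: powr_mult)
    then show "a * b\<^sup>2 * (if q = 0 then D - B * ln y else (D - B * y powr q) / q) = - nonlin q (a * y)"
      using False \<open>D > 0\<close> unfolding ab2 nonlin_def by (simp add: field_simps)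
  qed (use False pos 1 in \<open>auto simp: rescaled_def a_def b_def\<close>)
qed

context steady
begin

lemma ex_rescales_to:
  assumes nc: "\<exists>x. h1 x \<noteq> 0" and min: "\<And>x. h x0 \<le> h x"
  shows "\<exists>\<alpha>. rescales_to B q (\<lambda>x. h (x0 + x)) \<alpha>"
proof -
  obtain D0 where D0: "\<And>x. h2 x = D0 - B * nonlin q (h x)" using second_order_ode by blast
  \<comment> \<open>For \<open>q \<noteq> 0\<close> this absorbs the -1 in \<open>nonlin\<close>: D0
    - B (h^q - 1)/q = (D - B h^q)/q.\<close>
  define D where "D = (if q = 0 then D0 else q * D0 + B)"
  have ode: "h2 x = (if q = 0 then D - B * ln (h x) else (D - B * h x powr q) / q)" for x
    unfolding D0 D_def nonlin_def by (auto simp: field_simps)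
  \<comment> \<open>Since h' is periodic, h'' vanishes somewhere, and there D = B h^q.\<close>
  have Dpos: "q \<noteq> 0 \<longrightarrow> D > 0"
  proof
    assume "q \<noteq> 0"
    obtain z where "h1 X - h1 0 = (X - 0) * h2 z" using MVT2[OF X_pos h1_D] by blast
    moreover have "h1 X = h1 0" using per1 by (metis add_0 has_period_def)
    ultimately have "h2 z = 0" using X_pos by simp
    then have "D = B * h z powr q" using ode[of z] \<open>q \<noteq> 0\<close> by simp
    then show "D > 0" using B_pos h_pos[of z] by simp
  qed
  obtain a b where ab: "a > 0" "b > 0" "\<And>g x. rescaled B q D g x = a * g (b * x)"
    and scal: "\<And>y. y > 0 \<Longrightarrow> a * b\<^sup>2 * (if q = 0 then D - B * ln y else (D - B * y powr q) / q) = - nonlin q (a * y)"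
    using rescaled_scaling[OF B_pos Dpos] by metis
  define k where "k = rescaled B q D (\<lambda>x. h (x0 + x))"
  have k: "k x = a * h (x0 + b * x)" for x unfolding k_def ab(3) ..
  define k1 where "k1 x = a * b * h1 (x0 + b * x)" for x
  have aff: "((\<lambda>x. x0 + b * x) has_real_derivative b) (at x)" for x
    by (auto intro!: derivative_eq_intros)
  have kD: "(k has_real_derivative k1 x) (at x)" for x
    unfolding k k1_def by (auto intro!: derivative_eq_intros DERIV_chain2[OF h_D aff] simp: k[abs_def])
  have k1D: "(k1 has_real_derivative - nonlin q (k x)) (at x)" for x
  proof -
    have "((\<lambda>x. a * b * h1 (x0 + b * x)) has_real_derivative a * b * (h2 (x0 + b * x) * b)) (at x)"
      by (intro DERIV_cmult DERIV_chain2[OF h1_D aff])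
    moreover have "a * b * (h2 (x0 + b * x) * b) = - nonlin q (k x)"
      using scal[OF h_pos, of "x0 + b * x"] unfolding ode k by (simp add: power2_eq_square algebra_simps)
    ultimately show ?thesis unfolding k1_def[abs_def] by simp
  qed
  have k_pos: "k x > 0" for x unfolding k using ab(1) h_pos by simp
  define p where "p = X / b"
  have "p > 0" unfolding p_def using X_pos ab(2) by simp
  have bp: "x0 + b * (x + p) = (x0 + b * x) + X" for x
    unfolding p_def using ab(2) by (simp add: field_simps)
  have per_k: "has_period p k" using h_per unfolding has_period_def k bp by simp
  have "h1 x0 = 0"
    using DERIV_local_min[OF h_D, of 1 x0] min by simp
  then have k10: "k1 0 = 0" unfolding k1_def by simp
  define \<alpha> where "\<alpha> = k 0"
  have k_min: "\<alpha> \<le> k x" for x unfolding \<alpha>_def k using min ab(1) by simp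
  \<comment> \<open>With a minimum of at least 1 the equation gives k'' \<le> 0 everywhere; a
    nonincreasing periodic k' that vanishes at 0 is zero, against nonconstancy.\<close>
  have "\<alpha> < 1"
  proof (rule ccontr)
    assume "\<not> \<alpha> < 1"
    then have nl: "nonlin q (k x) \<ge> 0" for x using k_min[of x] by (intro nonlin_nonneg) linarith
    have anti: "k1 y \<le> k1 x" if "x \<le> y" for x y
      using nl by (intro DERIV_nonpos_imp_nonincreasing[OF that]) (use k1D in \<open>force\<close>)
    have per_k1: "has_period p k1" using has_period_deriv[OF per_k kD] .
    have "k1 x = 0" for x
    proof -
      obtain y where y: "0 \<le> y" "y < p" "k1 x = k1 y" using has_period_reduce[OF per_k1 \<open>p > 0\<close>] by blast
      have "k1 p = k1 0" using per_k1 by (metis add_0 has_period_def)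
      then show ?thesis using anti[of 0 y] anti[of y p] y k10 by simp
    qed
    then have "h1 (x0 + b * x) = 0" for x unfolding k1_def using ab by simp
    then have "h1 (x0 + b * ((z - x0) / b)) = 0" for z by blast
    then show False using nc ab(2) by simp
  qed
  have "k_prof q \<alpha> = k"
    by (rule k_prof_eqI(1)[OF kD k1D k_pos per_k \<open>p > 0\<close> _ k10]) (simp add: \<alpha>_def)
  moreover have "\<alpha> > 0" unfolding \<alpha>_def by (rule k_pos)
  moreover have "deriv (deriv (\<lambda>x. h (x0 + x))) x = h2 (x0 + x)" for x
  proof -
    have s: "((\<lambda>x. x0 + x) has_real_derivative 1) (at x)" for x by (auto intro!: derivative_eq_intros)
    have "deriv (\<lambda>x. h (x0 + x)) = (\<lambda>x. h1 (x0 + x))"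
      using DERIV_chain2[OF h_D s] by (auto intro!: DERIV_imp_deriv)
    then show ?thesis using DERIV_chain2[OF h1_D s] by (auto intro!: DERIV_imp_deriv)
  qed
  moreover have "k 0 = \<alpha>" by (simp add: \<alpha>_def)
  ultimately have "rescales_to B q (\<lambda>x. h (x0 + x)) \<alpha>"
    unfolding rescales_to_def using \<open>\<alpha> < 1\<close> Dpos k_min
    by (intro conjI exI[of _ D]) (auto simp: ode k_def diff_divide_distrib)
  then show ?thesis by blast
qed

section \<open>Transfer of a perturbation from the profile to the steady state\<close>

lemma integral_rescale:
  fixes Z :: "real \<Rightarrow> real"
  assumes "continuous_on UNIV Z" "has_period P Z" "P > 0" "b > 0" "X = real N * (b * P)"
    and "(Z has_integral J) {0..P}"
  shows "((\<lambda>y. Z ((y - x0) / b)) has_integral (b * real N * J)) {0..X}"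
proof -
  obtain F where F: "\<And>x. (F has_real_derivative Z x) (at x)"
    using antiderivative_exists[OF assms(1)] by blast
  have J: "J = F P - F 0"
    using has_integral_unique[OF assms(6) has_integral_antiderivative[OF _ F]] \<open>P > 0\<close> by simp
  have aff: "((\<lambda>y. (y - x0) / b) has_real_derivative 1 / b) (at y)" for y
    using assms(4) by (auto intro!: derivative_eq_intros)
  have "((\<lambda>y. b * F ((y - x0) / b)) has_real_derivative b * (Z ((y - x0) / b) * (1 / b))) (at y)" for y
    by (intro DERIV_cmult DERIV_chain2[OF F aff])
  then have "((\<lambda>y. b * F ((y - x0) / b)) has_real_derivative Z ((y - x0) / b)) (at y)" for y
    using assms(4) by simp
  from has_integral_antiderivative[OF less_imp_le[OF X_pos] this]
  have 1: "((\<lambda>y. Z ((y - x0) / b)) has_integral (b * F ((X - x0) / b) - b * F ((0 - x0) / b))) {0..X}" .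
  have "(X - x0) / b = (0 - x0) / b + real N * P"
    using assms(4,5) by (simp add: field_simps)
  then have "F ((X - x0) / b) - F ((0 - x0) / b) = real N * J"
    using antiderivative_period_mult[OF assms(2) F, of "(0 - x0) / b" N] by (simp only: J)
  then have "b * F ((X - x0) / b) - b * F ((0 - x0) / b) = b * real N * J"
    by (simp only: right_diff_distrib[symmetric] mult.assoc)
  with 1 show ?thesis by simp
qed

text \<open>The perturbation is pulled back by the affine change of variable. The hypothesis on
  \<open>a\<close> and \<open>b\<close> means a^(q-1) = B b^2, so the second variation becomes
  \<open>J\<close> times the positive factor N / b, where \<open>N\<close> counts the copies of the
  profile period in \<open>X\<close>.\<close>

lemma unstable_of_profile:
  assumes H: "potential B q H" and ab: "a > 0" "b > 0" "B * a powr (1 - q) * b\<^sup>2 = 1"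
    and k: "\<And>x. k x = a * h (x0 + b * x)" and P: "P > 0" "X = real N * (b * P)"
    and v: "smooth v" "has_period P v" "(v has_integral 0) {0..P}" and k_per: "has_period P k"
    and J: "((\<lambda>x. (deriv v x)\<^sup>2 - k x powr (q - 1) * (v x)\<^sup>2) has_integral J) {0..P}" "J < 0"
  shows "energy_unstable H X h"
proof -
  have v_D: "(v has_real_derivative deriv v x) (at x)" for x using smooth_DERIV[OF v(1)] .
  have v1_D: "(deriv v has_real_derivative deriv (deriv v) x) (at x)" for x
    using smooth_DERIV[OF smooth_deriv[OF v(1)]] .
  have v_cont: "continuous_on UNIV v" "continuous_on UNIV (deriv v)"
    using v_D v1_D by (meson DERIV_isCont continuous_at_imp_continuous_on)+
  have v1_per: "has_period P (deriv v)" by (rule has_period_deriv[OF v(2) v_D])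
  have k_pos: "k x > 0" for x unfolding k using ab h_pos by simp
  have "continuous_on UNIV (\<lambda>x. a * h (x0 + b * x))"
    by (intro continuous_intros continuous_on_compose2[OF cont(1)[of UNIV]]) auto
  then have k_cont: "continuous_on UNIV k" unfolding k[abs_def] .
  define u where "u y = v ((y - x0) / b)" for y
  define u1 where "u1 y = deriv v ((y - x0) / b) / b" for y
  have aff: "((\<lambda>y. (y - x0) / b) has_real_derivative 1 / b) (at y)" for y
    using ab(2) by (auto intro!: derivative_eq_intros)
  have u_D: "(u has_real_derivative u1 y) (at y)" for y
    unfolding u_def[abs_def] u1_def using DERIV_chain2[OF v_D aff] by simp
  have u1_D: "(u1 has_real_derivative deriv (deriv v) ((y - x0) / b) * (1 / b) / b) (at y)" for y
    unfolding u1_def[abs_def] by (intro DERIV_cdivide DERIV_chain2[OF v1_D aff])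
  have u_cont: "continuous_on UNIV u" "continuous_on UNIV u1"
    using u_D u1_D by (meson DERIV_isCont continuous_at_imp_continuous_on)+
  have "energy_unstable_dir H X h u"
  proof (rule energy_unstable_dirI[OF H u_D u_cont(2)])
    show "has_period X u"
      unfolding has_period_def
    proof
      fix y
      have "(y + X - x0) / b = (y - x0) / b + real N * P" using P(2) ab(2) by (simp add: field_simps)
      then show "u (y + X) = u y" unfolding u_def using has_period_mult_nat[OF v(2)] by simp
    qed
    show "(u has_integral 0) {0..X}"
      unfolding u_def[abs_def] using integral_rescale[OF v_cont(1) v(2) P(1) ab(2) P(2) v(3), of x0] by simp
    let ?Z = "\<lambda>x. (deriv v x)\<^sup>2 - k x powr (q - 1) * (v x)\<^sup>2"
    have "continuous_on UNIV ?Z"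
      using k_pos by (intro continuous_intros v_cont continuous_on_powr k_cont) (metis less_irrefl)
    moreover have "has_period P ?Z" using v(2) v1_per k_per by (simp add: has_period_def)
    ultimately have "((\<lambda>y. ?Z ((y - x0) / b)) has_integral (b * real N * J)) {0..X}"
      using integral_rescale[OF _ _ P(1) ab(2) P(2) J(1)] by blast
    from has_integral_mult_right[OF this, of "1 / b\<^sup>2"]
    have "((\<lambda>y. 1 / b\<^sup>2 * ?Z ((y - x0) / b)) has_integral 1 / b\<^sup>2 * (b * real N * J)) {0..X}" .
    moreover have "1 / b\<^sup>2 * ?Z ((y - x0) / b) = (u1 y)\<^sup>2 - B * h y powr (q - 1) * (u y)\<^sup>2" for y
    proof -
      have "k ((y - x0) / b) = a * h y" unfolding k using ab by simp
      then have "k ((y - x0) / b) powr (q - 1) = a powr (q - 1) * h y powr (q - 1)"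
        using ab(1) h_pos[of y] by (simp add: powr_mult)
      moreover have "a powr (q - 1) = B * b\<^sup>2"
      proof -
        have "a powr (q - 1) * a powr (1 - q) = 1" using ab(1) by (simp add: powr_add[symmetric])
        then have "a powr (q - 1) = a powr (q - 1) * (B * a powr (1 - q) * b\<^sup>2)" using ab(3) by simp
        also have "\<dots> = B * b\<^sup>2 * (a powr (q - 1) * a powr (1 - q))" by (simp add: mult_ac)
        also have "\<dots> = B * b\<^sup>2" using \<open>a powr (q - 1) * a powr (1 - q) = 1\<close> by simp
        finally show ?thesis .
      qed
      ultimately show ?thesis unfolding u_def u1_def using ab(2) by (simp add: power2_eq_square field_simps)
    qed
    ultimately show "((\<lambda>y. (u1 y)\<^sup>2 - B * h y powr (q - 1) * (u y)\<^sup>2) has_integral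
        1 / b\<^sup>2 * (b * real N * J)) {0..X}" by simp
    show "((\<lambda>x. B * (q - 1) * h x powr (q - 2) * (u x)^3) has_integral
        integral {0..X} (\<lambda>x. B * (q - 1) * h x powr (q - 2) * (u x)^3)) {0..X}"
      by (intro integrable continuous_intros cont_powr u_cont)
    show "((\<lambda>x. B * (q - 1) * (q - 2) * h x powr (q - 3) * (u x)^4) has_integral
        integral {0..X} (\<lambda>x. B * (q - 1) * (q - 2) * h x powr (q - 3) * (u x)^4)) {0..X}"
      by (intro integrable continuous_intros cont_powr u_cont)
    have "real N > 0" using P X_pos ab(2) by (metis mult_eq_0_iff of_nat_0_le_iff less_irrefl less_eq_real_def)
    then have "1 / b\<^sup>2 * (b * real N * J) < 0"
      using ab(2) J(2) by (intro mult_pos_neg mult_pos_pos) auto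
    then show "1 / b\<^sup>2 * (b * real N * J) < 0 \<or> 1 / b\<^sup>2 * (b * real N * J) = 0 \<and>
       integral {0..X} (\<lambda>x. B * (q - 1) * h x powr (q - 2) * (u x)^3) = 0 \<and>
       integral {0..X} (\<lambda>x. B * (q - 1) * (q - 2) * h x powr (q - 3) * (u x)^4) > 0" by blast
  qed
  moreover have "smooth u"
    using smooth_scaled_add[OF v(1) v(1), of 1 "1 / b" "- x0 / b" 0 0 0 0]
    unfolding u_def[abs_def] by (simp add: diff_divide_distrib)
  ultimately show ?thesis unfolding energy_unstable_def by blast
qed

end

section \<open>Phase plane coordinates for \<open>q > 1\<close>\<close>

text \<open>Splitting at \<open>c\<close> tolerates one point without derivative information; below
  this is 1, where \<open>lam\<close> is only known to be continuous.\<close>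

lemma DERIV_nonneg_except_imp_le:
  fixes f :: "real \<Rightarrow> real"
  assumes "x \<le> y" "continuous_on {x..y} f"
    and D: "\<And>t. x < t \<Longrightarrow> t < y \<Longrightarrow> t \<noteq> c \<Longrightarrow> \<exists>d. (f has_real_derivative d) (at t) \<and> d \<ge> 0"
  shows "f x \<le> f y"
proof -
  have *: "f a \<le> f b" if "x \<le> a" "a \<le> b" "b \<le> y" "\<not> (a < c \<and> c < b)" for a b
  proof (rule DERIV_nonneg_imp_increasing_open[OF that(2)])
    show "continuous_on {a..b} f" using that by (intro continuous_on_subset[OF assms(2)]) auto
    fix t assume "a < t" "t < b"
    then show "\<exists>d. (f has_real_derivative d) (at t) \<and> d \<ge> 0" using D[of t] that by fastforce
  qed
  show ?thesis using *[of x c] *[of c y] *[of x y] assms(1) by linarith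
qed

locale superlinear =
  fixes q :: real
  assumes q: "q > 1"
begin

definition p :: "real \<Rightarrow> real" where "p k = (k powr q - 1) / q"

text \<open>The primitive of \<open>p\<close> that vanishes at 1, so that k'^2 / 2 + G k is
  conserved along profiles.\<close>

definition G :: "real \<Rightarrow> real" where "G k = k powr (q + 1) / (q * (q + 1)) - k / q + 1 / (q + 1)"

text \<open>A signed square root of the doubled potential: the conserved energy becomes (k'^2 +
  r^2)/2, and orbits become circles in the plane of r and k'.\<close>

definition r :: "real \<Rightarrow> real" where "r k = sgn (k - 1) * sqrt (2 * G k)"

text \<open>The limit of \<open>r / p\<close> at 1 is filled in by hand; \<open>lam\<close> is the derivative of the
  inverse of \<open>r\<close>.\<close>

definition lam :: "real \<Rightarrow> real" where "lam k = (if k = 1 then 1 else r k / p k)"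

lemma p_eq_nonlin: "p = nonlin q"
  using q by (auto simp: p_def nonlin_def)

lemma p_D: "k > 0 \<Longrightarrow> (p has_real_derivative k powr (q - 1)) (at k)"
  unfolding p_eq_nonlin by (rule DERIV_nonlin)

lemma p_1 [simp]: "p 1 = 0" and G_1 [simp]: "G 1 = 0" and r_1 [simp]: "r 1 = 0" and lam_1 [simp]: "lam 1 = 1"
  using q by (auto simp: p_def G_def r_def lam_def field_simps)

lemma p_pos: "k > 1 \<Longrightarrow> p k > 0"
  using q powr_less_mono2[of q 1 k] by (simp add: p_def)

lemma p_neg: "0 < k \<Longrightarrow> k < 1 \<Longrightarrow> p k < 0"
  using q powr_less_mono2[of q k 1] by (simp add: p_def divide_neg_pos)

lemma p_eq_0: "k > 0 \<Longrightarrow> p k = 0 \<longleftrightarrow> k = 1"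
  using p_pos[of k] p_neg[of k] by (metis less_irrefl linorder_neqE_linordered_idom p_1)

lemma G_D: "k > 0 \<Longrightarrow> (G has_real_derivative p k) (at k)"
proof -
  assume k: "k > 0"
  have "((\<lambda>k. k powr (q + 1)) has_real_derivative (q + 1) * k powr q) (at k)"
    using has_real_derivative_powr[OF k, of "q + 1"] by simp
  from DERIV_add[OF DERIV_diff[OF DERIV_cdivide[OF this, of "q * (q + 1)"] DERIV_cdivide[OF DERIV_ident, of q]]
      DERIV_const[of "1 / (q + 1)"]]
  have "(G has_real_derivative (q + 1) * k powr q / (q * (q + 1)) - 1 / q + 0) (at k)"
    unfolding G_def[abs_def] .
  moreover have "(q + 1) * k powr q / (q * (q + 1)) - 1 / q + 0 = p k"
    using q by (simp add: p_def diff_divide_distrib)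
  ultimately show ?thesis by simp
qed

lemma G_pos:
  assumes "k > 0" "k \<noteq> 1"
  shows "G k > 0"
proof (cases "k > 1")
  case True
  have "G 1 < G k"
  proof (rule DERIV_pos_imp_increasing_open[OF True])
    show "continuous_on {1..k} G"
      by (rule DERIV_continuous_on, rule has_field_derivative_at_within, rule G_D) simp
    fix t :: real assume "1 < t"
    then show "\<exists>d. (G has_real_derivative d) (at t) \<and> d > 0"
      using p_pos[of t] G_D[of t] by auto
  qed
  then show ?thesis by simp
next
  case False
  then have "k < 1" using assms by simp
  then have "G 1 < G k"
  proof (intro DERIV_neg_imp_decreasing_open[of k 1 G])
    show "continuous_on {k..1} G"
      by (rule DERIV_continuous_on, rule has_field_derivative_at_within, rule G_D) (use assms in simp)
    fix t :: real assume "k < t" "t < 1"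
    then show "\<exists>d. (G has_real_derivative d) (at t) \<and> d < 0"
      using p_neg[of t] G_D[of t] assms by auto
  qed (use \<open>k < 1\<close> in simp)
  then show ?thesis by simp
qed

lemma r_sq: "k > 0 \<Longrightarrow> (r k)\<^sup>2 = 2 * G k"
  using G_pos[of k] by (cases "k = 1") (auto simp: r_def power_mult_distrib sgn_if)

lemma r_pos: "k > 1 \<Longrightarrow> r k > 0"
  using G_pos[of k] by (simp add: r_def)

lemma r_neg: "0 < k \<Longrightarrow> k < 1 \<Longrightarrow> r k < 0"
  using G_pos[of k] by (simp add: r_def)

lemma r_mult_p_pos: "k > 0 \<Longrightarrow> k \<noteq> 1 \<Longrightarrow> r k * p k > 0"
  using r_pos[of k] r_neg[of k] p_pos[of k] p_neg[of k]
  by (metis linorder_neqE_linordered_idom mult_neg_neg mult_pos_pos)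

lemma lam_pos: "k > 0 \<Longrightarrow> lam k > 0"
  using r_mult_p_pos[of k] by (auto simp: lam_def zero_less_mult_iff zero_less_divide_iff)

lemma p_lam: "k > 0 \<Longrightarrow> p k * lam k = r k"
  using p_eq_0[of k] by (auto simp: lam_def)

text \<open>The sign of this function controls the monotonicity of \<open>lam + c r\<close>.\<close>

definition Psi :: "real \<Rightarrow> real \<Rightarrow> real" where
  "Psi c k = 2 * G k - ((p k)^2 + c * (p k)^3) * k powr (1 - q)"

lemma Psi_1 [simp]: "Psi c 1 = 0" by (simp add: Psi_def)

text \<open>Because p' k^(1-q) = 1, the term 2 p from \<open>G\<close> cancels and everything left
  carries a factor p^2. At k = 1 the bracket equals q - 1 - 3 c, which singles out c =
  (q-1)/3.\<close>

lemma Psi_D: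
  assumes "k > 0"
  shows "(Psi c has_real_derivative (p k)\<^sup>2 * ((q - 1) * k powr (- q) * (1 + c * p k) - 3 * c)) (at k)"
proof -
  have 1: "k powr (q - 1) * k powr (1 - q) = 1" using assms by (simp add: powr_add[symmetric])
  have 2: "k powr (1 - q) / k = k powr (- q)" using assms powr_diff[of k "1 - q" 1] by simp
  have "((\<lambda>k. k powr (1 - q)) has_real_derivative (1 - q) * k powr (- q)) (at k)"
    using has_real_derivative_powr[OF assms, of "1 - q"] by simp
  from DERIV_diff[OF DERIV_cmult[OF G_D[OF assms], of 2]
      DERIV_mult[OF DERIV_add[OF DERIV_power[OF p_D[OF assms], of 2]
          DERIV_cmult[OF DERIV_power[OF p_D[OF assms], of 3], of c]] this]]
  have "(Psi c has_real_derivative 2 * p k - ((2 * (k powr (q - 1) * p k) + c * (3 * (k powr (q - 1) * (p k)^2))) * k powr (1 - q)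
      + (1 - q) * k powr (- q) * ((p k)^2 + c * (p k)^3))) (at k)"
    unfolding Psi_def[abs_def] by (simp add: eval_nat_numeral mult_ac)
  moreover have "2 * p k - ((2 * (k powr (q - 1) * p k) + c * (3 * (k powr (q - 1) * (p k)^2))) * k powr (1 - q)
      + (1 - q) * k powr (- q) * ((p k)^2 + c * (p k)^3))
     = 2 * p k - (k powr (q - 1) * k powr (1 - q)) * (2 * p k + c * 3 * (p k)^2)
      - (1 - q) * k powr (- q) * ((p k)^2 + c * (p k)^3)"
    by (simp add: algebra_simps)
  moreover have "\<dots> = (p k)\<^sup>2 * ((q - 1) * k powr (- q) * (1 + c * p k) - 3 * c)"
    unfolding 1 by (simp add: power2_eq_square power3_eq_cube algebra_simps)
  ultimately show ?thesis by simp
qed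

lemma powr_q: "k > 0 \<Longrightarrow> k powr q = 1 + q * p k"
  using q by (simp add: p_def)

text \<open>For this \<open>c\<close>, writing 3 c = (q-1) k^(-q) k^q with k^q = 1 + q p turns the
  bracket into a positive multiple of (c - q) p. The derivative thus has the sign of - p, and
  \<open>Psi\<close> has its maximum 0 at 1.\<close>

lemma Psi_third_nonpos:
  assumes "k > 0"
  shows "Psi ((q - 1) / 3) k \<le> 0"
proof -
  let ?c = "(q - 1) / 3"
  let ?d = "\<lambda>k. (p k)\<^sup>2 * ((q - 1) * k powr (- q) * (1 + ?c * p k) - 3 * ?c)"
  have d: "?d t = (p t)\<^sup>2 * (q - 1) * t powr (- q) * (?c - q) * p t" if "t > 0" for t
  proof -
    have c3: "3 * ?c = q - 1" by simp
    have "t powr (- q) * t powr q = 1" using that by (simp add: powr_add[symmetric])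
    then have "(q - 1) * t powr (- q) * (1 + ?c * p t) - 3 * ?c
        = (q - 1) * t powr (- q) * (1 + ?c * p t) - (q - 1) * (t powr (- q) * t powr q)"
      unfolding c3 by simp
    also have "\<dots> = (q - 1) * t powr (- q) * ((?c - q) * p t)"
      unfolding powr_q[OF that] by (simp add: algebra_simps)
    finally show ?thesis by simp
  qed
  have cq: "?c - q < 0" using q by simp
  show ?thesis
  proof (cases "k \<ge> 1")
    case True
    have "Psi ?c k \<le> Psi ?c 1"
    proof (rule DERIV_nonpos_imp_nonincreasing[OF True, where f = "Psi ?c"])
      fix t :: real assume "1 \<le> t"
      then have "t > 0" "p t \<ge> 0" using p_pos[of t] by (cases "t = 1"; simp)+
      then have "?d t \<le> 0" unfolding d[OF \<open>t > 0\<close>] using q cq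
        by (intro mult_nonpos_nonneg mult_nonneg_nonpos mult_nonneg_nonneg) auto
      then show "\<exists>y. (Psi ?c has_real_derivative y) (at t) \<and> y \<le> 0" using Psi_D[OF \<open>t > 0\<close>] by blast
    qed
    then show ?thesis by simp
  next
    case False
    have "Psi ?c k \<le> Psi ?c 1"
    proof (rule DERIV_nonneg_imp_nondecreasing[where f = "Psi ?c"])
      fix t assume "k \<le> t" "t \<le> 1"
      then have "t > 0" "p t \<le> 0" using assms p_neg[of t] by (cases "t = 1"; simp)+
      then have "?d t \<ge> 0" unfolding d[OF \<open>t > 0\<close>] using q cq
        by (intro mult_nonpos_nonpos mult_nonneg_nonpos mult_nonneg_nonneg) auto
      then show "\<exists>y. (Psi ?c has_real_derivative y) (at t) \<and> y \<ge> 0" using Psi_D[OF \<open>t > 0\<close>] by blast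
    qed (use False in simp)
    then show ?thesis by simp
  qed
qed

lemma Psi_0_D: "k > 0 \<Longrightarrow> (Psi 0 has_real_derivative (p k)\<^sup>2 * ((q - 1) * k powr (- q))) (at k)"
  using Psi_D[of k 0] by simp

lemma Psi_0_nonneg:
  assumes "k \<ge> 1"
  shows "Psi 0 k \<ge> 0"
proof -
  have "Psi 0 1 \<le> Psi 0 k"
  proof (rule DERIV_nonneg_imp_nondecreasing[OF assms])
    fix t :: real assume "1 \<le> t"
    then show "\<exists>y. (Psi 0 has_real_derivative y) (at t) \<and> y \<ge> 0"
      using q Psi_0_D[of t] by (intro exI[of _ "(p t)\<^sup>2 * ((q - 1) * t powr (- q))"]) auto
  qed
  then show ?thesis by simp
qed

lemma Psi_0_nonpos:
  assumes "0 < k" "k \<le> 1"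
  shows "Psi 0 k \<le> 0"
proof -
  have "Psi 0 k \<le> Psi 0 1"
  proof (rule DERIV_nonneg_imp_nondecreasing[OF assms(2)])
    fix t :: real assume "k \<le> t"
    then show "\<exists>y. (Psi 0 has_real_derivative y) (at t) \<and> y \<ge> 0"
      using q assms Psi_0_D[of t] by (intro exI[of _ "(p t)\<^sup>2 * ((q - 1) * t powr (- q))"]) auto
  qed
  then show ?thesis by simp
qed

text \<open>The least \<open>c\<close> for which 3 c dominates (q-1) t^(-q) on all of [\<kappa>, 1];
  it becomes the Lipschitz constant of \<open>lam\<close> in the coordinate
  \<open>r\<close>.\<close>

definition lip_const :: "real \<Rightarrow> real" where "lip_const \<kappa> = (q - 1) * \<kappa> powr (- q) / 3"

lemma lip_const_pos: "\<kappa> > 0 \<Longrightarrow> lip_const \<kappa> > 0"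
  using q by (simp add: lip_const_def)

lemma Psi_lip_nonneg:
  assumes "0 < \<kappa>" "\<kappa> \<le> k" "k \<le> 1"
  shows "Psi (lip_const \<kappa>) k \<ge> 0"
proof -
  let ?c = "lip_const \<kappa>"
  have "Psi ?c 1 \<le> Psi ?c k"
  proof (rule DERIV_nonpos_imp_nonincreasing[OF assms(3)])
    fix t assume t: "k \<le> t" "t \<le> 1"
    then have "t > 0" "p t \<le> 0" using assms p_neg[of t] by (cases "t = 1"; simp)+
    then have "1 + ?c * p t \<le> 1" using lip_const_pos[OF assms(1)] by (simp add: mult_nonneg_nonpos)
    then have "(q - 1) * t powr (- q) * (1 + ?c * p t) \<le> (q - 1) * t powr (- q) * 1"
      using q by (intro mult_left_mono) auto
    also have "\<dots> \<le> (q - 1) * \<kappa> powr (- q) * 1"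
      using q assms t by (intro mult_right_mono mult_left_mono powr_mono2') auto
    finally have "(p t)\<^sup>2 * ((q - 1) * t powr (- q) * (1 + ?c * p t) - 3 * ?c) \<le> 0"
      by (intro mult_nonneg_nonpos) (auto simp: lip_const_def)
    then show "\<exists>y. (Psi ?c has_real_derivative y) (at t) \<and> y \<le> 0" using Psi_D[OF \<open>t > 0\<close>] by blast
  qed
  then show ?thesis by simp
qed

text \<open>Above 1 \<open>Psi\<close> decreases in \<open>c\<close> because p \<ge> 0, and
  \<open>lip_const\<close> is at least (q-1)/3, so the previous sign result carries over.\<close>

lemma Psi_lip_nonpos:
  assumes "0 < \<kappa>" "\<kappa> \<le> 1" "k \<ge> 1"
  shows "Psi (lip_const \<kappa>) k \<le> 0"
proof -
  have "1 \<le> \<kappa> powr (- q)" using assms q powr_mono2'[of "- q" \<kappa> 1] by simp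
  then have "(q - 1) * 1 / 3 \<le> lip_const \<kappa>"
    unfolding lip_const_def using q by (intro divide_right_mono mult_left_mono) auto
  moreover have "p k \<ge> 0" using assms p_pos[of k] by (cases "k = 1") auto
  ultimately have "(q - 1) / 3 * (p k)^3 \<le> lip_const \<kappa> * (p k)^3" by (intro mult_right_mono) auto
  then have "((p k)^2 + (q - 1) / 3 * (p k)^3) * k powr (1 - q) \<le> ((p k)^2 + lip_const \<kappa> * (p k)^3) * k powr (1 - q)"
    by (intro mult_right_mono) auto
  then show ?thesis using Psi_third_nonpos[of k] assms unfolding Psi_def by linarith
qed

section \<open>\<open>r\<close> and \<open>lam\<close>: derivatives away from 1 and the behaviour at
  1\<close>

lemma r_D_ne_1:
  assumes "k > 0" "k \<noteq> 1"
  shows "(r has_real_derivative p k / r k) (at k)"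
proof -
  have G: "((\<lambda>k. sqrt (2 * G k)) has_real_derivative p k / sqrt (2 * G k)) (at k)"
    using assms G_pos[of k] by (auto intro!: derivative_eq_intros G_D simp: divide_simps)
  show ?thesis
  proof (cases "k > 1")
    case True
    have "(r has_real_derivative p k / sqrt (2 * G k)) (at k)"
      by (rule has_field_derivative_transform_within_open[OF G, of "{1<..}"]) (use True in \<open>auto simp: r_def\<close>)
    then show ?thesis using True by (simp add: r_def)
  next
    case False
    then have "k < 1" using assms by simp
    have "(r has_real_derivative - (p k / sqrt (2 * G k))) (at k)"
      by (rule has_field_derivative_transform_within_open[OF DERIV_minus[OF G], of "{..<1}"])
         (use \<open>k < 1\<close> in \<open>auto simp: r_def\<close>)
    then show ?thesis using \<open>k < 1\<close> by (simp add: r_def)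
  qed
qed

lemma lam_D_ne_1:
  assumes "k > 0" "k \<noteq> 1"
  shows "(lam has_real_derivative - Psi 0 k * k powr (q - 1) / (r k * (p k)\<^sup>2)) (at k)"
proof -
  have nz: "p k \<noteq> 0" "r k \<noteq> 0" using r_mult_p_pos[OF assms] by auto
  have "((\<lambda>k. r k / p k) has_real_derivative (p k / r k * p k - r k * k powr (q - 1)) / (p k * p k)) (at k)"
    by (intro DERIV_divide r_D_ne_1 p_D assms nz)
  moreover have "(p k / r k * p k - r k * k powr (q - 1)) / (p k * p k)
     = ((p k)\<^sup>2 - (r k)\<^sup>2 * k powr (q - 1)) / (r k * (p k)\<^sup>2)"
    using nz by (simp add: field_simps power2_eq_square)
  moreover have "(p k)\<^sup>2 - (r k)\<^sup>2 * k powr (q - 1) = - Psi 0 k * k powr (q - 1)"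
  proof -
    have "k powr (1 - q) * k powr (q - 1) = 1" using assms by (simp add: powr_add[symmetric])
    then have "Psi 0 k * k powr (q - 1) = 2 * G k * k powr (q - 1) - (p k)\<^sup>2"
      unfolding Psi_def by (simp add: left_diff_distrib mult.assoc)
    then show ?thesis unfolding r_sq[OF assms(1)] by simp
  qed
  ultimately have "((\<lambda>k. r k / p k) has_real_derivative - Psi 0 k * k powr (q - 1) / (r k * (p k)\<^sup>2)) (at k)"
    by simp
  then show ?thesis
    by (rule has_field_derivative_transform_within_open[of _ _ _ "- {1}"]) (use assms in \<open>auto simp: lam_def\<close>)
qed

text \<open>The sign of \<open>Psi c\<close> says on which side of 1 + c p the quantity lam^2
  k^(q-1) lies; c = 0 and c = \<open>lip_const (1/2)\<close> enclose it. This yields the limit of r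
  / p at 1.\<close>

lemma lam_sq_bounds:
  assumes "1/2 \<le> k" "k \<noteq> 1"
  shows "\<bar>(lam k)\<^sup>2 * k powr (q - 1) - 1\<bar> \<le> lip_const (1/2) * \<bar>p k\<bar>"
proof -
  have k: "k > 0" using assms by simp
  let ?c = "lip_const (1/2)"
  have kk: "k powr (1 - q) * k powr (q - 1) = 1" using k by (simp add: powr_add[symmetric])
  have pk: "(p k)\<^sup>2 > 0" using p_eq_0[OF k] assms(2) by simp
  have l2: "(lam k)\<^sup>2 * (p k)\<^sup>2 = 2 * G k"
    using p_lam[OF k] r_sq[OF k] by (metis mult.commute power_mult_distrib)
  have eq: "Psi c k * k powr (q - 1) = (p k)\<^sup>2 * ((lam k)\<^sup>2 * k powr (q - 1) - (1 + c * p k))" for c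
  proof -
    have "Psi c k * k powr (q - 1) = 2 * G k * k powr (q - 1) - ((p k)^2 + c * (p k)^3) * (k powr (1 - q) * k powr (q - 1))"
      unfolding Psi_def by (simp add: left_diff_distrib mult.assoc)
    then show ?thesis unfolding kk l2[symmetric]
      by (simp add: power2_eq_square power3_eq_cube algebra_simps)
  qed
  have le: "(lam k)\<^sup>2 * k powr (q - 1) - (1 + c * p k) \<le> 0" if "Psi c k \<le> 0" for c
  proof -
    have "Psi c k * k powr (q - 1) \<le> 0" using that by (simp add: mult_nonpos_nonneg)
    then show ?thesis unfolding eq using pk by (simp add: mult_le_0_iff)
  qed
  have ge: "(lam k)\<^sup>2 * k powr (q - 1) - (1 + c * p k) \<ge> 0" if "Psi c k \<ge> 0" for c
  proof -
    have "Psi c k * k powr (q - 1) \<ge> 0" using that by simp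
    then show ?thesis unfolding eq using pk by (simp add: zero_le_mult_iff)
  qed
  show ?thesis
  proof (cases "k > 1")
    case True
    then show ?thesis using le[OF Psi_lip_nonpos[of "1/2" k]] ge[OF Psi_0_nonneg[of k]] p_pos[of k] by simp
  next
    case False
    then have "k < 1" using assms by simp
    then show ?thesis
      using ge[OF Psi_lip_nonneg[of "1/2" k]] le[OF Psi_0_nonpos[of k]] p_neg[of k] assms by simp
  qed
qed

lemma lam_tendsto_1: "(lam \<longlongrightarrow> 1) (at 1)"
proof -
  have ev: "\<forall>\<^sub>F k in at (1::real). 1/2 \<le> k \<and> k \<noteq> 1"
    unfolding eventually_at by (intro exI[of _ "1/2"]) (auto simp: dist_real_def abs_if split: if_splits)
  have "(p \<longlongrightarrow> p 1) (at 1)" using DERIV_isCont[OF p_D[of 1]] by (simp add: isCont_def)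
  then have "((\<lambda>k. lip_const (1/2) * \<bar>p k\<bar>) \<longlongrightarrow> lip_const (1/2) * \<bar>p 1\<bar>) (at 1)"
    by (intro tendsto_intros)
  then have 0: "((\<lambda>k. lip_const (1/2) * \<bar>p k\<bar>) \<longlongrightarrow> 0) (at 1)" by simp
  have "((\<lambda>k. (lam k)\<^sup>2 * k powr (q - 1) - 1) \<longlongrightarrow> 0) (at 1)"
    by (rule Lim_null_comparison[OF _ 0]) (use ev lam_sq_bounds in \<open>auto elim: eventually_mono\<close>)
  moreover have "((\<lambda>k::real. k powr (1 - q)) \<longlongrightarrow> 1 powr (1 - q)) (at 1)"
    by (intro tendsto_intros) auto
  ultimately have "((\<lambda>k. sqrt (((lam k)\<^sup>2 * k powr (q - 1) - 1 + 1) * k powr (1 - q))) \<longlongrightarrow> sqrt ((0 + 1) * 1 powr (1 - q))) (at 1)"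
    by (intro tendsto_intros) auto
  then have "((\<lambda>k. sqrt (((lam k)\<^sup>2 * k powr (q - 1) - 1 + 1) * k powr (1 - q))) \<longlongrightarrow> 1) (at 1)" by simp
  then show ?thesis
  proof (rule Lim_transform_eventually)
    show "\<forall>\<^sub>F k in at 1. sqrt (((lam k)\<^sup>2 * k powr (q - 1) - 1 + 1) * k powr (1 - q)) = lam k"
      using ev
    proof eventually_elim
      case (elim k)
      then have "k powr (q - 1) * k powr (1 - q) = 1" "k > 0" by (auto simp: powr_add[symmetric])
      then have e: "((lam k)\<^sup>2 * k powr (q - 1) - 1 + 1) * k powr (1 - q) = (lam k)\<^sup>2" by (simp add: mult.assoc)
      show ?case unfolding e using lam_pos[OF \<open>k > 0\<close>] by simp
    qed
  qed
qed

lemma lam_isCont: "k > 0 \<Longrightarrow> isCont lam k"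
  using lam_tendsto_1 lam_D_ne_1[of k] DERIV_isCont by (cases "k = 1") (auto simp: isCont_def)

lemma r_D:
  assumes "k > 0"
  shows "(r has_real_derivative 1 / lam k) (at k)"
proof (cases "k = 1")
  case False
  then have "p k / r k = 1 / lam k" by (simp add: lam_def)
  then show ?thesis using r_D_ne_1[OF assms False] by simp
next
  case True
  have "((\<lambda>k. (p k - p 1) / (k - 1)) \<longlongrightarrow> 1) (at 1)"
    using p_D[of 1] by (simp add: has_field_derivative_iff)
  from tendsto_mult[OF lam_tendsto_1 this]
  have "((\<lambda>k. lam k * ((p k - p 1) / (k - 1))) \<longlongrightarrow> 1) (at 1)" by simp
  then have "((\<lambda>k. (r k - r 1) / (k - 1)) \<longlongrightarrow> 1) (at 1)"
  proof (rule Lim_transform_eventually)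
    have "\<forall>\<^sub>F k in at (1::real). k > 0"
      unfolding eventually_at by (intro exI[of _ "1/2"]) (auto simp: dist_real_def abs_if split: if_splits)
    then show "\<forall>\<^sub>F k in at 1. lam k * ((p k - p 1) / (k - 1)) = (r k - r 1) / (k - 1)"
      by eventually_elim (simp add: p_lam[symmetric])
  qed
  then show ?thesis using True by (simp add: has_field_derivative_iff)
qed

lemma r_strict_mono: "0 < x \<Longrightarrow> x < y \<Longrightarrow> r x < r y"
proof (rule DERIV_pos_imp_increasing[of x y r])
  fix t assume "0 < x" "x \<le> t"
  then have "t > 0" by simp
  then show "\<exists>d. (r has_real_derivative d) (at t) \<and> d > 0"
    using r_D lam_pos by (intro exI[of _ "1 / lam t"]) auto
qed

lemma r_mono: "0 < x \<Longrightarrow> x \<le> y \<Longrightarrow> r x \<le> r y"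
  using r_strict_mono[of x y] by (cases "x = y") auto

lemma continuous_on_pos:
  assumes "0 < x"
  shows "continuous_on {x..y} lam" "continuous_on {x..y} r"
  using assms lam_isCont DERIV_isCont[OF r_D] by (auto intro!: continuous_at_imp_continuous_on)

text \<open>As \<open>r\<close> has the sign of k - 1, \<open>lam + c r\<close> grows above 1 where
  \<open>Psi c\<close> is nonpositive and below 1 where it is nonnegative.\<close>

lemma lam_r_D_ne_1:
  assumes "k > 0" "k \<noteq> 1"
  shows "((\<lambda>k. lam k + c * r k) has_real_derivative - Psi c k * k powr (q - 1) / (r k * (p k)\<^sup>2)) (at k)"
proof -
  have nz: "p k \<noteq> 0" "r k \<noteq> 0" using r_mult_p_pos[OF assms] by auto
  have "((\<lambda>k. lam k + c * r k) has_real_derivative - Psi 0 k * k powr (q - 1) / (r k * (p k)\<^sup>2) + c * (p k / r k)) (at k)"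
    by (intro DERIV_add DERIV_cmult lam_D_ne_1 r_D_ne_1 assms)
  moreover have "c * (p k / r k) = c * (p k)^3 / (r k * (p k)\<^sup>2)"
    using nz by (simp add: power2_eq_square power3_eq_cube)
  moreover have "- Psi c k * k powr (q - 1) = - Psi 0 k * k powr (q - 1) + c * (p k)^3"
  proof -
    have "k powr (1 - q) * k powr (q - 1) = 1" using assms by (simp add: powr_add[symmetric])
    moreover have "Psi c k * k powr (q - 1) = Psi 0 k * k powr (q - 1) - c * (p k)^3 * (k powr (1 - q) * k powr (q - 1))"
      unfolding Psi_def by (simp add: algebra_simps)
    ultimately show ?thesis by simp
  qed
  ultimately show ?thesis by (simp only: add_divide_distrib)
qed

section \<open>Monotonicity and Lipschitz bounds for \<open>lam\<close>\<close>

lemma lam_antimono: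
  assumes "0 < x" "x \<le> y"
  shows "lam y \<le> lam x"
proof -
  have "- lam x \<le> - lam y"
  proof (rule DERIV_nonneg_except_imp_le[where f = "\<lambda>k. - lam k" and c = 1, OF assms(2)])
    show "continuous_on {x..y} (\<lambda>k. - lam k)" by (intro continuous_intros continuous_on_pos assms)
    fix t assume t: "x < t" "t < y" "t \<noteq> 1"
    then have "t > 0" using assms by simp
    have "Psi 0 t * t powr (q - 1) / (r t * (p t)\<^sup>2) \<ge> 0"
    proof (cases "t > 1")
      case True
      then show ?thesis using Psi_0_nonneg[of t] r_pos[of t] by simp
    next
      case False
      then show ?thesis using Psi_0_nonpos[of t] r_neg[of t] t \<open>t > 0\<close>
        by (intro divide_nonpos_nonpos mult_nonpos_nonneg) auto
    qed
    then show "\<exists>d. ((\<lambda>k. - lam k) has_real_derivative d) (at t) \<and> d \<ge> 0"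
      using DERIV_minus[OF lam_D_ne_1[OF \<open>t > 0\<close> t(3)]] by auto
  qed
  then show ?thesis by simp
qed

text \<open>A one-sided bound in the coordinate \<open>r\<close>, read off from the growth of
  \<open>lam + c r\<close>; \<open>lam_antimono\<close> supplies the other side.\<close>

lemma lam_lipschitz:
  assumes "0 < \<kappa>" "\<kappa> \<le> 1" "\<kappa> \<le> x" "x \<le> y"
  shows "lam x - lam y \<le> lip_const \<kappa> * (r y - r x)"
proof -
  let ?c = "lip_const \<kappa>"
  have "lam x + ?c * r x \<le> lam y + ?c * r y"
  proof (rule DERIV_nonneg_except_imp_le[where f = "\<lambda>k. lam k + ?c * r k" and c = 1, OF assms(4)])
    show "continuous_on {x..y} (\<lambda>k. lam k + ?c * r k)" using assms by (intro continuous_intros continuous_on_pos) auto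
    fix t assume t: "x < t" "t < y" "t \<noteq> 1"
    then have "t > 0" using assms by simp
    have "- Psi ?c t * t powr (q - 1) / (r t * (p t)\<^sup>2) \<ge> 0"
    proof (cases "t > 1")
      case True
      then show ?thesis using Psi_lip_nonpos[of \<kappa> t] r_pos[of t] assms
        by (intro divide_nonneg_nonneg mult_nonneg_nonneg) auto
    next
      case False
      then show ?thesis using Psi_lip_nonneg[of \<kappa> t] r_neg[of t] t \<open>t > 0\<close> assms
        by (intro divide_nonpos_nonpos mult_nonpos_nonneg) auto
    qed
    then show "\<exists>d. ((\<lambda>k. lam k + ?c * r k) has_real_derivative d) (at t) \<and> d \<ge> 0"
      using lam_r_D_ne_1[OF \<open>t > 0\<close> t(3)] by blast
  qed
  then show ?thesis by (simp add: algebra_simps)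
qed

lemma lam_r_mono:
  assumes "1 \<le> x" "x \<le> y"
  shows "lam x + (q - 1) / 3 * r x \<le> lam y + (q - 1) / 3 * r y"
proof (rule DERIV_nonneg_except_imp_le[where f = "\<lambda>k. lam k + (q - 1) / 3 * r k" and c = 1, OF assms(2)])
  show "continuous_on {x..y} (\<lambda>k. lam k + (q - 1) / 3 * r k)" using assms by (intro continuous_intros continuous_on_pos) auto
  fix t assume t: "x < t" "t < y" "t \<noteq> 1"
  then have "t > 0" using assms by simp
  then have "- Psi ((q - 1) / 3) t * t powr (q - 1) / (r t * (p t)\<^sup>2) \<ge> 0"
    using Psi_third_nonpos[of t] r_pos[of t] assms t by (intro divide_nonneg_nonneg mult_nonneg_nonneg) auto
  then show "\<exists>d. ((\<lambda>k. lam k + (q - 1) / 3 * r k) has_real_derivative d) (at t) \<and> d \<ge> 0"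
    using lam_r_D_ne_1[OF \<open>t > 0\<close> t(3)] by blast
qed

lemma lam_r_antimono:
  assumes "0 < x" "x \<le> y" "y \<le> 1"
  shows "lam y + (q - 1) / 3 * r y \<le> lam x + (q - 1) / 3 * r x"
proof -
  have "- (lam x + (q - 1) / 3 * r x) \<le> - (lam y + (q - 1) / 3 * r y)"
  proof (rule DERIV_nonneg_except_imp_le[where f = "\<lambda>k. - (lam k + (q - 1) / 3 * r k)" and c = 1, OF assms(2)])
    show "continuous_on {x..y} (\<lambda>k. - (lam k + (q - 1) / 3 * r k))" using assms by (intro continuous_intros continuous_on_pos) auto
    fix t assume t: "x < t" "t < y" "t \<noteq> 1"
    then have "t > 0" using assms by simp
    then have "- (- Psi ((q - 1) / 3) t * t powr (q - 1) / (r t * (p t)\<^sup>2)) \<ge> 0"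
      using Psi_third_nonpos[of t] r_neg[of t] assms t
      by (simp add: divide_nonpos_nonpos mult_nonpos_nonneg mult_nonneg_nonpos)
    then show "\<exists>d. ((\<lambda>k. - (lam k + (q - 1) / 3 * r k)) has_real_derivative d) (at t) \<and> d \<ge> 0"
      using DERIV_minus[OF lam_r_D_ne_1[OF \<open>t > 0\<close> t(3), of "(q - 1) / 3"]] by blast
  qed
  then show ?thesis by simp
qed

end

section \<open>Profiles and their periods\<close>

context superlinear
begin

text \<open>Inverse of \<open>r\<close> on the positive half line, leading from the polar coordinate
  back to \<open>k\<close>; its values are meaningful on the range of \<open>r\<close> only.\<close>

definition phi :: "real \<Rightarrow> real" where "phi = inv_into {0<..} r"

lemma inj_on_r: "inj_on r {0<..}"
  by (intro linorder_inj_onI) (auto dest: r_strict_mono)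

lemma phi_r: "k > 0 \<Longrightarrow> phi (r k) = k"
  unfolding phi_def by (rule inv_into_f_f[OF inj_on_r]) simp

lemma r_range:
  assumes "0 < x" "x \<le> y" "r x \<le> s" "s \<le> r y"
  shows "x \<le> phi s \<and> phi s \<le> y \<and> r (phi s) = s"
proof -
  obtain k where "x \<le> k" "k \<le> y" "r k = s"
    using IVT'[of r x s y] continuous_on_pos(2)[of x y] assms by auto
  then show ?thesis using phi_r[of k] assms(1) by auto
qed

lemma phi_D:
  assumes "k > 0"
  shows "(phi has_real_derivative lam k) (at (r k))"
proof -
  have z_pos: "z > 0" if "\<bar>z - k\<bar> \<le> k / 2" for z using that assms by arith
  have "isCont phi (r k)"
  proof (rule isCont_inverse_function[where d = "k / 2" and x = k and f = r and g = phi])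
    show "phi (r z) = z" if "\<bar>z - k\<bar> \<le> k / 2" for z
      using z_pos[OF that] by (rule phi_r)
    show "isCont r z" if "\<bar>z - k\<bar> \<le> k / 2" for z
      by (rule DERIV_isCont[OF r_D[OF z_pos[OF that]]])
  qed (use assms in simp)
  moreover have "r (k / 2) < r k" "r k < r (2 * k)"
    using assms by (auto intro!: r_strict_mono)
  moreover have "r (phi y) = y" if "r (k / 2) < y" "y < r (2 * k)" for y
    using r_range[of "k / 2" "2 * k" y] that assms by simp
  moreover have "(r has_real_derivative 1 / lam k) (at (phi (r k)))"
    using r_D[OF assms] phi_r[OF assms] by simp
  ultimately have "(phi has_real_derivative inverse (1 / lam k)) (at (r k))"
    using lam_pos[OF assms]
    by (intro DERIV_inverse_function[where f = r and a = "r (k / 2)" and b = "r (2 * k)"]) auto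
  then show ?thesis by simp
qed

text \<open>The value of \<open>k > 1\<close> at which \<open>G k = G 0\<close>: an upper bound for every profile.\<close>

definition top_val :: real where "top_val = (q + 1) powr (1 / q)"

lemma top_val_gt_1: "top_val > 1"
  using q powr_less_mono2[of "1 / q" 1 "q + 1"] by (simp add: top_val_def)

text \<open>\<open>G top_val\<close> equals 1/(q+1), the limit of \<open>G\<close> at 0, and this
  exceeds \<open>G \<beta>\<close>. So the whole circle of radius \<open>- r \<beta>\<close>
  projects into the range of \<open>r\<close>.\<close>

lemma r_top_val:
  assumes "0 < \<beta>" "\<beta> < 1"
  shows "- r \<beta> < r top_val"
proof -
  have "top_val powr q = q + 1" using q by (simp add: top_val_def powr_powr)
  moreover have "top_val powr (q + 1) = top_val powr q * top_val"
    using top_val_gt_1 by (subst powr_add) auto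
  ultimately have top: "top_val powr (q + 1) = (q + 1) * top_val" by simp
  have Gt: "G top_val = 1 / (q + 1)" using q unfolding G_def top by (simp add: divide_simps)
  have "\<beta> powr q < 1" using assms q powr_less_mono2[of q \<beta> 1] by simp
  then have "\<beta> * \<beta> powr q < \<beta> * (q + 1)" using assms q by (intro mult_strict_left_mono) auto
  then have "\<beta> powr (q + 1) / (q * (q + 1)) < \<beta> * (q + 1) / (q * (q + 1))"
    using assms q powr_add[of \<beta> q 1] by (intro divide_strict_right_mono) (auto simp: mult.commute)
  then have "G \<beta> < 1 / (q + 1)" using q by (simp add: G_def)
  then have "(- r \<beta>)\<^sup>2 < (r top_val)\<^sup>2"
    using r_sq[of \<beta>] r_sq[of top_val] assms top_val_gt_1 Gt by simp
  from power2_less_imp_less[OF this] show ?thesis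
    using r_pos[OF top_val_gt_1] by simp
qed

lemma phi_range:
  assumes "0 < \<beta>" "\<beta> < 1" "\<bar>s\<bar> \<le> - r \<beta>"
  shows "\<beta> \<le> phi s" "phi s \<le> top_val" "r (phi s) = s" "phi s > 0"
    "(phi has_real_derivative lam (phi s)) (at s)"
    "lam top_val \<le> lam (phi s)" "lam (phi s) \<le> lam \<beta>"
proof -
  have "\<beta> \<le> top_val" using assms top_val_gt_1 by simp
  then have *: "\<beta> \<le> phi s \<and> phi s \<le> top_val \<and> r (phi s) = s"
    using r_range[of \<beta> top_val s] r_top_val[OF assms(1,2)] assms by auto
  then show "\<beta> \<le> phi s" "phi s \<le> top_val" "r (phi s) = s" by auto
  then show "phi s > 0" using assms(1) by linarith
  then show "(phi has_real_derivative lam (phi s)) (at s)" using phi_D[of "phi s"] * by simp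
  show "lam top_val \<le> lam (phi s)" "lam (phi s) \<le> lam \<beta>"
    using lam_antimono * \<open>phi s > 0\<close> assms(1) by auto
qed

lemma phi_mono:
  assumes "0 < \<beta>" "\<beta> < 1" "\<bar>s\<bar> \<le> - r \<beta>" "\<bar>t\<bar> \<le> - r \<beta>" "s \<le> t"
  shows "phi s \<le> phi t"
  using r_strict_mono[of "phi t" "phi s"] phi_range(3,4)[OF assms(1,2,3)] phi_range(3,4)[OF assms(1,2,4)] assms(5)
  by linarith

lemma lam_phi_lipschitz:
  assumes "0 < \<beta>" "\<beta> < 1" "\<bar>s\<bar> \<le> - r \<beta>" "\<bar>t\<bar> \<le> - r \<beta>"
  shows "\<bar>lam (phi s) - lam (phi t)\<bar> \<le> lip_const \<beta> * \<bar>s - t\<bar>"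
proof -
  have *: "\<bar>lam (phi s) - lam (phi t)\<bar> \<le> lip_const \<beta> * \<bar>s - t\<bar>"
    if "s \<le> t" "\<bar>s\<bar> \<le> - r \<beta>" "\<bar>t\<bar> \<le> - r \<beta>" for s t
  proof -
    note s = phi_range[OF assms(1,2) that(2)] and t = phi_range[OF assms(1,2) that(3)]
    have "phi s \<le> phi t" by (rule phi_mono[OF assms(1,2) that(2,3,1)])
    then show ?thesis
      using lam_lipschitz[of \<beta> "phi s" "phi t"] lam_antimono[of "phi s" "phi t"] s(1,3,4) t(3) assms(1,2) that(1)
      by simp
  qed
  show ?thesis
    using *[of s t] *[of t s] assms by (cases "s \<le> t") (auto simp: abs_minus_commute)
qed

lemma phi_lipschitz:
  assumes "0 < \<beta>" "\<beta> < 1" "\<bar>s\<bar> \<le> - r \<beta>" "\<bar>t\<bar> \<le> - r \<beta>"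
  shows "\<bar>phi s - phi t\<bar> \<le> lam \<beta> * \<bar>s - t\<bar>"
proof -
  have "norm (phi s - phi t) \<le> lam \<beta> * norm (s - t)"
  proof (rule field_differentiable_bound[where S = "{r \<beta>..- r \<beta>}"])
    fix z assume "z \<in> {r \<beta>..- r \<beta>}"
    then have z: "\<bar>z\<bar> \<le> - r \<beta>" by auto
    note z = phi_range[OF assms(1,2) z]
    show "(phi has_field_derivative lam (phi z)) (at z within {r \<beta>..- r \<beta>})"
      using z(5) by (rule has_field_derivative_at_within)
    show "norm (lam (phi z)) \<le> lam \<beta>" using z(7) lam_pos[OF z(4)] by simp
  qed (use assms in auto)
  then show ?thesis by simp
qed

text \<open>Polar coordinates in the phase plane: \<open>r k = r \<beta> cos \<theta>\<close> and \<open>k' = - r \<beta> sin \<theta>\<close>, so that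
  \<open>dt/d\<theta> = lam k\<close>.\<close>

lemma profile:
  assumes \<beta>: "0 < \<beta>" "\<beta> < 1"
  obtains \<tau> \<theta> where "\<tau> 0 = 0" "\<And>s. (\<tau> has_real_derivative lam (phi (r \<beta> * cos s))) (at s)"
    "\<And>t. \<tau> (\<theta> t) = t" "\<And>s. \<theta> (\<tau> s) = s"
    "k_prof q \<beta> = (\<lambda>t. phi (r \<beta> * cos (\<theta> t)))" "P_per q \<beta> = \<tau> (2 * pi)"
    "P_per q \<beta> > 0" "has_period (P_per q \<beta>) (k_prof q \<beta>)" "smooth (k_prof q \<beta>)"
    "\<And>t. (deriv (k_prof q \<beta>) has_real_derivative - p (k_prof q \<beta> t)) (at t)"
    "\<And>p'. p' > 0 \<Longrightarrow> has_period p' (k_prof q \<beta>) \<Longrightarrow> P_per q \<beta> \<le> p'"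
proof -
  have rb: "r \<beta> < 0" using r_neg[OF \<beta>] .
  have arg: "\<bar>r \<beta> * cos s\<bar> \<le> - r \<beta>" for s
  proof -
    have "- r \<beta> * \<bar>cos s\<bar> \<le> - r \<beta> * 1" using rb by (intro mult_left_mono) auto
    then show ?thesis using rb by (simp add: abs_mult)
  qed
  note ph = phi_range[OF \<beta> arg]
  define f where "f s = lam (phi (r \<beta> * cos s))" for s
  have f_cont: "isCont f s" for s
  proof -
    have "isCont (\<lambda>s. phi (r \<beta> * cos s)) s"
      by (rule isCont_o2[where g = phi]) (auto intro!: continuous_intros DERIV_isCont[OF ph(5)])
    then show ?thesis unfolding f_def by (rule isCont_o2) (rule lam_isCont[OF ph(4)])
  qed
  have ltop: "lam top_val > 0" using lam_pos top_val_gt_1 by simp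
  obtain F where F: "\<And>s. (F has_real_derivative f s) (at s)"
    using antiderivative_exists[of f] f_cont by (auto simp: continuous_on_eq_continuous_at)
  define \<tau> where "\<tau> s = F s - F 0" for s
  have \<tau>0: "\<tau> 0 = 0" by (simp add: \<tau>_def)
  have \<tau>_D: "(\<tau> has_real_derivative f s) (at s)" for s
    unfolding \<tau>_def[abs_def] by (rule DERIV_cong[OF DERIV_diff[OF F DERIV_const]]) simp
  \<comment> \<open>The speed of time in the angle is at least \<open>lam top_val > 0\<close>, so it
    can be inverted on the whole line.\<close>
  obtain \<theta> where \<theta>: "\<And>x. \<tau> (\<theta> x) = x" "\<And>x. \<theta> (\<tau> x) = x"
      "\<And>x. (\<theta> has_real_derivative inverse (f (\<theta> x))) (at x)"
    using global_inverse_function[OF \<tau>_D ltop] ph(6) unfolding f_def by blast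
  have f_pos: "f s > 0" for s unfolding f_def by (rule lam_pos[OF ph(4)])
  have \<tau>_mono: "\<tau> x < \<tau> y" if "x < y" for x y
    using DERIV_pos_imp_increasing[OF that, of \<tau>] \<tau>_D f_pos by blast
  define P where "P = \<tau> (2 * pi)"
  have "P > 0" using \<tau>_mono[of 0 "2 * pi"] \<tau>0 unfolding P_def by simp
  have \<tau>_per: "\<tau> (s + 2 * pi) = \<tau> s + P" for s
  proof -
    have "has_period (2 * pi) f" by (simp add: has_period_def f_def)
    from antiderivative_period_mult[OF this \<tau>_D, of s 1]
    show ?thesis using \<tau>0 by (simp add: P_def)
  qed
  have \<theta>_per: "\<theta> (t + P) = \<theta> t + 2 * pi" for t
    using \<theta>(2)[of "\<theta> t + 2 * pi"] \<tau>_per[of "\<theta> t"] \<theta>(1)[of t] by simp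
  have \<theta>0: "\<theta> 0 = 0" using \<theta>(2)[of 0] \<tau>0 by simp
  define k where "k t = phi (r \<beta> * cos (\<theta> t))" for t
  define k1 where "k1 t = - r \<beta> * sin (\<theta> t)" for t
  have kD: "(k has_real_derivative k1 t) (at t)" for t
  proof -
    have "((\<lambda>t. r \<beta> * cos (\<theta> t)) has_real_derivative r \<beta> * (- sin (\<theta> t) * inverse (f (\<theta> t)))) (at t)"
      by (auto intro!: derivative_eq_intros \<theta>(3))
    from DERIV_chain2[OF ph(5) this]
    have "(k has_real_derivative f (\<theta> t) * (r \<beta> * (- sin (\<theta> t) * inverse (f (\<theta> t))))) (at t)"
      unfolding k_def[abs_def] f_def .
    moreover have "f (\<theta> t) * (r \<beta> * (- sin (\<theta> t) * inverse (f (\<theta> t)))) = k1 t"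
      using f_pos[of "\<theta> t"] by (simp add: k1_def)
    ultimately show ?thesis by simp
  qed
  have k1D: "(k1 has_real_derivative - p (k t)) (at t)" for t
  proof -
    have "(k1 has_real_derivative - r \<beta> * (cos (\<theta> t) * inverse (f (\<theta> t)))) (at t)"
      unfolding k1_def[abs_def] by (auto intro!: derivative_eq_intros \<theta>(3))
    moreover have "p (k t) * f (\<theta> t) = r \<beta> * cos (\<theta> t)"
      unfolding k_def f_def p_lam[OF ph(4)] by (rule ph(3))
    then have "- r \<beta> * (cos (\<theta> t) * inverse (f (\<theta> t))) = - p (k t)"
      using f_pos[of "\<theta> t"] by (simp add: field_simps)
    ultimately show ?thesis by simp
  qed
  have per: "has_period P k" unfolding has_period_def k_def \<theta>_per by simp
  have k0: "k 0 = \<beta>" using phi_r[OF \<beta>(1)] by (simp add: k_def \<theta>0)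
  have k1D': "(k1 has_real_derivative - nonlin q (k t)) (at t)" for t
    using k1D[of t] unfolding p_eq_nonlin .
  have k_pos: "k t > 0" for t unfolding k_def by (rule ph(4))
  have k10: "k1 0 = 0" by (simp add: k1_def \<theta>0)
  note kp = k_prof_eqI(1)[OF kD k1D' k_pos per \<open>P > 0\<close> k0 k10]
  note sm = k_prof_eqI(2)[OF kD k1D' k_pos per \<open>P > 0\<close> k0 k10]
  \<comment> \<open>After a period the profile is back at its minimum, so the angle is a multiple of
    2 pi; none lies strictly between 0 and 2 pi.\<close>
  have least: "P \<le> p'" if p': "p' > 0 \<and> has_period p' k" for p'
  proof (rule ccontr)
    assume "\<not> P \<le> p'"
    have "k p' = k 0" using p' by (metis add_0 has_period_def)
    then have "r (k p') = r \<beta>" by (simp add: k0)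
    then have "r \<beta> * cos (\<theta> p') = r \<beta>" unfolding k_def ph(3) .
    then have "cos (\<theta> p') = 1" using rb by simp
    then obtain n :: int where n: "\<theta> p' = of_int n * 2 * pi" using cos_one_2pi_int by auto
    have "\<not> \<theta> p' < 0" "\<theta> p' \<noteq> 0"
      using \<tau>_mono[of "\<theta> p'" 0] \<theta>(1)[of p'] \<tau>0 p' by auto
    then have "\<theta> p' > 0" by linarith
    moreover have "\<not> 2 * pi < \<theta> p'" "\<theta> p' \<noteq> 2 * pi"
      using \<tau>_mono[of "2 * pi" "\<theta> p'"] \<theta>(1)[of p'] \<open>\<not> P \<le> p'\<close> unfolding P_def by auto
    then have "\<theta> p' < 2 * pi" by linarith
    ultimately have "0 < real_of_int n * (2 * pi)" "real_of_int n * (2 * pi) < 1 * (2 * pi)"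
      unfolding n by (simp_all add: mult.assoc)
    then have "0 < real_of_int n" "real_of_int n < 1"
      by (simp_all only: zero_less_mult_iff mult_less_cancel_right) (use pi_gt_zero in auto)
    then show False by simp
  qed
  have "P_per q \<beta> = P"
    unfolding P_per_def kp using least per \<open>P > 0\<close> by (intro Least_equality) auto
  then have Pk: "P_per q \<beta> = \<tau> (2 * pi)" unfolding P_def .
  have dk: "deriv k = k1" using kD by (auto intro!: DERIV_imp_deriv)
  show ?thesis
  proof (rule that[of \<tau> \<theta>, OF \<tau>0 _ \<theta>(1,2) _ Pk])
    show "(\<tau> has_real_derivative lam (phi (r \<beta> * cos s))) (at s)" for s
      using \<tau>_D[of s] unfolding f_def .
    show "k_prof q \<beta> = (\<lambda>t. phi (r \<beta> * cos (\<theta> t)))" unfolding kp k_def[abs_def] ..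
    show "P_per q \<beta> > 0" using \<open>P > 0\<close> unfolding Pk P_def .
    show "has_period (P_per q \<beta>) (k_prof q \<beta>)" using per unfolding Pk P_def kp .
    show "smooth (k_prof q \<beta>)" using sm unfolding kp .
    show "(deriv (k_prof q \<beta>) has_real_derivative - p (k_prof q \<beta> t)) (at t)" for t
      unfolding kp dk by (rule k1D)
    show "P_per q \<beta> \<le> p'" if "p' > 0" "has_period p' (k_prof q \<beta>)" for p'
      using least[of p'] that unfolding Pk P_def kp by simp
  qed
qed

lemma k_prof_bounds:
  assumes "0 < \<beta>" "\<beta> < 1"
  shows "\<beta> \<le> k_prof q \<beta> t" "k_prof q \<beta> t \<le> top_val" "k_prof q \<beta> t > 0"
proof -
  have "\<exists>\<theta>. k_prof q \<beta> = (\<lambda>t. phi (r \<beta> * cos (\<theta> t)))"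
    by (rule profile[OF assms], rule exI)
  then obtain \<theta> where k: "k_prof q \<beta> = (\<lambda>t. phi (r \<beta> * cos (\<theta> t)))" ..
  have "- r \<beta> * \<bar>cos (\<theta> t)\<bar> \<le> - r \<beta> * 1" using r_neg[OF assms] by (intro mult_left_mono) auto
  then have "\<bar>r \<beta> * cos (\<theta> t)\<bar> \<le> - r \<beta>" using r_neg[OF assms] by (simp add: abs_mult)
  from phi_range[OF assms this] show "\<beta> \<le> k_prof q \<beta> t" "k_prof q \<beta> t \<le> top_val" "k_prof q \<beta> t > 0"
    unfolding k by auto
qed

text \<open>The two one-sided results in the coordinate s = r k. The alternatives say that
  \<open>s\<close> and \<open>t\<close> lie on the same side of 0 with \<open>t\<close> farther out,
  and \<open>phi 0 = 1\<close> is the turning point.\<close>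

lemma lam_r_phi_mono:
  assumes "0 < \<beta>" "\<beta> < 1" "\<bar>t\<bar> \<le> - r \<beta>" and "0 \<le> s \<and> s \<le> t \<or> t \<le> s \<and> s \<le> 0"
  shows "lam (phi s) + (q - 1) / 3 * s \<le> lam (phi t) + (q - 1) / 3 * t"
proof -
  have s: "\<bar>s\<bar> \<le> - r \<beta>" using assms by auto
  note t = phi_range[OF assms(1-3)] and s' = phi_range[OF assms(1,2) s]
  have p0: "phi 0 = 1" using phi_r[of 1] by simp
  have z: "\<bar>0\<bar> \<le> - r \<beta>" using r_neg[OF assms(1,2)] by simp
  from assms(4) show ?thesis
  proof
    assume st: "0 \<le> s \<and> s \<le> t"
    then have "1 \<le> phi s" "phi s \<le> phi t"
      using phi_mono[OF assms(1,2) z s] phi_mono[OF assms(1,2) s assms(3)] p0 by auto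
    from lam_r_mono[OF this] show ?thesis unfolding t(3) s'(3) .
  next
    assume st: "t \<le> s \<and> s \<le> 0"
    then have "phi t \<le> phi s" "phi s \<le> 1"
      using phi_mono[OF assms(1,2) s z] phi_mono[OF assms(1,2,3) s] p0 by auto
    from lam_r_antimono[OF t(4) this] show ?thesis unfolding t(3) s'(3) .
  qed
qed

text \<open>Both orbits are parametrised by the same angle, so all differences reduce to the
  difference \<open>d\<close> of the radii. The circle for \<beta> \<ge> \<alpha> lies inside the
  one for \<alpha>, so the constants of \<alpha> serve both.\<close>

lemma profile_compare:
  assumes \<alpha>: "0 < \<alpha>" "\<alpha> < 1"
  shows "\<exists>C>0. \<forall>\<beta>. \<alpha> \<le> \<beta> \<and> \<beta> < 1 \<longrightarrow>
     P_per q \<beta> \<le> P_per q \<alpha> \<and> P_per q \<alpha> - P_per q \<beta> \<le> C * (\<beta> - \<alpha>) \<and>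
     (\<forall>x. \<bar>k_prof q \<beta> (P_per q \<beta> / P_per q \<alpha> * x) - k_prof q \<alpha> x\<bar> \<le> C * (\<beta> - \<alpha>))"
proof -
  obtain \<tau> \<theta> where pa: "\<tau> 0 = 0" "\<And>s. (\<tau> has_real_derivative lam (phi (r \<alpha> * cos s))) (at s)"
    "\<And>t. \<tau> (\<theta> t) = t" "\<And>s. \<theta> (\<tau> s) = s"
    "k_prof q \<alpha> = (\<lambda>t. phi (r \<alpha> * cos (\<theta> t)))" "P_per q \<alpha> = \<tau> (2 * pi)"
    "P_per q \<alpha> > 0" "has_period (P_per q \<alpha>) (k_prof q \<alpha>)" "smooth (k_prof q \<alpha>)"
    "\<And>t. (deriv (k_prof q \<alpha>) has_real_derivative - p (k_prof q \<alpha> t)) (at t)"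
    "\<And>p'. p' > 0 \<Longrightarrow> has_period p' (k_prof q \<alpha>) \<Longrightarrow> P_per q \<alpha> \<le> p'"
    using that by (rule profile[OF \<alpha>])
  define L where "L = lip_const \<alpha>"
  define l where "l = lam top_val"
  have L: "L > 0" unfolding L_def using lip_const_pos \<alpha> by simp
  have l: "l > 0" unfolding l_def using lam_pos top_val_gt_1 by simp
  have la: "lam \<alpha> > 0" using lam_pos \<alpha> by simp
  have ra: "r \<alpha> < 0" using r_neg[OF \<alpha>] .
  have arg: "\<bar>c * cos s\<bar> \<le> - r \<alpha>" if "r \<alpha> \<le> c" "c \<le> 0" for c s
  proof -
    have "\<bar>c\<bar> * \<bar>cos s\<bar> \<le> (- r \<alpha>) * 1" using that by (intro mult_mono) auto
    then show ?thesis by (simp add: abs_mult)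
  qed
  \<comment> \<open>\<open>lam \<alpha>\<close> is the Lipschitz constant of \<open>phi\<close>; the
    bracket collects the changes of radius and of angle per unit of \<open>d\<close>; the last
    \<open>1 / l\<close> comes from \<open>d \<le> (\<beta> - \<alpha>) / l\<close>.\<close>
  define C where "C = lam \<alpha> * (1 - r \<alpha> * (4 * pi * L / l)) / l"
  define C' where "C' = C + 2 * pi * L / l"
  have m: "r \<alpha> * (4 * pi * L / l) \<le> 0" using ra L l by (intro mult_nonpos_nonneg) auto
  then have "C > 0"
    unfolding C_def using la l by (intro divide_pos_pos mult_pos_pos) linarith+
  have "2 * pi * L / l > 0" using L l by simp
  have C': "C' > 0" "C \<le> C'" "2 * pi * L / l \<le> C'"
    unfolding C'_def using \<open>C > 0\<close> \<open>2 * pi * L / l > 0\<close> by linarith+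
  have "P_per q \<beta> \<le> P_per q \<alpha> \<and> P_per q \<alpha> - P_per q \<beta> \<le> C' * (\<beta> - \<alpha>) \<and>
     (\<forall>x. \<bar>k_prof q \<beta> (P_per q \<beta> / P_per q \<alpha> * x) - k_prof q \<alpha> x\<bar> \<le> C' * (\<beta> - \<alpha>))"
    if ab: "\<alpha> \<le> \<beta>" "\<beta> < 1" for \<beta>
  proof -
    have \<beta>: "0 < \<beta>" "\<beta> < 1" using ab \<alpha> by auto
    obtain \<sigma> \<eta> where pb: "\<sigma> 0 = 0" "\<And>s. (\<sigma> has_real_derivative lam (phi (r \<beta> * cos s))) (at s)"
      "\<And>t. \<sigma> (\<eta> t) = t" "\<And>s. \<eta> (\<sigma> s) = s"
      "k_prof q \<beta> = (\<lambda>t. phi (r \<beta> * cos (\<eta> t)))" "P_per q \<beta> = \<sigma> (2 * pi)"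
      "P_per q \<beta> > 0" "has_period (P_per q \<beta>) (k_prof q \<beta>)" "smooth (k_prof q \<beta>)"
      "\<And>t. (deriv (k_prof q \<beta>) has_real_derivative - p (k_prof q \<beta> t)) (at t)"
      "\<And>p'. p' > 0 \<Longrightarrow> has_period p' (k_prof q \<beta>) \<Longrightarrow> P_per q \<beta> \<le> p'"
      using that by (rule profile[OF \<beta>])
    define d where "d = r \<beta> - r \<alpha>"
    have d0: "d \<ge> 0" unfolding d_def using r_mono[OF \<alpha>(1) ab(1)] by simp
    have rb: "r \<alpha> \<le> r \<beta>" "r \<beta> \<le> 0" using d0 r_neg[OF \<beta>] unfolding d_def by auto
    have d_le: "d \<le> (\<beta> - \<alpha>) / l"
    proof -
      have "norm (r \<beta> - r \<alpha>) \<le> (1 / l) * norm (\<beta> - \<alpha>)"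
      proof (rule field_differentiable_bound[where S = "{\<alpha>..\<beta>}"])
        fix z assume z: "z \<in> {\<alpha>..\<beta>}"
        then have "z > 0" "z \<le> top_val" using \<alpha> ab top_val_gt_1 by auto
        show "(r has_field_derivative 1 / lam z) (at z within {\<alpha>..\<beta>})"
          using r_D[OF \<open>z > 0\<close>] by (rule has_field_derivative_at_within)
        show "norm (1 / lam z) \<le> 1 / l"
          using lam_antimono[OF \<open>z > 0\<close> \<open>z \<le> top_val\<close>] l lam_pos[OF \<open>z > 0\<close>]
          unfolding l_def by (simp add: frac_le)
      qed (use ab in auto)
      then show ?thesis using d0 ab unfolding d_def by simp
    qed
    have arga: "\<bar>r \<alpha> * cos s\<bar> \<le> - r \<alpha>" and argb: "\<bar>r \<beta> * cos s\<bar> \<le> - r \<alpha>" for s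
      using arg[of "r \<alpha>" s] arg[of "r \<beta>" s] ra rb by auto
    have \<tau>\<sigma>: "\<bar>\<tau> s - \<sigma> s\<bar> \<le> L * d * \<bar>s\<bar>" for s
    proof -
      have "norm ((\<tau> s - \<sigma> s) - (\<tau> 0 - \<sigma> 0)) \<le> (L * d) * norm (s - 0)"
      proof (rule field_differentiable_bound[where S = UNIV and f = "\<lambda>s. \<tau> s - \<sigma> s"])
        fix z :: real
        show "((\<lambda>s. \<tau> s - \<sigma> s) has_field_derivative lam (phi (r \<alpha> * cos z)) - lam (phi (r \<beta> * cos z))) (at z)"
          by (intro DERIV_diff pa(2) pb(2))
        have "\<bar>lam (phi (r \<alpha> * cos z)) - lam (phi (r \<beta> * cos z))\<bar> \<le> L * \<bar>r \<alpha> * cos z - r \<beta> * cos z\<bar>"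
          unfolding L_def by (rule lam_phi_lipschitz[OF \<alpha> arga argb])
        also have "\<bar>r \<alpha> * cos z - r \<beta> * cos z\<bar> = d * \<bar>cos z\<bar>"
          using d0 unfolding d_def left_diff_distrib[symmetric] abs_mult by simp
        also have "L * (d * \<bar>cos z\<bar>) \<le> L * (d * 1)"
          using L d0 by (intro mult_left_mono) auto
        finally show "norm (lam (phi (r \<alpha> * cos z)) - lam (phi (r \<beta> * cos z))) \<le> L * d" by simp
      qed auto
      then show ?thesis using pa(1) pb(1) by simp
    qed
    define Pa Pb where "Pa = P_per q \<alpha>" and "Pb = P_per q \<beta>"
    have Pa: "Pa = \<tau> (2 * pi)" "Pa > 0" unfolding Pa_def using pa by auto
    have Pb: "Pb = \<sigma> (2 * pi)" "Pb > 0" unfolding Pb_def using pb by auto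
    text \<open>The term \<open>(q - 1)/3 \<cdot> r\<close> integrates to zero over a period and makes the integrand
      monotone in the amplitude.\<close>
    have Pmono: "Pb \<le> Pa"
    proof -
      let ?f = "\<lambda>s. \<tau> s - \<sigma> s + (q - 1) / 3 * (r \<alpha> - r \<beta>) * sin s"
      have "?f 0 \<le> ?f (2 * pi)"
      proof (rule DERIV_nonneg_imp_nondecreasing[where f = ?f])
        fix s :: real
        have D: "(?f has_real_derivative lam (phi (r \<alpha> * cos s)) - lam (phi (r \<beta> * cos s))
            + (q - 1) / 3 * (r \<alpha> - r \<beta>) * cos s) (at s)"
          by (intro DERIV_add DERIV_diff pa(2) pb(2) DERIV_cmult DERIV_sin)
        have "0 \<le> r \<beta> * cos s \<and> r \<beta> * cos s \<le> r \<alpha> * cos s \<or> r \<alpha> * cos s \<le> r \<beta> * cos s \<and> r \<beta> * cos s \<le> 0"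
          using rb by (cases "cos s \<ge> 0") (auto simp: mult_nonpos_nonpos mult_nonpos_nonneg mult_right_mono mult_right_mono_neg)
        from lam_r_phi_mono[OF \<alpha> arga this]
        have "lam (phi (r \<beta> * cos s)) + (q - 1) / 3 * (r \<beta> * cos s)
          \<le> lam (phi (r \<alpha> * cos s)) + (q - 1) / 3 * (r \<alpha> * cos s)" .
        moreover have "(q - 1) / 3 * (r \<alpha> - r \<beta>) * cos s = (q - 1) / 3 * (r \<alpha> * cos s) - (q - 1) / 3 * (r \<beta> * cos s)"
          by (simp only: right_diff_distrib left_diff_distrib mult.assoc)
        ultimately have "0 \<le> lam (phi (r \<alpha> * cos s)) - lam (phi (r \<beta> * cos s)) + (q - 1) / 3 * (r \<alpha> - r \<beta>) * cos s"
          by linarith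
        with D show "\<exists>y. (?f has_real_derivative y) (at s) \<and> y \<ge> 0" by blast
      qed simp
      then show ?thesis using pa(1) pb(1) Pa Pb by simp
    qed
    have Pdiff: "Pa - Pb \<le> L * d * (2 * pi)"
      using \<tau>\<sigma>[of "2 * pi"] Pmono unfolding Pa Pb by simp
    have \<tau>_lower: "l * (y - x) \<le> \<tau> y - \<tau> x" if "x \<le> y" for x y
    proof -
      have "\<tau> x - l * x \<le> \<tau> y - l * y"
      proof (rule DERIV_nonneg_imp_nondecreasing[where f = "\<lambda>s. \<tau> s - l * s", OF that])
        fix s
        have "((\<lambda>s. \<tau> s - l * s) has_real_derivative lam (phi (r \<alpha> * cos s)) - l) (at s)"
          by (auto intro!: derivative_eq_intros pa(2))
        then show "\<exists>y. ((\<lambda>s. \<tau> s - l * s) has_real_derivative y) (at s) \<and> y \<ge> 0"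
          using phi_range(6)[OF \<alpha> arga] unfolding l_def by force
      qed
      then show ?thesis by (simp add: algebra_simps)
    qed
    have near: "\<bar>k_prof q \<beta> (Pb / Pa * x) - k_prof q \<alpha> x\<bar> \<le> C * (\<beta> - \<alpha>)" if x: "0 \<le> x" "x \<le> Pa" for x
    proof -
      define s where "s = \<eta> (Pb / Pa * x)"
      define s' where "s' = \<theta> x"
      have \<sigma>s: "\<sigma> s = Pb / Pa * x" unfolding s_def by (rule pb(3))
      have \<tau>s': "\<tau> s' = x" unfolding s'_def by (rule pa(3))
      have \<sigma>_mono: "\<sigma> u < \<sigma> v" if "u < v" for u v
        using DERIV_pos_imp_increasing[OF that, of \<sigma>] pb(2) lam_pos[OF phi_range(4)[OF \<alpha> argb]] by blast
      have "0 \<le> Pb / Pa * x" "Pb / Pa * x \<le> Pb" using Pa Pb x by (auto simp: field_simps)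
      then have s: "0 \<le> s" "s \<le> 2 * pi"
        using \<sigma>_mono[of s 0] \<sigma>_mono[of "2 * pi" s] \<sigma>s pb(1) Pb(1) by (auto simp: not_less[symmetric])
      have "x - Pb / Pa * x = x / Pa * (Pa - Pb)" using Pa(2) by (simp add: field_simps)
      also have "\<dots> \<le> 1 * (Pa - Pb)" using x Pa(2) Pmono by (intro mult_right_mono) (auto simp: field_simps)
      finally have "x - Pb / Pa * x \<le> L * d * (2 * pi)" using Pdiff by simp
      moreover have "x - Pb / Pa * x \<ge> 0"
        using x Pa(2) Pmono by (simp add: field_simps mult_right_mono)
      moreover have "\<bar>\<tau> s - \<sigma> s\<bar> \<le> L * d * (2 * pi)"
      proof -
        have "L * d * \<bar>s\<bar> \<le> L * d * (2 * pi)" using s L d0 by (intro mult_left_mono) auto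
        then show ?thesis using \<tau>\<sigma>[of s] by linarith
      qed
      \<comment> \<open>Two errors of size 2 pi L d each: the two clocks \<open>\<tau>\<close> and
        \<open>\<sigma>\<close> at the same angle, and the rescaling of time by the ratio of the
        periods.\<close>
      ultimately have "\<bar>\<tau> s - \<tau> s'\<bar> \<le> 4 * pi * L * d"
        using \<sigma>s \<tau>s' by (simp add: abs_le_iff algebra_simps)
      moreover have "l * \<bar>s - s'\<bar> \<le> \<bar>\<tau> s - \<tau> s'\<bar>"
        using \<tau>_lower[of s s'] \<tau>_lower[of s' s] by (cases "s \<le> s'") (auto simp: abs_if)
      ultimately have ss: "\<bar>s - s'\<bar> \<le> 4 * pi * L / l * d"
        using l by (simp add: field_simps)
      have "\<bar>r \<beta> * cos s - r \<alpha> * cos s'\<bar> \<le> (1 - r \<alpha> * (4 * pi * L / l)) * d"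
      proof -
        have "r \<beta> * cos s - r \<alpha> * cos s' = d * cos s + r \<alpha> * (cos s - cos s')"
          unfolding d_def by (simp add: algebra_simps)
        then have "\<bar>r \<beta> * cos s - r \<alpha> * cos s'\<bar> \<le> \<bar>d * cos s\<bar> + \<bar>r \<alpha> * (cos s - cos s')\<bar>"
          by (metis abs_triangle_ineq)
        also have "\<bar>d * cos s\<bar> \<le> d * 1" using d0 unfolding abs_mult by (intro mult_mono) auto
        also have "\<bar>r \<alpha> * (cos s - cos s')\<bar> \<le> (- r \<alpha>) * (4 * pi * L / l * d)"
        proof -
          have "norm (cos s - cos s') \<le> 1 * norm (s - s')"
            by (rule field_differentiable_bound[where S = UNIV and f' = "\<lambda>x. - sin x"])
               (auto intro!: derivative_eq_intros)
          then have "\<bar>cos s - cos s'\<bar> \<le> 4 * pi * L / l * d" using ss by simp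
          then show ?thesis unfolding abs_mult using ra by (intro mult_mono) auto
        qed
        finally show ?thesis by (simp add: algebra_simps)
      qed
      then have "lam \<alpha> * \<bar>r \<beta> * cos s - r \<alpha> * cos s'\<bar> \<le> lam \<alpha> * ((1 - r \<alpha> * (4 * pi * L / l)) * d)"
        using la by (intro mult_left_mono) auto
      moreover have "\<bar>phi (r \<beta> * cos s) - phi (r \<alpha> * cos s')\<bar> \<le> lam \<alpha> * \<bar>r \<beta> * cos s - r \<alpha> * cos s'\<bar>"
        by (rule phi_lipschitz[OF \<alpha> argb arga])
      moreover have "lam \<alpha> * ((1 - r \<alpha> * (4 * pi * L / l)) * d) \<le> C * (\<beta> - \<alpha>)"
      proof -
        have "(1 - r \<alpha> * (4 * pi * L / l)) * d \<le> (1 - r \<alpha> * (4 * pi * L / l)) * ((\<beta> - \<alpha>) / l)"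
          using d_le m by (intro mult_left_mono) linarith+
        from mult_left_mono[OF this less_imp_le[OF la]]
        have "lam \<alpha> * ((1 - r \<alpha> * (4 * pi * L / l)) * d) \<le> lam \<alpha> * ((1 - r \<alpha> * (4 * pi * L / l)) * ((\<beta> - \<alpha>) / l))" .
        then show ?thesis unfolding C_def by (simp add: mult_ac)
      qed
      ultimately show ?thesis unfolding pa(5) pb(5) s_def s'_def by linarith
    qed
    have near_all: "\<bar>k_prof q \<beta> (Pb / Pa * x) - k_prof q \<alpha> x\<bar> \<le> C * (\<beta> - \<alpha>)" for x
    proof -
      let ?g = "\<lambda>x. k_prof q \<beta> (Pb / Pa * x) - k_prof q \<alpha> x"
      have "has_period Pa ?g"
        unfolding has_period_def
      proof
        fix x
        have "Pb / Pa * (x + Pa) = Pb / Pa * x + Pb" using Pa(2) by (simp add: field_simps)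
        then show "?g (x + Pa) = ?g x"
          using pa(8) pb(8) unfolding has_period_def Pa_def[symmetric] Pb_def[symmetric] by simp
      qed
      then obtain y where "0 \<le> y" "y < Pa" "?g x = ?g y" using has_period_reduce[of Pa ?g x] Pa(2) by blast
      then show ?thesis using near[of y] by simp
    qed
    have "L * d * (2 * pi) \<le> L * ((\<beta> - \<alpha>) / l) * (2 * pi)"
      using L d_le by (intro mult_right_mono mult_left_mono) auto
    also have "\<dots> = 2 * pi * L / l * (\<beta> - \<alpha>)" by simp
    also have "\<dots> \<le> C' * (\<beta> - \<alpha>)" using C'(3) ab by (intro mult_right_mono) auto
    finally have "Pa - Pb \<le> C' * (\<beta> - \<alpha>)" using Pdiff by simp
    moreover have "C * (\<beta> - \<alpha>) \<le> C' * (\<beta> - \<alpha>)" using C'(2) ab by (intro mult_right_mono) auto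
    ultimately show ?thesis
      using Pmono near_all unfolding Pa_def Pb_def by (meson order_trans)
  qed
  then show ?thesis using C'(1) by blast
qed

end

section \<open>Instability from the monotonicity of \<open>E\<close>\<close>

lemma powr_ge_one_minus:
  fixes z e :: real
  assumes "0 < z" "z \<le> 1" "0 < e"
  shows "1 - z powr e \<le> max 1 e * (1 - z)"
proof (cases "e \<le> 1")
  case True
  have "z powr 1 \<le> z powr e" using assms True by (intro powr_mono') auto
  then show ?thesis using True assms by simp
next
  case False
  have "norm (1 powr e - z powr e) \<le> e * norm (1 - z)"
  proof (rule field_differentiable_bound[where S = "{z..1}" and f = "\<lambda>t. t powr e"])
    fix t assume t: "t \<in> {z..1}"
    then have "t > 0" using assms by simp
    show "((\<lambda>t. t powr e) has_field_derivative e * t powr (e - 1)) (at t within {z..1})"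
      by (rule has_field_derivative_at_within) (rule has_real_derivative_powr[OF \<open>t > 0\<close>])
    have "t powr (e - 1) \<le> 1 powr (e - 1)" using t \<open>t > 0\<close> False by (intro powr_mono2) auto
    then show "norm (e * t powr (e - 1)) \<le> e" using assms by (simp add: abs_mult)
  qed (use assms in auto)
  then show ?thesis using False assms by simp
qed

context superlinear
begin

text \<open>The mean value inequality twice: for the derivative y^(q-1) of \<open>p\<close>, then
  for \<open>p\<close> minus its tangent at \<open>y\<close>. \<open>M\<close> bounds p'' on the
  interval.\<close>

lemma p_taylor:
  assumes "0 < a" "a \<le> b"
  shows "\<exists>M>0. \<forall>y\<in>{a..b}. \<forall>z\<in>{a..b}. \<bar>p z - p y - y powr (q - 1) * (z - y)\<bar> \<le> M * (z - y)\<^sup>2"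
proof -
  define M where "M = (q - 1) * (a powr (q - 2) + b powr (q - 2))"
  have "a powr (q - 2) > 0" using assms by simp
  then have "M > 0" unfolding M_def using q by (intro mult_pos_pos add_pos_nonneg) auto
  have "\<bar>p z - p y - y powr (q - 1) * (z - y)\<bar> \<le> M * (z - y)\<^sup>2" if yz: "y \<in> {a..b}" "z \<in> {a..b}" for y z
  proof -
    define lo hi where "lo = min y z" and "hi = max y z"
    have lh: "a \<le> lo" "hi \<le> b" "lo \<le> y" "y \<le> hi" "lo \<le> z" "z \<le> hi" "\<And>t. t \<in> {lo..hi} \<Longrightarrow> \<bar>t - y\<bar> \<le> \<bar>z - y\<bar>"
      using yz unfolding lo_def hi_def by auto
    have lip: "\<bar>t powr (q - 1) - y powr (q - 1)\<bar> \<le> M * \<bar>z - y\<bar>" if t: "t \<in> {lo..hi}" for t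
    proof -
      have "norm (t powr (q - 1) - y powr (q - 1)) \<le> M * norm (t - y)"
      proof (rule field_differentiable_bound[where S = "{lo..hi}" and f = "\<lambda>t. t powr (q - 1)"])
        fix s assume s: "s \<in> {lo..hi}"
        then have "s > 0" "a \<le> s" "s \<le> b" using lh assms by auto
        have "((\<lambda>t. t powr (q - 1)) has_field_derivative (q - 1) * s powr (q - 2)) (at s)"
          using has_real_derivative_powr[OF \<open>s > 0\<close>, of "q - 1"] by simp
        then show "((\<lambda>t. t powr (q - 1)) has_field_derivative (q - 1) * s powr (q - 2)) (at s within {lo..hi})"
          by (rule has_field_derivative_at_within)
        show "norm ((q - 1) * s powr (q - 2)) \<le> M"
          using powr_bounds_between[OF assms(1) \<open>a \<le> s\<close> \<open>s \<le> b\<close>, of "q - 2"] q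
          unfolding M_def by (simp add: abs_mult)
      qed (use t lh in auto)
      also have "\<dots> \<le> M * \<bar>z - y\<bar>" using lh(7)[OF t] \<open>M > 0\<close> by simp
      finally show ?thesis by simp
    qed
    have "norm ((p z - y powr (q - 1) * z) - (p y - y powr (q - 1) * y)) \<le> (M * \<bar>z - y\<bar>) * norm (z - y)"
    proof (rule field_differentiable_bound[where S = "{lo..hi}" and f = "\<lambda>t. p t - y powr (q - 1) * t"])
      fix t assume t: "t \<in> {lo..hi}"
      then have "t > 0" using lh assms by auto
      have "((\<lambda>t. p t - y powr (q - 1) * t) has_field_derivative t powr (q - 1) - y powr (q - 1)) (at t)"
        by (auto intro!: derivative_eq_intros p_D[OF \<open>t > 0\<close>])
      then show "((\<lambda>t. p t - y powr (q - 1) * t) has_field_derivative t powr (q - 1) - y powr (q - 1)) (at t within {lo..hi})"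
        by (rule has_field_derivative_at_within)
      show "norm (t powr (q - 1) - y powr (q - 1)) \<le> M * \<bar>z - y\<bar>" using lip[OF t] by simp
    qed (use lh in auto)
    then show ?thesis by (simp add: power2_eq_square algebra_simps)
  qed
  then show ?thesis using \<open>M > 0\<close> by blast
qed

text \<open>The quadratic form is evaluated at \<open>w + c\<close>, where \<open>w\<close> solves the linearised equation
  with right-hand side \<open>d + \<eta>\<close> and \<open>c = - I/P\<close> restores the mean value zero.\<close>

lemma quadratic_form_shift:
  fixes k w w1 w2 \<eta> :: "real \<Rightarrow> real"
  assumes w: "\<And>x. (w has_real_derivative w1 x) (at x)" "\<And>x. (w1 has_real_derivative w2 x) (at x)"
    and per: "has_period P w" "P > 0"
    and lin: "\<And>x. w2 x + k x powr (q - 1) * w x = d + \<eta> x"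
    and I: "(w has_integral I) {0..P}" and c: "c = - I / P"
    and K: "((\<lambda>x. k x powr (q - 1)) has_integral K) {0..P}"
    and N: "((\<lambda>x. (w x + 2 * c) * \<eta> x) has_integral N) {0..P}"
  shows "((\<lambda>x. (w1 x)\<^sup>2 - k x powr (q - 1) * (w x + c)\<^sup>2) has_integral (d * I - N - c\<^sup>2 * K)) {0..P}"
proof -
  have const: "((\<lambda>x. y) has_integral y * P) {0..P}" for y :: real
    using has_integral_const_real[of y 0 P] per(2) by (simp add: mult.commute)
  have per1: "has_period P w1" by (rule has_period_deriv[OF per(1) w(1)])
  have 1: "((\<lambda>x. w2 x * (w x + c) + (w1 x)\<^sup>2) has_integral 0) {0..P}"
  proof (rule integral_periodic_deriv_zero[OF _ per(2)])
    show "has_period P (\<lambda>x. w1 x * (w x + c))" using per(1) per1 by (simp add: has_period_def)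
    show "((\<lambda>x. w1 x * (w x + c)) has_real_derivative w2 x * (w x + c) + (w1 x)\<^sup>2) (at x)" for x
      by (auto intro!: derivative_eq_intros w simp: power2_eq_square)
  qed
  have 2: "(w2 has_integral 0) {0..P}" by (rule integral_periodic_deriv_zero[OF per1 per(2) w(2)])
  have 3: "((\<lambda>x. (w2 x * (w x + c) + (w1 x)\<^sup>2) - d * w x - 2 * c * d + c * w2 x - (w x + 2 * c) * \<eta> x - c\<^sup>2 * k x powr (q - 1))
     has_integral (0 - d * I - 2 * c * d * P + c * 0 - N - c\<^sup>2 * K)) {0..P}"
    by (intro has_integral_diff has_integral_add has_integral_mult_right 1 2 I K N const)
  have e1: "(w2 x * (w x + c) + (w1 x)\<^sup>2) - d * w x - 2 * c * d + c * w2 x - (w x + 2 * c) * \<eta> x - c\<^sup>2 * k x powr (q - 1)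
     = (w1 x)\<^sup>2 - k x powr (q - 1) * (w x + c)\<^sup>2" for x
  proof -
    have e: "\<eta> x = w2 x + k x powr (q - 1) * w x - d" using lin[of x] by simp
    show ?thesis unfolding e by (simp add: power2_eq_square algebra_simps)
  qed
  \<comment> \<open>Since \<open>c * P = - I\<close>, the term - 2 c d P equals 2 d I and reverses
    the sign of - d I.\<close>
  have e2: "0 - d * I - 2 * c * d * P + c * 0 - N - c\<^sup>2 * K = d * I - N - c\<^sup>2 * K"
    using per(2) unfolding c by (simp add: field_simps)
  show ?thesis using 3 unfolding e1 e2 .
qed

lemma k_prof_facts:
  assumes "0 < \<beta>" "\<beta> < 1"
  shows "P_per q \<beta> > 0" "has_period (P_per q \<beta>) (k_prof q \<beta>)" "smooth (k_prof q \<beta>)"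
    "\<And>t. (k_prof q \<beta> has_real_derivative deriv (k_prof q \<beta>) t) (at t)"
    "\<And>t. (deriv (k_prof q \<beta>) has_real_derivative - p (k_prof q \<beta> t)) (at t)"
    "continuous_on UNIV (k_prof q \<beta>)"
    "\<And>p'. p' > 0 \<Longrightarrow> has_period p' (k_prof q \<beta>) \<Longrightarrow> P_per q \<beta> \<le> p'"
proof -
  show sm: "smooth (k_prof q \<beta>)" by (rule profile[OF assms])
  show "P_per q \<beta> > 0" by (rule profile[OF assms])
  show "has_period (P_per q \<beta>) (k_prof q \<beta>)" by (rule profile[OF assms])
  show "(deriv (k_prof q \<beta>) has_real_derivative - p (k_prof q \<beta> t)) (at t)" for t by (rule profile[OF assms])
  show D: "(k_prof q \<beta> has_real_derivative deriv (k_prof q \<beta>) t) (at t)" for t by (rule smooth_DERIV[OF sm])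
  show "continuous_on UNIV (k_prof q \<beta>)"
    using D by (meson DERIV_isCont continuous_at_imp_continuous_on)
  show "P_per q \<beta> \<le> p'" if "p' > 0" "has_period p' (k_prof q \<beta>)" for p'
    by (rule profile[OF assms]) (use that in blast)
qed

text \<open>The remainder of \<open>p'\<close> modulo the least period would be a smaller period
  unless it is zero.\<close>

lemma period_multiple:
  assumes "0 < \<beta>" "\<beta> < 1" "p' > 0" "has_period p' (k_prof q \<beta>)"
  shows "\<exists>N. p' = real N * P_per q \<beta>"
proof -
  define P where "P = P_per q \<beta>"
  note facts = k_prof_facts[OF assms(1,2)]
  have P: "P > 0" unfolding P_def by (rule facts)
  define N where "N = nat \<lfloor>p' / P\<rfloor>"
  have fl: "real N = of_int \<lfloor>p' / P\<rfloor>" unfolding N_def using assms(3) P by simp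
  have "real N \<le> p' / P" "p' / P < real N + 1" unfolding fl by linarith+
  then have r: "0 \<le> p' - real N * P" "p' - real N * P < P" using P by (auto simp: field_simps)
  have "has_period (p' - real N * P) (k_prof q \<beta>)"
    unfolding has_period_def
  proof
    fix x
    have "k_prof q \<beta> (x + (p' - real N * P)) = k_prof q \<beta> ((x + (p' - real N * P)) + real N * P)"
      unfolding P_def by (rule has_period_mult_nat[OF facts(2), symmetric])
    also have "\<dots> = k_prof q \<beta> (x + p')" by simp
    finally show "k_prof q \<beta> (x + (p' - real N * P)) = k_prof q \<beta> x"
      using assms(4) by (simp add: has_period_def)
  qed
  from facts(7)[OF _ this] have "\<not> p' - real N * P > 0"
    using r(2) unfolding P_def[symmetric] by (meson not_le)
  then have "p' = real N * P" using r(1) by linarith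
  then show ?thesis unfolding P_def by blast
qed

lemma A_area_pos:
  assumes "0 < \<beta>" "\<beta> < 1"
  shows "A_area q \<beta> > 0" "(k_prof q \<beta> has_integral A_area q \<beta>) {0..P_per q \<beta>}"
proof -
  note facts = k_prof_facts[OF assms]
  show int: "(k_prof q \<beta> has_integral A_area q \<beta>) {0..P_per q \<beta>}"
    unfolding A_area_def
    by (intro integrable_integral integrable_continuous_real continuous_on_subset[OF facts(6)]) simp
  have "((\<lambda>x. \<beta>) has_integral \<beta> * P_per q \<beta>) {0..P_per q \<beta>}"
    using has_integral_const_real[of \<beta> 0 "P_per q \<beta>"] facts(1) by (simp add: mult.commute)
  from has_integral_le[OF this int] have "\<beta> * P_per q \<beta> \<le> A_area q \<beta>"
    using k_prof_bounds(1)[OF assms] by blast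
  then show "A_area q \<beta> > 0" using assms facts(1) by (meson less_le_trans mult_pos_pos)
qed

lemma profile_unstable:
  assumes \<alpha>: "0 < \<alpha>" "\<alpha> < 1" and E: "(E_fun q has_real_derivative E') (at \<alpha>)" "E' > 0"
  shows "\<exists>v J. smooth v \<and> has_period (P_per q \<alpha>) v \<and> (v has_integral 0) {0..P_per q \<alpha>} \<and>
    ((\<lambda>x. (deriv v x)\<^sup>2 - k_prof q \<alpha> x powr (q - 1) * (v x)\<^sup>2) has_integral J) {0..P_per q \<alpha>} \<and> J < 0"
proof -
  define P where "P = P_per q \<alpha>"
  define k where "k = k_prof q \<alpha>"
  define A where "A = A_area q \<alpha>"
  note facts = k_prof_facts[OF \<alpha>, folded P_def k_def]
  note bds = k_prof_bounds[OF \<alpha>, folded k_def]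
  note area = A_area_pos[OF \<alpha>, folded P_def k_def A_def]
  \<comment> \<open>The exponent for which a = z^e satisfies a^(q-1) = z^2: then a * l (z * x)
    solves the profile equation again, with only the constant term changed.\<close>
  define e where "e = 2 / (q - 1)"
  have "e > 0" unfolding e_def using q by simp
  moreover have "q - 1 \<noteq> 0" using q by simp
  ultimately have e: "e > 0" "e * (q - 1) = 2"
    using nonzero_eq_divide_eq[of "q - 1" e 2] unfolding e_def by blast+
  \<comment> \<open>An increasing function of E, as \<open>q > 1\<close>. In the form P^(e-1) A it
    is proportional to the area of the profile rescaled to a fixed period with exponent
    \<open>e\<close>.\<close>
  define S where "S \<beta> = E_fun q \<beta> powr (1 / (q - 1))" for \<beta>
  have S: "S \<beta> = P_per q \<beta> powr (e - 1) * A_area q \<beta>" if "0 < \<beta>" "\<beta> < 1" for \<beta>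
  proof -
    have "(3 - q) * (1 / (q - 1)) = e - 1" unfolding e_def using q by (simp add: field_simps)
    then show ?thesis
      unfolding S_def E_fun_def using A_area_pos(1)[OF that] k_prof_facts(1)[OF that] q
      by (simp add: powr_mult powr_powr)
  qed
  have Epos: "E_fun q \<alpha> > 0" unfolding E_fun_def using area(1) facts(1) by (simp add: A_def P_def)
  define S' where "S' = 1 / (q - 1) * E_fun q \<alpha> powr (1 / (q - 1) - 1) * E'"
  have S'pos: "S' > 0" unfolding S'_def using Epos E(2) q by simp
  have S_D: "(S has_real_derivative S') (at \<alpha>)"
    unfolding S_def[abs_def] S'_def by (rule DERIV_chain2[OF has_real_derivative_powr[OF Epos] E(1)])
  obtain \<delta>0 where \<delta>0: "\<delta>0 > 0" "\<And>\<beta>. \<alpha> < \<beta> \<Longrightarrow> \<beta> < \<alpha> + \<delta>0 \<Longrightarrow> S \<beta> - S \<alpha> > S' / 2 * (\<beta> - \<alpha>)"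
  proof -
    have "((\<lambda>\<beta>. (S \<beta> - S \<alpha>) / (\<beta> - \<alpha>)) \<longlongrightarrow> S') (at \<alpha>)"
      using S_D by (simp add: has_field_derivative_iff)
    then have "\<forall>\<^sub>F \<beta> in at \<alpha>. (S \<beta> - S \<alpha>) / (\<beta> - \<alpha>) > S' / 2"
      by (rule order_tendstoD(1)) (use S'pos in simp)
    then obtain d where d: "d > 0" "\<forall>\<beta>. \<beta> \<noteq> \<alpha> \<and> dist \<beta> \<alpha> < d \<longrightarrow> (S \<beta> - S \<alpha>) / (\<beta> - \<alpha>) > S' / 2"
      unfolding eventually_at by auto
    show ?thesis
    proof (rule that[OF d(1)])
      fix \<beta> assume "\<alpha> < \<beta>" "\<beta> < \<alpha> + d"
      then have "(S \<beta> - S \<alpha>) / (\<beta> - \<alpha>) > S' / 2" using d(2) by (simp add: dist_real_def)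
      then show "S \<beta> - S \<alpha> > S' / 2 * (\<beta> - \<alpha>)" using \<open>\<alpha> < \<beta>\<close> by (simp add: field_simps)
    qed
  qed
  define c0 where "c0 = S' / 2 / P powr (e - 1)"
  have c0: "c0 > 0" unfolding c0_def using S'pos facts(1) by simp
  obtain C where C: "C > 0" "\<And>\<beta>. \<alpha> \<le> \<beta> \<Longrightarrow> \<beta> < 1 \<Longrightarrow> P_per q \<beta> \<le> P \<and> P - P_per q \<beta> \<le> C * (\<beta> - \<alpha>) \<and>
     (\<forall>x. \<bar>k_prof q \<beta> (P_per q \<beta> / P * x) - k x\<bar> \<le> C * (\<beta> - \<alpha>))"
    using profile_compare[OF \<alpha>] unfolding P_def k_def by blast
  have top: "\<alpha> < top_val" using \<alpha> top_val_gt_1 by simp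
  have rng: "0 < \<alpha> / 2" "\<alpha> / 2 \<le> top_val + \<alpha> / 2" using \<alpha> top by auto
  obtain M where M: "M > 0" "\<And>y z. y \<in> {\<alpha>/2..top_val + \<alpha>/2} \<Longrightarrow> z \<in> {\<alpha>/2..top_val + \<alpha>/2} \<Longrightarrow>
     \<bar>p z - p y - y powr (q - 1) * (z - y)\<bar> \<le> M * (z - y)\<^sup>2"
    using p_taylor[OF rng] by blast
  have kq_cont: "continuous_on UNIV (\<lambda>x. k x powr (q - 1))"
    using bds(3) by (intro continuous_on_powr facts(6) continuous_intros) (metis less_irrefl)
  define K where "K = integral {0..P} (\<lambda>x. k x powr (q - 1))"
  have K: "((\<lambda>x. k x powr (q - 1)) has_integral K) {0..P}"
    unfolding K_def by (intro integrable_integral integrable_continuous_real continuous_on_subset[OF kq_cont]) simp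
  have "K > 0"
  proof -
    have "((\<lambda>x. \<alpha> powr (q - 1)) has_integral \<alpha> powr (q - 1) * P) {0..P}"
      using has_integral_const_real[of "\<alpha> powr (q - 1)" 0 P] facts(1) by (simp add: mult.commute)
    from has_integral_le[OF this K] have "\<alpha> powr (q - 1) * P \<le> K"
      using bds(1) \<alpha> q by (simp add: powr_mono2)
    moreover have "\<alpha> powr (q - 1) * P > 0" using \<alpha> facts(1) by simp
    ultimately show ?thesis by linarith
  qed
  \<comment> \<open>The first summand accounts for the amplitude factor \<open>a\<close>, through 1
    - a, and \<open>C\<close> for the distance of the profiles at corresponding times.\<close>
  define C1 where "C1 = top_val * (max 1 e * (C / P)) + C"
  have C1: "C1 > 0" unfolding C1_def using C(1) facts(1) top \<alpha> by (intro add_nonneg_pos mult_nonneg_nonneg) auto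
  \<comment> \<open>In order, the bounds keep \<beta> in the range of the difference quotient, below
    1, keep \<open>kt\<close> in the interval of the Taylor bound, and make the cubic error 3 M P
    (C1 \<Delta>)^3 smaller than the quadratic gain.\<close>
  define \<Delta> where "\<Delta> = min (min (\<delta>0 / 2) ((1 - \<alpha>) / 2)) (min (\<alpha> / (2 * C1)) ((c0 / P)\<^sup>2 * K / (2 * (3 * M * P * C1^3))))"
  have den: "2 * (3 * M * P * C1^3) > 0" using M(1) facts(1) C1 by simp
  have \<Delta>: "\<Delta> > 0"
    unfolding \<Delta>_def using \<delta>0(1) \<alpha> C1 c0 \<open>K > 0\<close> facts(1) den by (simp add: zero_less_power2)
  have \<Delta>_le: "\<Delta> \<le> \<delta>0 / 2" "\<Delta> \<le> (1 - \<alpha>) / 2" "\<Delta> \<le> \<alpha> / (2 * C1)"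
    "\<Delta> \<le> (c0 / P)\<^sup>2 * K / (2 * (3 * M * P * C1^3))"
    unfolding \<Delta>_def by (simp_all only: min_le_iff_disj order_refl simp_thms)
  define \<beta> where "\<beta> = \<alpha> + \<Delta>"
  have \<beta>: "0 < \<beta>" "\<beta> < 1" "\<alpha> < \<beta>" "\<beta> < \<alpha> + \<delta>0" and \<beta>\<alpha>: "\<beta> - \<alpha> = \<Delta>"
    unfolding \<beta>_def using \<alpha> \<Delta> \<Delta>_le(1,2) \<delta>0(1) by auto
  note bfacts = k_prof_facts[OF \<beta>(1,2)] and bbds = k_prof_bounds[OF \<beta>(1,2)]
  define l where "l = k_prof q \<beta>"
  define Q where "Q = P_per q \<beta>"
  define z where "z = Q / P"
  have Q: "Q > 0" unfolding Q_def by (rule bfacts)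
  have CC: "Q \<le> P" "P - Q \<le> C * \<Delta>" "\<And>x. \<bar>l (z * x) - k x\<bar> \<le> C * \<Delta>"
    using C(2)[of \<beta>] \<beta> \<beta>\<alpha> unfolding Q_def z_def l_def by auto
  have z: "0 < z" "z \<le> 1" "z * P = Q" unfolding z_def using Q CC(1) facts(1) by auto
  have "1 - z = (P - Q) / P" unfolding z_def using facts(1) by (simp add: diff_divide_distrib)
  then have z1: "1 - z \<le> C / P * \<Delta>"
    using divide_right_mono[OF CC(2), of P] facts(1) by simp
  define a where "a = z powr e"
  have a: "0 < a" "a \<le> 1" unfolding a_def using z e by (auto intro: powr_le1)
  have a1: "1 - a \<le> max 1 e * (C / P) * \<Delta>"
  proof -
    have "1 - a \<le> max 1 e * (1 - z)" unfolding a_def using powr_ge_one_minus z e by blast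
    also have "\<dots> \<le> max 1 e * (C / P * \<Delta>)" using z1 by (intro mult_left_mono) auto
    finally show ?thesis by (simp add: mult.assoc)
  qed
  define D where "D = a * z\<^sup>2"
  have D: "D \<le> 1" unfolding D_def using a z by (simp add: mult_le_one power_le_one)
  \<comment> \<open>\<open>kt\<close> satisfies the equation with \<open>D\<close> in place of 1.
    The sign \<open>d \<le> 0\<close> is where the period comparison enters: Q \<le> P gives z \<le>
    1 and hence D \<le> 1.\<close>
  define d where "d = (D - 1) / q"
  have d: "d \<le> 0" unfolding d_def using D q by (simp add: divide_nonpos_pos)
  define kt where "kt x = a * l (z * x)" for x
  have l_pos: "l x > 0" "l x \<le> top_val" for x unfolding l_def by (rule bbds)+
  have kt_pos: "kt x > 0" for x unfolding kt_def using a l_pos by simp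
  define w where "w x = kt x - k x" for x
  define w1 where "w1 x = a * z * deriv l (z * x) - deriv k x" for x
  define w2 where "w2 x = - (a * z\<^sup>2 * p (l (z * x))) + p (k x)" for x
  define W where "W = C1 * \<Delta>"
  have W: "\<bar>w x\<bar> \<le> W" for x
  proof -
    have tri: "\<bar>- s + t\<bar> \<le> s + \<bar>t\<bar>" if "s \<ge> 0" for s t :: real using that by arith
    have eq: "w x = - ((1 - a) * l (z * x)) + (l (z * x) - k x)" unfolding w_def kt_def by (simp add: algebra_simps)
    have "\<bar>w x\<bar> \<le> (1 - a) * l (z * x) + \<bar>l (z * x) - k x\<bar>"
      unfolding eq by (rule tri) (use a l_pos(1)[of "z * x"] in simp)
    also have "\<dots> \<le> (max 1 e * (C / P) * \<Delta>) * top_val + C * \<Delta>"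
      using a1 a l_pos[of "z * x"] CC(3)[of x] by (intro add_mono mult_mono) auto
    also have "\<dots> = W" unfolding W_def C1_def by (simp add: algebra_simps)
    finally show ?thesis .
  qed
  have W_half: "W \<le> \<alpha> / 2" using \<Delta>_le(3) C1 unfolding W_def by (simp add: field_simps)
  have W0: "W > 0" unfolding W_def using C1 \<Delta> by simp
  have aff: "((\<lambda>x. z * x) has_real_derivative z) (at x)" for x by (auto intro!: derivative_eq_intros)
  have lD: "(l has_real_derivative deriv l x) (at x)" "(deriv l has_real_derivative - p (l x)) (at x)" for x
    unfolding l_def by (rule bfacts)+
  have w_D: "(w has_real_derivative w1 x) (at x)" for x
  proof -
    have "((\<lambda>x. a * l (z * x) - k x) has_real_derivative a * (deriv l (z * x) * z) - deriv k x) (at x)"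
      by (intro DERIV_diff DERIV_cmult DERIV_chain2[OF lD(1) aff] facts(4))
    then show ?thesis unfolding w_def[abs_def] kt_def w1_def by (simp add: mult_ac)
  qed
  have w1_D: "(w1 has_real_derivative w2 x) (at x)" for x
  proof -
    have "((\<lambda>x. a * z * deriv l (z * x) - deriv k x) has_real_derivative a * z * (- p (l (z * x)) * z) - - p (k x)) (at x)"
      by (intro DERIV_diff DERIV_cmult DERIV_chain2[OF lD(2) aff] facts(5))
    then show ?thesis unfolding w1_def[abs_def] w2_def by (simp add: mult_ac power2_eq_square)
  qed
  have w_per: "has_period P w"
    unfolding has_period_def
  proof
    fix x
    have "z * (x + P) = z * x + Q" using z(3) by (simp add: algebra_simps)
    moreover have "l (z * x + Q) = l (z * x)" using bfacts(2) unfolding l_def Q_def has_period_def by blast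
    moreover have "k (x + P) = k x" using facts(2) unfolding has_period_def by blast
    ultimately show "w (x + P) = w x" unfolding w_def kt_def by simp
  qed
  \<comment> \<open>Minus the Taylor remainder of \<open>p\<close> at \<open>k x\<close>, hence
    quadratic in \<open>w\<close>.\<close>
  define \<eta> where "\<eta> x = - (p (kt x) - p (k x) - k x powr (q - 1) * w x)" for x
  have lin: "w2 x + k x powr (q - 1) * w x = d + \<eta> x" for x
  proof -
    have "a powr q = a powr (q - 1) * a" using a powr_add[of a "q - 1" 1] by simp
    moreover have "a powr (q - 1) = z\<^sup>2"
      unfolding a_def powr_powr e(2) using z by simp
    ultimately have aq: "a powr q = D" unfolding D_def by simp
    have "kt x powr q = D * l (z * x) powr q"
      unfolding kt_def using a l_pos(1)[of "z * x"] aq by (simp add: powr_mult)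
    then have "p (kt x) = a * z\<^sup>2 * p (l (z * x)) + d"
      unfolding p_def d_def D_def[symmetric] by (simp add: diff_divide_distrib right_diff_distrib)
    then show ?thesis unfolding w2_def \<eta>_def by simp
  qed
  have \<eta>_bound: "\<bar>\<eta> x\<bar> \<le> M * W\<^sup>2" for x
  proof -
    have "k x \<in> {\<alpha>/2..top_val + \<alpha>/2}" "kt x \<in> {\<alpha>/2..top_val + \<alpha>/2}"
      using bds(1,2)[of x] W[of x] W_half \<alpha> unfolding w_def by auto
    from M(2)[OF this] have "\<bar>\<eta> x\<bar> \<le> M * (w x)\<^sup>2" unfolding \<eta>_def w_def by simp
    also have "\<dots> \<le> M * W\<^sup>2" using W[of x] W0 M(1) by (intro mult_left_mono abs_le_square_iff[THEN iffD1]) auto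
    finally show ?thesis .
  qed
  have w_cont: "continuous_on UNIV w" using w_D by (meson DERIV_isCont continuous_at_imp_continuous_on)
  \<comment> \<open>\<open>kt\<close> has integral z^(e-1) A(\<beta>) over a period, and with z = Q
    / P its excess over A(\<alpha>) is the increment of \<open>S\<close> up to the fixed factor
    P^(1-e).\<close>
  define I where "I = (S \<beta> - S \<alpha>) / P powr (e - 1)"
  have I: "(w has_integral I) {0..P}"
  proof -
    obtain F where F: "\<And>x. (F has_real_derivative l x) (at x)"
      using antiderivative_exists[OF bfacts(6)] unfolding l_def by blast
    have "((\<lambda>x. a / z * F (z * x)) has_real_derivative a / z * (l (z * x) * z)) (at x)" for x
      by (intro DERIV_cmult DERIV_chain2[OF F aff])
    then have "((\<lambda>x. a / z * F (z * x)) has_real_derivative kt x) (at x)" for x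
      unfolding kt_def using z(1) by simp
    from has_integral_antiderivative[OF less_imp_le[OF facts(1)] this]
    have "(kt has_integral a / z * (F Q - F 0)) {0..P}"
      by (simp add: z(3) right_diff_distrib)
    moreover have "F Q - F 0 = A_area q \<beta>"
      using has_integral_unique[OF has_integral_antiderivative[OF less_imp_le[OF Q] F]]
        A_area_pos(2)[OF \<beta>(1,2)] unfolding l_def Q_def by blast
    ultimately have "(w has_integral a / z * A_area q \<beta> - A) {0..P}"
      unfolding w_def using has_integral_diff[OF _ area(2)] by simp
    moreover have "a / z * A_area q \<beta> - A = I"
    proof -
      have "a / z = z powr (e - 1)" unfolding a_def using z(1) by (simp add: powr_diff)
      also have "\<dots> = Q powr (e - 1) / P powr (e - 1)" unfolding z_def using Q facts(1) by (simp add: powr_divide)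
      finally show ?thesis
        unfolding I_def S[OF \<beta>(1,2)] S[OF \<alpha>] P_def[symmetric] Q_def[symmetric] A_def[symmetric]
        using facts(1) by (simp add: diff_divide_distrib)
    qed
    ultimately show ?thesis by simp
  qed
  have I_lower: "I > c0 * \<Delta>"
  proof -
    have "S \<beta> - S \<alpha> > S' / 2 * \<Delta>" using \<delta>0(2)[OF \<beta>(3,4)] unfolding \<beta>\<alpha> .
    from divide_strict_right_mono[OF this, of "P powr (e - 1)"]
    have "S' / 2 * \<Delta> / P powr (e - 1) < I" unfolding I_def using facts(1) by simp
    then show ?thesis unfolding c0_def by simp
  qed
  have I_upper: "\<bar>I\<bar> \<le> W * P"
    using has_integral_bound_real[OF _ finite.emptyI I, of W] W W0 facts(1) by simp
  define c where "c = - I / P"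
  have cW: "\<bar>c\<bar> \<le> W" using I_upper facts(1) unfolding c_def by (simp add: field_simps)
  have w2_cont: "continuous_on UNIV w2"
  proof -
    have "isCont (\<lambda>x. p (k x)) x" for x
      by (rule DERIV_isCont, rule DERIV_chain2[where f = p and g = k, OF p_D[OF bds(3)] facts(4)])
    moreover have "isCont (\<lambda>x. p (l (z * x))) x" for x
      by (rule DERIV_isCont, rule DERIV_chain2[where f = p and g = "\<lambda>x. l (z * x)",
            OF p_D[OF l_pos(1)] DERIV_chain2[where f = l and g = "\<lambda>x. z * x", OF lD(1) aff]])
    ultimately have "continuous_on UNIV (\<lambda>x. p (k x))" "continuous_on UNIV (\<lambda>x. p (l (z * x)))"
      by (simp_all add: continuous_at_imp_continuous_on)
    then show ?thesis unfolding w2_def[abs_def] by (intro continuous_intros)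
  qed
  have "\<eta> x = w2 x + k x powr (q - 1) * w x - d" for x using lin[of x] by simp
  then have "\<eta> = (\<lambda>x. w2 x + k x powr (q - 1) * w x - d)" by (rule ext)
  moreover have "continuous_on UNIV (\<lambda>x. w2 x + k x powr (q - 1) * w x - d)"
    by (intro continuous_intros w2_cont kq_cont w_cont)
  ultimately have \<eta>_cont: "continuous_on UNIV \<eta>" by simp
  define N where "N = integral {0..P} (\<lambda>x. (w x + 2 * c) * \<eta> x)"
  have Nc: "continuous_on UNIV (\<lambda>x. (w x + 2 * c) * \<eta> x)" by (intro continuous_intros w_cont \<eta>_cont)
  have N: "((\<lambda>x. (w x + 2 * c) * \<eta> x) has_integral N) {0..P}"
    unfolding N_def by (intro integrable_integral integrable_continuous_real continuous_on_subset[OF Nc]) simp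
  have N_bound: "\<bar>N\<bar> \<le> 3 * W * (M * W\<^sup>2) * P"
  proof -
    have "norm ((w x + 2 * c) * \<eta> x) \<le> 3 * W * (M * W\<^sup>2)" for x
    proof -
      have "\<bar>w x + 2 * c\<bar> \<le> 3 * W" using W[of x] cW by linarith
      then show ?thesis unfolding real_norm_def abs_mult using \<eta>_bound[of x] W0 by (intro mult_mono) auto
    qed
    then show ?thesis
      using has_integral_bound_real[OF _ finite.emptyI N, of "3 * W * (M * W\<^sup>2)"] W0 M(1) facts(1) by simp
  qed
  define v where "v x = w x + c" for x
  define J where "J = d * I - N - c\<^sup>2 * K"
  have dv: "deriv v x = w1 x" for x
    unfolding v_def[abs_def] by (rule DERIV_imp_deriv) (auto intro!: derivative_eq_intros w_D)
  have "((\<lambda>x. (deriv v x)\<^sup>2 - k x powr (q - 1) * (v x)\<^sup>2) has_integral J) {0..P}"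
    unfolding dv v_def J_def
    by (rule quadratic_form_shift[OF w_D w1_D w_per facts(1) lin I c_def K N])
  \<comment> \<open>\<open>d * I\<close> is nonpositive, \<open>\<bar>N\<bar>\<close> is at most 3 M
    P W^3, and c^2 K exceeds (c0 \<Delta> / P)^2 K, which the choice of \<open>\<Delta>\<close> puts
    above that cubic bound.\<close>
  moreover have "J < 0"
  proof -
    have "I > 0" using I_lower c0 \<Delta> by (meson less_trans mult_pos_pos)
    then have "d * I \<le> 0" using d by (simp add: mult_nonpos_nonneg)
    have "c\<^sup>2 = (I / P)\<^sup>2" unfolding c_def by simp
    moreover have "(c0 * \<Delta> / P)\<^sup>2 < (I / P)\<^sup>2"
      using I_lower c0 \<Delta> facts(1) by (intro power_strict_mono divide_strict_right_mono) auto
    ultimately have "(c0 * \<Delta> / P)\<^sup>2 * K < c\<^sup>2 * K" using \<open>K > 0\<close> by simp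
    moreover have "3 * W * (M * W\<^sup>2) * P \<le> (c0 * \<Delta> / P)\<^sup>2 * K"
    proof -
      have "(3 * M * P * C1^3) * \<Delta> \<le> (c0 / P)\<^sup>2 * K"
      proof -
        have "\<Delta> * (2 * (3 * M * P * C1^3)) \<le> (c0 / P)\<^sup>2 * K"
          using \<Delta>_le(4) unfolding pos_le_divide_eq[OF den] .
        then have "2 * ((3 * M * P * C1^3) * \<Delta>) \<le> (c0 / P)\<^sup>2 * K"
          by (simp only: mult_ac)
        moreover have "(3 * M * P * C1^3) * \<Delta> > 0"
          using M(1) facts(1) C1 \<Delta> by (intro mult_pos_pos) auto
        ultimately show ?thesis by linarith
      qed
      then have "\<Delta>\<^sup>2 * ((3 * M * P * C1^3) * \<Delta>) \<le> \<Delta>\<^sup>2 * ((c0 / P)\<^sup>2 * K)" by (intro mult_left_mono) auto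
      then show ?thesis unfolding W_def
        by (simp add: power2_eq_square power3_eq_cube mult_ac)
    qed
    ultimately show ?thesis using N_bound \<open>d * I \<le> 0\<close> unfolding J_def by linarith
  qed
  moreover have "(v has_integral 0) {0..P}"
  proof -
    have "((\<lambda>x. c) has_integral c * P) {0..P}"
      using has_integral_const_real[of c 0 P] facts(1) by (simp add: mult.commute)
    from has_integral_add[OF I this] show ?thesis unfolding v_def using facts(1) by (simp add: c_def)
  qed
  moreover have "has_period P v" using w_per by (simp add: has_period_def v_def)
  moreover have "smooth v"
  proof -
    have "smooth l" unfolding l_def by (rule bfacts)
    from smooth_scaled_add[OF this facts(3), of a z 0 "-1" 1 0 c]
    show ?thesis unfolding v_def[abs_def] w_def kt_def by simp
  qed
  ultimately show ?thesis unfolding P_def k_def by blast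
qed

end

theorem theorem2:
  fixes m n B q X x0 :: real and h H :: "real \<Rightarrow> real"
  assumes "B > 0"
    and "q = m - n + 1"
    and "X > 0"
    and "potential B q H"
    and "steady_state B m n X h"
    and "\<not> (\<exists>c. \<forall>x. h x = c)"
    and "\<forall>x. h x0 \<le> h x"
  shows "(\<exists>\<alpha>. rescales_to B q (\<lambda>x. h (x0 + x)) \<alpha>) \<and>
    (q < 1 \<or> q > 2 \<longrightarrow>
       (\<forall>u \<in> {deriv h, \<lambda>x. - deriv h x, deriv (deriv h), \<lambda>x. - deriv (deriv h) x}.
          energy_unstable_dir H X h u)) \<and>
    (\<forall>\<alpha>. rescales_to B q (\<lambda>x. h (x0 + x)) \<alpha> \<longrightarrow>
       q = 2 \<or> (q > 1 \<and> (\<exists>E'. (E_fun q has_real_derivative E') (at \<alpha>) \<and> E' > 0)) \<longrightarrow>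
       energy_unstable H X h)"
proof (intro conjI impI allI)
  interpret steady B q X h "deriv h" "deriv (deriv h)"
    using steady_of_steady_state[OF assms(1,2,3,5)] .
  have nc: "\<exists>x. deriv h x \<noteq> 0"
  proof (rule ccontr)
    assume "\<not> ?thesis"
    then have "(h has_real_derivative 0) (at x)" for x using h_D[of x] by simp
    then have "h x = h 0" for x using DERIV_isconst_all by blast
    then show False using assms(6) by blast
  qed
  show "\<exists>\<alpha>. rescales_to B q (\<lambda>x. h (x0 + x)) \<alpha>"
    using ex_rescales_to[OF nc] assms(7) by blast
  show "\<forall>u \<in> {deriv h, \<lambda>x. - deriv h x, deriv (deriv h), \<lambda>x. - deriv (deriv h) x}.
          energy_unstable_dir H X h u" if "q < 1 \<or> q > 2"
  proof -
    have "(q - 1) * (q - 2) > 0" using that by (auto simp: zero_less_mult_iff)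
    note * = unstable_h1[OF assms(4) nc this] unstable_h2[OF assms(4) nc this]
    show ?thesis using *(1)[of 1] *(1)[of "- 1"] *(2)[of 1] *(2)[of "- 1"] by simp
  qed
  fix \<alpha>
  assume resc: "rescales_to B q (\<lambda>x. h (x0 + x)) \<alpha>"
    and "q = 2 \<or> (q > 1 \<and> (\<exists>E'. (E_fun q has_real_derivative E') (at \<alpha>) \<and> E' > 0))"
  then consider "q = 2" | E' where "q > 1" "(E_fun q has_real_derivative E') (at \<alpha>)" "E' > 0" by blast
  then show "energy_unstable H X h"
  proof cases
    case 1
    then show ?thesis by (rule unstable_quadratic[OF assms(4) nc])
  next
    case 2
    interpret superlinear q using 2(1) by unfold_locales
    obtain D where D: "q \<noteq> 0 \<longrightarrow> D > 0" "rescaled B q D (\<lambda>x. h (x0 + x)) = k_prof q \<alpha>"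
      and \<alpha>: "0 < \<alpha>" "\<alpha> < 1"
      using resc unfolding rescales_to_def by blast
    obtain a b where ab: "a > 0" "b > 0" "\<And>g x. rescaled B q D g x = a * g (b * x)"
      "B * a powr (1 - q) * b\<^sup>2 = 1"
      using rescaled_scaling[OF assms(1) D(1)] by blast
    have k: "k_prof q \<alpha> x = a * h (x0 + b * x)" for x
      unfolding D(2)[symmetric] ab(3) ..
    \<comment> \<open>\<open>X / b\<close> is a period of the profile but perhaps not the least one;
      it is \<open>N\<close> times the least, on which the perturbation is constructed.\<close>
    have "has_period (X / b) (k_prof q \<alpha>)"
      unfolding has_period_def
    proof
      fix x
      have e: "x0 + b * (x + X / b) = (x0 + b * x) + X" using ab(2) by (simp add: field_simps)
      have "h ((x0 + b * x) + X) = h (x0 + b * x)" using h_per unfolding has_period_def by blast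
      then show "k_prof q \<alpha> (x + X / b) = k_prof q \<alpha> x" unfolding k e by simp
    qed
    then obtain N where "X / b = real N * P_per q \<alpha>"
      using period_multiple[OF \<alpha>] X_pos ab(2) by (meson divide_pos_pos)
    then have N: "X = real N * (b * P_per q \<alpha>)" using ab(2) by (simp add: field_simps)
    obtain v J where v: "smooth v" "has_period (P_per q \<alpha>) v" "(v has_integral 0) {0..P_per q \<alpha>}"
      "((\<lambda>x. (deriv v x)\<^sup>2 - k_prof q \<alpha> x powr (q - 1) * (v x)\<^sup>2) has_integral J) {0..P_per q \<alpha>}" "J < 0"
      using profile_unstable[OF \<alpha> 2(2,3)] by blast
    show ?thesis
      by (rule unstable_of_profile[OF assms(4) ab(1,2,4) k k_prof_facts(1)[OF \<alpha>] N v(1,2,3)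
            k_prof_facts(2)[OF \<alpha>] v(4,5)])
  qed
qed

end
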